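(* If an $\omega$-narrow semitopological group $G$ acts continuously and transitively on a pseudocompact space $X$ and $G$ is a $k$-space, then the Stone–Čech compactification $\beta X$ is a Dugundji space.
   Context: All spaces are Tychonoff (including the underlying spaces of groups). A semitopological group is a group $G$ with a topology making the multiplication $G\times G\to G$ separately continuous. It is $\omega$-narrow if for every neighborhood $U$ of the neutral element there is a countable set $A\subset G$ with $UA=AU=G$. Actions are left actions $\theta:G\times X\to X$, written $\theta(g,x)=gx$; an action is continuous if $\theta$ is (jointly) continuous, and transitive if for every $x\in X$ the map $\theta^x:G\to X$, $\theta^x(g)=gx$, is surjective. A Dugundji space is a compact space $K$ such that for every embedding of $K$ in another compact space $Y$ there is a regular linear extension operator $u:C(K)\to C(Y)$ between the Banach spaces of continuous real-valued functions, i.e. $u$ is linear, $u(f)|_K=f$ for all $f$, $u(1)=1$, and $u(f)\ge 0$ whenever $f\ge 0$. *)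

theory Defs
  imports "HOL-Analysis.Analysis" "HOL-Algebra.Group_Action"
begin

definition tychonoff_space :: "'a topology \<Rightarrow> bool"
  where "tychonoff_space X \<longleftrightarrow> completely_regular_space X \<and> Hausdorff_space X"

definition pseudocompact_space :: "'a topology \<Rightarrow> bool"
  where "pseudocompact_space X \<longleftrightarrow>
    (\<forall>f. continuous_map X euclideanreal f \<longrightarrow> bounded (f ` topspace X))"

definition semitopological_group :: "('g, 'm) monoid_scheme \<Rightarrow> 'g topology \<Rightarrow> bool"
  where "semitopological_group G T \<longleftrightarrow>
    group G \<and> topspace T = carrier G \<and>
    (\<forall>g\<in>carrier G. continuous_map T T (\<lambda>h. g \<otimes>\<^bsub>G\<^esub> h)) \<and>
    (\<forall>g\<in>carrier G. continuous_map T T (\<lambda>h. h \<otimes>\<^bsub>G\<^esub> g))"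

text \<open>As usual, a neighbourhood need not be open.\<close>

definition omega_narrow :: "('g, 'm) monoid_scheme \<Rightarrow> 'g topology \<Rightarrow> bool"
  where "omega_narrow G T \<longleftrightarrow>
    (\<forall>U. U \<subseteq> carrier G \<and> (\<exists>V. openin T V \<and> \<one>\<^bsub>G\<^esub> \<in> V \<and> V \<subseteq> U) \<longrightarrow>
      (\<exists>A. A \<subseteq> carrier G \<and> countable A \<and>
        U <#>\<^bsub>G\<^esub> A = carrier G \<and> A <#>\<^bsub>G\<^esub> U = carrier G))"

definition continuous_action ::
    "'g topology \<Rightarrow> 'x topology \<Rightarrow> ('g \<Rightarrow> 'x \<Rightarrow> 'x) \<Rightarrow> bool"
  where "continuous_action T X \<theta> \<longleftrightarrow>
    continuous_map (prod_topology T X) X (\<lambda>(g, x). \<theta> g x)"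

text \<open>
  \<open>cont_functions X\<close> is \<open>C(X)\<close>. Functions are required to be
  \<^const>\<open>extensional\<close>, so that they are determined by their values on \<^term>\<open>topspace X\<close>.
\<close>

definition cont_functions :: "'a topology \<Rightarrow> ('a \<Rightarrow> real) set"
  where "cont_functions X = {f. continuous_map X euclideanreal f} \<inter> extensional (topspace X)"

text \<open>\<open>u : C(K) \<rightarrow> C(Y)\<close> extends functions along the embedding \<open>e\<close> of \<open>K\<close> in \<open>Y\<close>.\<close>

definition regular_extension_operator ::
    "'k topology \<Rightarrow> 'y topology \<Rightarrow> ('k \<Rightarrow> 'y) \<Rightarrow> (('k \<Rightarrow> real) \<Rightarrow> ('y \<Rightarrow> real)) \<Rightarrow> bool"
  where "regular_extension_operator K Y e u \<longleftrightarrow>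
    u \<in> cont_functions K \<rightarrow> cont_functions Y \<and>
    (\<forall>f\<in>cont_functions K. \<forall>g\<in>cont_functions K.
      u (\<lambda>x\<in>topspace K. f x + g x) = (\<lambda>y\<in>topspace Y. u f y + u g y)) \<and>
    (\<forall>c. \<forall>f\<in>cont_functions K. u (\<lambda>x\<in>topspace K. c * f x) = (\<lambda>y\<in>topspace Y. c * u f y)) \<and>
    (\<forall>f\<in>cont_functions K. \<forall>x\<in>topspace K. u f (e x) = f x) \<and>
    u (\<lambda>x\<in>topspace K. 1) = (\<lambda>y\<in>topspace Y. 1) \<and>
    (\<forall>f\<in>cont_functions K. (\<forall>x\<in>topspace K. f x \<ge> 0) \<longrightarrow> (\<forall>y\<in>topspace Y. u f y \<ge> 0))"

text \<open>
  A definition cannot quantify over all compact spaces \<open>Y\<close> on all types, so the point type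
  \<open>'y\<close> of \<open>Y\<close> is a parameter. When \<open>dugundji_space TYPE('y) K\<close> is the conclusion of a theorem,
  \<open>'y\<close> is universally quantified and \<open>Y\<close> ranges over all compact spaces.
\<close>

definition dugundji_space :: "'y itself \<Rightarrow> 'k topology \<Rightarrow> bool"
  where "dugundji_space (_ :: 'y itself) K \<longleftrightarrow>
    compact_space K \<and> Hausdorff_space K \<and>
    (\<forall>(Y :: 'y topology) e. compact_space Y \<and> Hausdorff_space Y \<and> embedding_map K Y e \<longrightarrow>
      (\<exists>u. regular_extension_operator K Y e u))"

text \<open>
  The Stone-Cech compactification is the closure of the image of \<open>X\<close> under the evaluation map
  into the cube \<open>[0,1]\<close> to the power \<open>C(X,[0,1])\<close>.
\<close>

definition unit_functions :: "'a topology \<Rightarrow> ('a \<Rightarrow> real) set"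
  where "unit_functions X =
    {f. continuous_map X (top_of_set {0..1}) f} \<inter> extensional (topspace X)"

definition stone_cech_cube :: "'a topology \<Rightarrow> (('a \<Rightarrow> real) \<Rightarrow> real) topology"
  where "stone_cech_cube X = product_topology (\<lambda>_. top_of_set {0..1}) (unit_functions X)"

definition stone_cech_map :: "'a topology \<Rightarrow> 'a \<Rightarrow> ('a \<Rightarrow> real) \<Rightarrow> real"
  where "stone_cech_map X x = (\<lambda>f\<in>unit_functions X. f x)"

definition stone_cech :: "'a topology \<Rightarrow> (('a \<Rightarrow> real) \<Rightarrow> real) topology"
  where "stone_cech X = subtopology (stone_cech_cube X)
    (stone_cech_cube X closure_of (stone_cech_map X ` topspace X))"

lemma unit_functions_restrict:
  assumes "continuous_map X (top_of_set {0..1::real}) f"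
  shows "restrict f (topspace X) \<in> unit_functions X"
proof -
  have "continuous_map X (top_of_set {0..1}) (restrict f (topspace X))"
    by (rule continuous_map_eq [OF assms]) simp
  then show ?thesis
    by (simp add: unit_functions_def)
qed

lemma compact_Hausdorff_stone_cech_cube:
  "compact_space (stone_cech_cube X)" "Hausdorff_space (stone_cech_cube X)"
  unfolding stone_cech_cube_def
  by (auto simp: compact_space_product_topology compact_space_subtopology
      Hausdorff_space_product_topology Hausdorff_space_subtopology)

lemma compact_space_stone_cech: "compact_space (stone_cech X)"
  unfolding stone_cech_def
  by (simp add: closedin_compact_space compact_Hausdorff_stone_cech_cube compact_space_subtopology)

lemma Hausdorff_space_stone_cech: "Hausdorff_space (stone_cech X)"
  unfolding stone_cech_def
  by (simp add: Hausdorff_space_subtopology compact_Hausdorff_stone_cech_cube)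

lemma continuous_map_stone_cech_cube: "continuous_map X (stone_cech_cube X) (stone_cech_map X)"
  unfolding stone_cech_cube_def continuous_map_componentwise
  by (auto simp: stone_cech_map_def unit_functions_def)

lemma stone_cech_map_image: "stone_cech_map X ` topspace X \<subseteq> topspace (stone_cech_cube X)"
  using continuous_map_stone_cech_cube by (rule continuous_map_image_subset_topspace)

lemma embedding_map_stone_cech_cube:
  assumes "tychonoff_space X"
  shows "embedding_map X (stone_cech_cube X) (stone_cech_map X)"
proof -
  have "unit_functions X =
      mspace (submetric (cfunspace X euclidean_metric) {f. f \<in> topspace X \<rightarrow> {0..1}})"
    by (auto simp: unit_functions_def continuous_map_in_subtopology
        intro: bounded_subset [OF bounded_closed_interval])
  then show ?thesis
    using completely_regular_space_cube_embedding_explicit [of X] assms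
    by (simp add: tychonoff_space_def stone_cech_cube_def stone_cech_map_def [abs_def])
qed

lemma embedding_map_stone_cech:
  assumes "tychonoff_space X"
  shows "embedding_map X (stone_cech X) (stone_cech_map X)"
  unfolding stone_cech_def
  using embedding_map_stone_cech_cube [OF assms] closure_of_subset [OF stone_cech_map_image [of X]]
  by (simp add: embedding_map_in_subtopology)

lemma stone_cech_dense:
  "stone_cech X closure_of (stone_cech_map X ` topspace X) = topspace (stone_cech X)"
  unfolding stone_cech_def
  using closure_of_subset [OF stone_cech_map_image [of X]]
  by (simp add: closure_of_subtopology Int_absorb1 closure_of_subset_topspace)

lemma stone_cech_extension:
  fixes X :: "'a topology" and Z :: "'b topology"
  assumes Z: "compact_space Z" "Hausdorff_space Z" and h: "continuous_map X Z h"
  obtains k where "continuous_map (stone_cech X) Z k"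
    and "\<And>x. x \<in> topspace X \<Longrightarrow> k (stone_cech_map X x) = h x"
proof -
  let ?E = "stone_cech_map Z ` topspace Z"
  define r where "r p = (\<lambda>g\<in>unit_functions Z. p (restrict (g \<circ> h) (topspace X)))"
    for p :: "('a \<Rightarrow> real) \<Rightarrow> real"
  have gh: "restrict (g \<circ> h) (topspace X) \<in> unit_functions X" if "g \<in> unit_functions Z" for g
    using that h by (intro unit_functions_restrict continuous_map_compose) (auto simp: unit_functions_def)
  have r: "continuous_map (stone_cech_cube X) (stone_cech_cube Z) r"
    unfolding stone_cech_cube_def [of Z] continuous_map_componentwise
    using gh by (auto simp: r_def stone_cech_cube_def intro: continuous_map_product_projection)
  have rx: "r (stone_cech_map X x) = stone_cech_map Z (h x)" if "x \<in> topspace X" for x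
    using gh that by (auto simp: r_def stone_cech_map_def fun_eq_iff)
  have hx: "h x \<in> topspace Z" if "x \<in> topspace X" for x
    using h that by (auto simp: continuous_map_def)
  have "compactin (stone_cech_cube Z) ?E"
    using Z(1) continuous_map_stone_cech_cube by (metis compact_space_def image_compactin)
  then have E: "closedin (stone_cech_cube Z) ?E"
    by (simp add: compactin_imp_closedin compact_Hausdorff_stone_cech_cube)
  have "r ` (stone_cech_cube X closure_of (stone_cech_map X ` topspace X))
      \<subseteq> stone_cech_cube Z closure_of (r ` stone_cech_map X ` topspace X)"
    using r by (rule continuous_map_image_closure_subset)
  also have "\<dots> \<subseteq> ?E"
    using rx hx by (intro closure_of_minimal [OF _ E]) auto
  finally have "continuous_map (stone_cech X) (subtopology (stone_cech_cube Z) ?E) r"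
    unfolding stone_cech_def
    by (auto simp: continuous_map_in_subtopology r continuous_map_from_subtopology closure_of_subset_topspace)
  moreover have "tychonoff_space Z"
    unfolding tychonoff_space_def using Z
    by (simp add: compact_Hausdorff_or_regular_imp_normal_space normal_imp_completely_regular_space)
  then obtain i where i: "homeomorphic_maps Z (subtopology (stone_cech_cube Z) ?E) (stone_cech_map Z) i"
    using embedding_map_stone_cech_cube unfolding embedding_map_def homeomorphic_map_maps by blast
  ultimately have "continuous_map (stone_cech X) Z (i \<circ> r)"
    by (meson continuous_map_compose homeomorphic_maps_def)
  moreover have "(i \<circ> r) (stone_cech_map X x) = h x" if "x \<in> topspace X" for x
    using i rx hx that by (simp add: homeomorphic_maps_def)
  ultimately show thesis
    using that by blast
qed

end

theory Submission
  imports Defs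
begin

text \<open>
  Write \<open>K\<close> for the Stone-Cech compactification and \<open>S \<subseteq> K\<close> for the image of \<open>X\<close>.

  The group enters through the orbits of functions. Let \<open>F \<in> C(K)\<close>. On a compact set of group
  elements, joint continuity of the action and pseudocompactness of \<open>X\<close> make \<open>g \<mapsto> F \<circ> g\<close> norm
  continuous, and since \<open>G\<close> is a k-space this holds on all of \<open>G\<close>
  (\<open>k_space_uniform_neighbourhood\<close>). So the elements that move \<open>F\<close> by at most \<open>\<epsilon>\<close> form a
  neighbourhood of the neutral element, and \<open>\<omega>\<close>-narrowness makes the orbit of \<open>F\<close> norm separable.
  The locale \<open>homogeneous_compactum\<close> records this together with transitivity on \<open>S\<close> and the fact
  that \<open>S\<close> meets every nonempty zero set of \<open>K\<close>, which is what pseudocompactness says about \<open>K\<close>.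

  A set \<open>J \<subseteq> C(K)\<close> maps \<open>K\<close> onto a compact subset \<open>K\<^sub>J\<close> of the product \<open>\<real>\<^sup>J\<close>. Call \<open>J\<close> invariant if
  the group permutes the fibres of this map. By separability of orbits every function belongs to a
  countable invariant set, and unions of invariant sets are invariant. The heart of the proof is
  that \<open>K \<rightarrow> K\<^sub>J\<close> is an open map for invariant \<open>J\<close> (\<open>invariant_openly_fibred\<close>). It is a Baire
  category argument: for a small neighbourhood \<open>V\<close> of the neutral element, countably many sets
  \<open>a V x\<close> cover \<open>S\<close>, so the image of one of them in \<open>K\<^sub>J\<close> is somewhere dense, and translating
  back shows that the closure of the image of \<open>V\<^sup>-\<^sup>1 V x\<close> is a neighbourhood of the image of \<open>x\<close>
  (\<open>locally_dense_orbit\<close>). A countable cover by cozero sets carries the conclusion from \<open>S\<close> to \<open>K\<close>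
  (\<open>fibres_vary_openly\<close>).

  Thus \<open>K\<close> is the limit of a well-ordered system of open maps in which each step adds only
  countably many coordinates, and Haydon's method applies. Given an embedding \<open>e : K \<rightarrow> Y\<close>, a
  regular extension operator on the functions that factor through \<open>K\<^sub>J\<close> is enlarged by countably
  many coordinates at a time (\<open>regular_on_countable_extension\<close>), unions of chains are handled by
  density, and Zorn's lemma reaches all of \<open>C(K)\<close> (\<open>regular_on_exists\<close>). A single enlargement needs
  probability measures on the fibre through \<open>x\<close> that depend continuously on \<open>x \<in> K\<close> and \<open>y \<in> Y\<close>
  and reduce to a point mass at \<open>x\<close> when \<open>y = e x\<close>. A selection theorem would provide them; here
  they are the limit distributions of an explicit random walk that starts at \<open>y\<close> and whose \<open>n\<close>-th
  step ends within \<open>2\<^sup>-\<^sup>n\<close> of the fibre (locale \<open>fibrewise_walk\<close>).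
\<close>

section \<open>Continuity and compactness\<close>

text \<open>
  Functions on a product are curried, with projections in place of a pattern, so that the
  introduction rules for continuity apply to the body directly.
\<close>

abbreviation jointly_continuous ::
    "'a topology \<Rightarrow> 'b topology \<Rightarrow> ('a \<Rightarrow> 'b \<Rightarrow> real) \<Rightarrow> bool"
  where "jointly_continuous K Y \<Phi> \<equiv>
    continuous_map (prod_topology K Y) euclideanreal (\<lambda>p. \<Phi> (fst p) (snd p))"

lemma continuous_map_real_iff:
  "continuous_map X euclideanreal f \<longleftrightarrow>
    (\<forall>x\<in>topspace X. \<forall>\<epsilon>>0. \<exists>U. openin X U \<and> x \<in> U \<and> (\<forall>y\<in>U. \<bar>f y - f x\<bar> < \<epsilon>))"
  using Met_TC.continuous_map_to_metric [of X f]
  by (simp add: dist_real_def abs_minus_commute)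

lemma continuous_map_realD:
  assumes "continuous_map X euclideanreal f" "x \<in> topspace X" "\<epsilon> > 0"
  obtains U where "openin X U" "x \<in> U" "\<And>y. y \<in> U \<Longrightarrow> \<bar>f y - f x\<bar> < \<epsilon>"
proof -
  have "\<exists>U. openin X U \<and> x \<in> U \<and> (\<forall>y\<in>U. \<bar>f y - f x\<bar> < \<epsilon>)"
    using assms by (simp add: continuous_map_real_iff)
  then show thesis
    using that by blast
qed

lemma openin_less:
  assumes "continuous_map X euclideanreal f" "continuous_map X euclideanreal g"
  shows "openin X {x \<in> topspace X. f x < g x}"
proof -
  have "continuous_map X euclideanreal (\<lambda>x. g x - f x)"
    using assms by (intro continuous_intros)
  then have "openin X {x \<in> topspace X. g x - f x \<in> {0<..}}"
    by (rule openin_continuous_map_preimage) simp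
  then show ?thesis by simp
qed

lemma closedin_le:
  assumes "continuous_map X euclideanreal f" "continuous_map X euclideanreal g"
  shows "closedin X {x \<in> topspace X. f x \<le> g x}"
proof -
  have "continuous_map X euclideanreal (\<lambda>x. g x - f x)"
    using assms by (intro continuous_intros)
  then have "closedin X {x \<in> topspace X. g x - f x \<in> {0..}}"
    by (rule closedin_continuous_map_preimage) simp
  then show ?thesis by simp
qed

lemma continuous_map_uniform_approx:
  assumes "\<And>\<epsilon>. \<epsilon> > 0 \<Longrightarrow>
    \<exists>g. continuous_map X euclideanreal g \<and> (\<forall>x\<in>topspace X. \<bar>f x - g x\<bar> \<le> \<epsilon>)"
  shows "continuous_map X euclideanreal f"
  unfolding continuous_map_real_iff
proof (intro ballI allI impI)
  fix x and \<epsilon> :: real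
  assume x: "x \<in> topspace X" and "\<epsilon> > 0"
  then obtain g where g: "continuous_map X euclideanreal g"
    and fg: "\<And>x. x \<in> topspace X \<Longrightarrow> \<bar>f x - g x\<bar> \<le> \<epsilon> / 4"
    using assms [of "\<epsilon> / 4"] by auto
  obtain U where U: "openin X U" "x \<in> U" "\<And>y. y \<in> U \<Longrightarrow> \<bar>g y - g x\<bar> < \<epsilon> / 4"
    using continuous_map_realD [OF g x, of "\<epsilon> / 4"] \<open>\<epsilon> > 0\<close> by auto
  have "\<bar>f y - f x\<bar> < \<epsilon>" if "y \<in> U" for y
  proof -
    have "y \<in> topspace X"
      using that U(1) openin_subset by blast
    then show ?thesis
      using fg [of y] fg [OF x] U(3) [OF that] \<open>\<epsilon> > 0\<close> by linarith
  qed
  then show "\<exists>U. openin X U \<and> x \<in> U \<and> (\<forall>y\<in>U. \<bar>f y - f x\<bar> < \<epsilon>)"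
    using U by blast
qed

lemma jointly_continuous_compose:
  assumes "jointly_continuous K Y \<Phi>" "continuous_map Z K a" "continuous_map Z Y b"
  shows "continuous_map Z euclideanreal (\<lambda>z. \<Phi> (a z) (b z))"
proof -
  have "continuous_map Z (prod_topology K Y) (\<lambda>z. (a z, b z))"
    using assms by (intro continuous_map_pairedI)
  from continuous_map_compose [OF this assms(1)] show ?thesis
    by (simp add: o_def)
qed

lemma jointly_continuous_left:
  assumes "jointly_continuous K Y \<Phi>" "y \<in> topspace Y"
  shows "continuous_map K euclideanreal (\<lambda>x. \<Phi> x y)"
  using assms by (intro jointly_continuous_compose [OF assms(1)]) auto

lemma jointly_continuous_right:
  assumes "jointly_continuous K Y \<Phi>" "x \<in> topspace K"
  shows "continuous_map Y euclideanreal (\<lambda>y. \<Phi> x y)"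
  using assms by (intro jointly_continuous_compose [OF assms(1)]) auto

text \<open>
  Compactness of the first factor makes the modulus of continuity in \<open>y\<close> uniform in \<open>x\<close>: this is
  the tube lemma for the set where \<open>\<Phi> x y'\<close> is close to \<open>\<Phi> x y\<close>.
\<close>

lemma jointly_continuous_uniform:
  assumes K: "compact_space K" and \<Phi>: "jointly_continuous K Y \<Phi>"
    and y: "y \<in> topspace Y" and "\<epsilon> > 0"
  obtains N where "openin Y N" "y \<in> N"
    "\<And>y' x. y' \<in> N \<Longrightarrow> x \<in> topspace K \<Longrightarrow> \<bar>\<Phi> x y' - \<Phi> x y\<bar> < \<epsilon>"
proof -
  let ?W = "{p \<in> topspace (prod_topology K Y). \<bar>\<Phi> (fst p) (snd p) - \<Phi> (fst p) y\<bar> < \<epsilon>}"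
  have "continuous_map (prod_topology K Y) euclideanreal (\<lambda>p. \<Phi> (fst p) y)"
    by (rule jointly_continuous_compose [OF \<Phi>]) (use y in \<open>auto intro: continuous_map_fst\<close>)
  then have "openin (prod_topology K Y) ?W"
    using \<Phi> by (intro openin_less continuous_intros)
  moreover have "topspace K \<times> {y} \<subseteq> ?W"
    using y \<open>\<epsilon> > 0\<close> by auto
  ultimately obtain U V where "topspace K \<subseteq> U" "openin Y V" "y \<in> V" "U \<times> V \<subseteq> ?W"
    using tube_lemma_left [of K Y ?W "topspace K" y] K y by (auto simp: compact_space_def)
  then show thesis
    using that [of V] by force
qed

lemma compact_attains_min:
  assumes "compact_space K" "closedin K A" "A \<noteq> {}" "continuous_map K euclideanreal F"
  obtains q where "q \<in> A" "\<And>q'. q' \<in> A \<Longrightarrow> F q \<le> F q'"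
proof -
  have "compactin K A"
    using assms closedin_compact_space by blast
  then have "compact (F ` A)"
    using assms(4) image_compactin by fastforce
  then obtain s where "s \<in> F ` A" "\<forall>t\<in>F ` A. s \<le> t"
    using compact_attains_inf [of "F ` A"] assms(3) by auto
  then show thesis
    using that by auto
qed

lemma continuous_bounded:
  assumes "compact_space K" "continuous_map K euclideanreal F"
  obtains B where "B > 0" "\<And>x. x \<in> topspace K \<Longrightarrow> \<bar>F x\<bar> \<le> B"
proof -
  have "compact (F ` topspace K)"
    using assms image_compactin [of K "topspace K" euclideanreal F] by (auto simp: compact_space_def)
  then show thesis
    using that by (auto dest!: compact_imp_bounded simp: bounded_pos)
qed

text \<open>
  For functions with values in \<open>[0,1]\<close> this is a continuous function whose zero set is the common
  zero set of all terms. It turns countable families into single functions, both for pseudometrics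
  and for zero sets.
\<close>

definition half_series :: "(nat \<Rightarrow> 'a \<Rightarrow> real) \<Rightarrow> 'a \<Rightarrow> real"
  where "half_series \<phi> x = (\<Sum>i. (1/2) ^ i * \<phi> i x)"

context
  fixes \<phi> :: "nat \<Rightarrow> 'a \<Rightarrow> real" and A :: "'a set"
  assumes \<phi>: "\<And>i x. x \<in> A \<Longrightarrow> 0 \<le> \<phi> i x \<and> \<phi> i x \<le> 1"
begin

lemma half_series_term: "x \<in> A \<Longrightarrow> 0 \<le> (1/2) ^ i * \<phi> i x \<and> (1/2) ^ i * \<phi> i x \<le> (1/2) ^ i"
  using \<phi>[of x i] by (auto intro: mult_left_le)

lemma half_series_summable: "x \<in> A \<Longrightarrow> summable (\<lambda>i. (1/2) ^ i * \<phi> i x)"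
  by (rule summable_comparison_test' [of "\<lambda>i. (1/2) ^ i" 0])
     (use half_series_term in \<open>auto simp: abs_of_nonneg\<close>)

lemma half_series_nonneg: "x \<in> A \<Longrightarrow> 0 \<le> half_series \<phi> x"
  unfolding half_series_def
  using half_series_term half_series_summable by (intro suminf_nonneg) auto

lemma half_series_le_2: "x \<in> A \<Longrightarrow> half_series \<phi> x \<le> 2"
  unfolding half_series_def
  using half_series_term half_series_summable suminf_geometric [of "1/2::real"]
    suminf_le [of "\<lambda>i. (1/2) ^ i * \<phi> i x" "\<lambda>i. (1/2) ^ i"]
  by auto

lemma half_series_eq_0: "x \<in> A \<Longrightarrow> half_series \<phi> x = 0 \<longleftrightarrow> (\<forall>i. \<phi> i x = 0)"
  unfolding half_series_def
  using half_series_term half_series_summable by (subst suminf_eq_zero_iff) auto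

end

lemma continuous_map_half_series:
  assumes cont: "\<And>i. continuous_map X euclideanreal (\<phi> i)"
    and \<phi>: "\<And>i x. x \<in> topspace X \<Longrightarrow> 0 \<le> \<phi> i x \<and> \<phi> i x \<le> 1"
  shows "continuous_map X euclideanreal (half_series \<phi>)"
proof (rule continuous_map_uniform_approx)
  fix \<epsilon> :: real
  assume "\<epsilon> > 0"
  then obtain n where n: "(1/2) ^ n < \<epsilon> / 2"
    using real_arch_pow_inv [of "\<epsilon> / 2" "1/2"] by auto
  have "\<bar>half_series \<phi> x - (\<Sum>i<n. (1/2) ^ i * \<phi> i x)\<bar> \<le> \<epsilon>" if x: "x \<in> topspace X" for x
  proof -
    have sm: "summable (\<lambda>i. (1/2) ^ i * \<phi> i x)"
      using half_series_summable [of "topspace X" \<phi>] \<phi> x by blast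
    have "half_series \<phi> x - (\<Sum>i<n. (1/2) ^ i * \<phi> i x) = (\<Sum>i. (1/2) ^ (i + n) * \<phi> (i + n) x)"
      unfolding half_series_def using suminf_minus_initial_segment [OF sm, of n] by simp
    also have "\<dots> = (1/2) ^ n * half_series (\<lambda>i. \<phi> (i + n)) x"
    proof -
      have "summable (\<lambda>i. (1/2) ^ i * \<phi> (i + n) x)"
        using half_series_summable [of "topspace X" "\<lambda>i. \<phi> (i + n)"] \<phi> x by blast
      then show ?thesis
        unfolding half_series_def
        by (simp flip: suminf_mult add: power_add mult.assoc mult.left_commute)
    qed
    finally have eq: "half_series \<phi> x - (\<Sum>i<n. (1/2) ^ i * \<phi> i x)
      = (1/2) ^ n * half_series (\<lambda>i. \<phi> (i + n)) x" .
    have "0 \<le> half_series (\<lambda>i. \<phi> (i + n)) x" "half_series (\<lambda>i. \<phi> (i + n)) x \<le> 2"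
      using half_series_nonneg [of "topspace X" "\<lambda>i. \<phi> (i + n)"]
        half_series_le_2 [of "topspace X" "\<lambda>i. \<phi> (i + n)"] \<phi> x by blast+
    then have "0 \<le> (1/2) ^ n * half_series (\<lambda>i. \<phi> (i + n)) x"
      "(1/2) ^ n * half_series (\<lambda>i. \<phi> (i + n)) x \<le> (1/2) ^ n * 2"
      by (auto intro!: mult_left_mono)
    with n eq show ?thesis by linarith
  qed
  moreover have "continuous_map X euclideanreal (\<lambda>x. \<Sum>i<n. (1/2) ^ i * \<phi> i x)"
    using cont by (intro continuous_intros) auto
  ultimately show "\<exists>g. continuous_map X euclideanreal g \<and>
      (\<forall>x\<in>topspace X. \<bar>half_series \<phi> x - g x\<bar> \<le> \<epsilon>)"
    by blast
qed

section \<open>Functions determined by a set of coordinates\<close>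

abbreviation real_maps :: "'a topology \<Rightarrow> ('a \<Rightarrow> real) set"
  where "real_maps K \<equiv> {f. continuous_map K euclideanreal f}"

definition agree :: "('a \<Rightarrow> real) set \<Rightarrow> 'a \<Rightarrow> 'a \<Rightarrow> bool"
  where "agree J x y \<longleftrightarrow> (\<forall>j\<in>J. j x = j y)"

definition fibre :: "'a topology \<Rightarrow> ('a \<Rightarrow> real) set \<Rightarrow> 'a \<Rightarrow> 'a set"
  where "fibre K J x = {q \<in> topspace K. agree J x q}"

definition fibre_inf :: "'a topology \<Rightarrow> ('a \<Rightarrow> real) set \<Rightarrow> ('a \<Rightarrow> real) \<Rightarrow> 'a \<Rightarrow> real"
  where "fibre_inf K J F x = Inf (F ` fibre K J x)"

definition determined :: "'a topology \<Rightarrow> ('a \<Rightarrow> real) set \<Rightarrow> ('a \<Rightarrow> real) set"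
  where "determined K J = {f \<in> real_maps K.
    \<forall>x\<in>topspace K. \<forall>y\<in>topspace K. agree J x y \<longrightarrow> f x = f y}"

text \<open>
  Fibrewise infima are automatically lower semicontinuous when \<open>K\<close> is compact; their upper
  semicontinuity says that the map of \<open>K\<close> onto its image in \<open>\<real>\<^sup>J\<close> is open.
\<close>

definition openly_fibred :: "'a topology \<Rightarrow> ('a \<Rightarrow> real) set \<Rightarrow> bool"
  where "openly_fibred K J \<longleftrightarrow>
    (\<forall>F\<in>real_maps K. continuous_map K euclideanreal (fibre_inf K J F))"

lemma agree_refl [simp]: "agree J x x"
  by (auto simp: agree_def)

lemma agree_sym: "agree J x y \<Longrightarrow> agree J y x"
  by (auto simp: agree_def)

lemma agree_trans: "agree J x y \<Longrightarrow> agree J y z \<Longrightarrow> agree J x z"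
  by (auto simp: agree_def)

lemma agree_Un: "agree (J \<union> D) x y \<longleftrightarrow> agree J x y \<and> agree D x y"
  by (auto simp: agree_def)

lemma agree_mono: "agree J' x y \<Longrightarrow> J \<subseteq> J' \<Longrightarrow> agree J x y"
  by (auto simp: agree_def)

lemma fibre_eq: "agree J x y \<Longrightarrow> fibre K J x = fibre K J y"
  unfolding fibre_def by (blast intro: agree_trans agree_sym)

lemma fibre_inf_eq: "agree J x y \<Longrightarrow> fibre_inf K J F x = fibre_inf K J F y"
  by (simp add: fibre_inf_def fibre_eq)

lemma fibre_self: "x \<in> topspace K \<Longrightarrow> x \<in> fibre K J x"
  by (simp add: fibre_def)

lemma determinedD:
  assumes "f \<in> determined K J" "x \<in> topspace K" "y \<in> topspace K" "agree J x y"
  shows "f x = f y"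
  using assms unfolding determined_def by blast

lemma determinedI:
  assumes "continuous_map K euclideanreal f"
    and "\<And>x y. x \<in> topspace K \<Longrightarrow> y \<in> topspace K \<Longrightarrow> agree J x y \<Longrightarrow> f x = f y"
  shows "f \<in> determined K J"
  using assms unfolding determined_def by blast

lemma determined_cont: "f \<in> determined K J \<Longrightarrow> continuous_map K euclideanreal f"
  by (simp add: determined_def)

lemma determined_mono: "J \<subseteq> J' \<Longrightarrow> determined K J \<subseteq> determined K J'"
  unfolding determined_def by (blast intro: agree_mono)

lemma subset_determined: "J \<subseteq> real_maps K \<Longrightarrow> J \<subseteq> determined K J"
  by (auto simp: determined_def agree_def)

lemma agree_determined:
  assumes "J \<subseteq> real_maps K" "x \<in> topspace K" "y \<in> topspace K"
  shows "agree (determined K J) x y \<longleftrightarrow> agree J x y"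
  using assms subset_determined [OF assms(1)]
  unfolding determined_def agree_def by blast

lemma determined_idem:
  assumes "J \<subseteq> real_maps K"
  shows "determined K (determined K J) = determined K J"
  using agree_determined [OF assms] unfolding determined_def [of K "determined K J"]
  by (auto simp: determined_def [of K J])

lemma closedin_agree:
  assumes "J \<subseteq> real_maps K"
  shows "closedin (prod_topology K K) {p \<in> topspace (prod_topology K K). agree J (fst p) (snd p)}"
proof -
  have "{p \<in> topspace (prod_topology K K). agree J (fst p) (snd p)} =
    topspace (prod_topology K K) \<inter>
      (\<Inter>j\<in>J. {p \<in> topspace (prod_topology K K). j (fst p) = j (snd p)})"
    by (auto simp: agree_def)
  moreover have "closedin (prod_topology K K)
      {p \<in> topspace (prod_topology K K). j (fst p) = j (snd p)}" if "j \<in> J" for j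
  proof -
    have "continuous_map K euclideanreal j"
      using assms that by blast
    then show ?thesis
      using continuous_map_compose [OF continuous_map_fst] continuous_map_compose [OF continuous_map_snd]
      by (intro closedin_continuous_maps_eq [of euclideanreal]) (auto simp: o_def)
  qed
  ultimately show ?thesis
    by (cases "J = {}") (auto intro!: closedin_Inter closedin_Int simp del: topspace_prod_topology)
qed

lemma closedin_fibre:
  assumes "J \<subseteq> real_maps K" "x \<in> topspace K"
  shows "closedin K (fibre K J x)"
proof -
  have "continuous_map K (prod_topology K K) (\<lambda>q. (x, q))"
    using assms by (intro continuous_map_pairedI) auto
  from closedin_continuous_map_preimage [OF this closedin_agree [OF assms(1)]]
  show ?thesis
    using assms(2) by (simp add: fibre_def cong: conj_cong)
qed

lemma fibre_inf_attained:
  assumes K: "compact_space K" and J: "J \<subseteq> real_maps K" and x: "x \<in> topspace K"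
    and F: "continuous_map K euclideanreal F"
  obtains q where "q \<in> fibre K J x" "F q = fibre_inf K J F x"
    "\<And>q'. q' \<in> fibre K J x \<Longrightarrow> fibre_inf K J F x \<le> F q'"
proof -
  obtain q where q: "q \<in> fibre K J x" "\<And>q'. q' \<in> fibre K J x \<Longrightarrow> F q \<le> F q'"
    using compact_attains_min [OF K closedin_fibre [OF J x] _ F] fibre_self [OF x] by blast
  then have "fibre_inf K J F x = F q"
    unfolding fibre_inf_def by (intro cInf_eq_minimum) auto
  then show thesis
    using q that by simp
qed

lemma fibre_inf_le:
  assumes "compact_space K" "J \<subseteq> real_maps K" "x \<in> topspace K" "continuous_map K euclideanreal F"
    and "q \<in> fibre K J x"
  shows "fibre_inf K J F x \<le> F q"
  using fibre_inf_attained [OF assms(1-4)] assms(5) by metis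

lemma fibre_inf_determined:
  assumes "openly_fibred K J" "F \<in> real_maps K"
  shows "fibre_inf K J F \<in> determined K J"
  using assms fibre_inf_eq by (fastforce simp: openly_fibred_def determined_def)

lemma fibre_inf_perturb:
  assumes K: "compact_space K" and J: "J \<subseteq> real_maps K" and x: "x \<in> topspace K"
    and F: "continuous_map K euclideanreal F" and F': "continuous_map K euclideanreal F'"
    and le: "\<And>q. q \<in> topspace K \<Longrightarrow> F q \<le> F' q + \<epsilon>"
  shows "fibre_inf K J F x \<le> fibre_inf K J F' x + \<epsilon>"
proof -
  obtain q where q: "q \<in> fibre K J x" "F' q = fibre_inf K J F' x"
    using fibre_inf_attained [OF K J x F'] by metis
  have "fibre_inf K J F x \<le> F q"
    by (rule fibre_inf_le [OF K J x F q(1)])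
  also have "\<dots> \<le> F' q + \<epsilon>"
    using q(1) le by (simp add: fibre_def)
  finally show ?thesis
    using q by simp
qed

text \<open>
  Continuity in \<open>x\<close> comes from openness of the fibration; the infimum over a fibre is moreover
  nonexpansive in the function, so the uniform modulus in \<open>y\<close> passes to it.
\<close>

lemma jointly_continuous_fibre_inf:
  assumes K: "compact_space K" and J: "J \<subseteq> real_maps K" and op: "openly_fibred K J"
    and G: "jointly_continuous K Y G"
  shows "jointly_continuous K Y (\<lambda>x y. fibre_inf K J (\<lambda>q. G q y) x)"
  unfolding continuous_map_real_iff
proof (intro ballI allI impI)
  fix p and \<epsilon> :: real
  assume "p \<in> topspace (prod_topology K Y)" and \<epsilon>: "\<epsilon> > 0"
  then obtain x y where p: "p = (x, y)" and x: "x \<in> topspace K" and y: "y \<in> topspace Y"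
    by auto
  have Gy: "continuous_map K euclideanreal (\<lambda>q. G q y)" if "y \<in> topspace Y" for y
    using jointly_continuous_left [OF G that] .
  obtain N where N: "openin Y N" "y \<in> N"
    and NG: "\<And>y' q. y' \<in> N \<Longrightarrow> q \<in> topspace K \<Longrightarrow> \<bar>G q y' - G q y\<bar> < \<epsilon> / 2"
    using jointly_continuous_uniform [OF K G y, of "\<epsilon> / 2"] \<epsilon> by auto
  have "continuous_map K euclideanreal (fibre_inf K J (\<lambda>q. G q y))"
    using op Gy [OF y] by (simp add: openly_fibred_def)
  then obtain U where U: "openin K U" "x \<in> U"
    and UG: "\<And>x'. x' \<in> U \<Longrightarrow>
      \<bar>fibre_inf K J (\<lambda>q. G q y) x' - fibre_inf K J (\<lambda>q. G q y) x\<bar> < \<epsilon> / 2"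
    using continuous_map_realD [OF _ x, of _ "\<epsilon> / 2"] \<epsilon> by (metis half_gt_zero)
  have "\<bar>fibre_inf K J (\<lambda>q. G q y') x' - fibre_inf K J (\<lambda>q. G q y) x\<bar> < \<epsilon>"
    if x': "x' \<in> U" and y': "y' \<in> N" for x' y'
  proof -
    have K': "x' \<in> topspace K" and Y': "y' \<in> topspace Y"
      using x' y' U N openin_subset by blast+
    have "fibre_inf K J (\<lambda>q. G q y') x' \<le> fibre_inf K J (\<lambda>q. G q y) x' + \<epsilon> / 2"
      using NG [OF y'] by (intro fibre_inf_perturb [OF K J K' Gy [OF Y'] Gy [OF y]]) (smt (verit))
    moreover have "fibre_inf K J (\<lambda>q. G q y) x' \<le> fibre_inf K J (\<lambda>q. G q y') x' + \<epsilon> / 2"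
      using NG [OF y'] by (intro fibre_inf_perturb [OF K J K' Gy [OF y] Gy [OF Y']]) (smt (verit))
    ultimately show ?thesis
      using UG [OF x'] by linarith
  qed
  then show "\<exists>U. openin (prod_topology K Y) U \<and> p \<in> U \<and> (\<forall>p'\<in>U.
      \<bar>fibre_inf K J (\<lambda>q. G q (snd p')) (fst p') - fibre_inf K J (\<lambda>q. G q (snd p)) (fst p)\<bar> < \<epsilon>)"
    using U N p by (intro exI [of _ "U \<times> N"]) (auto simp: openin_prod_Times_iff)
qed

section \<open>A random walk towards the fibres\<close>

lemma convex_combination_bounds:
  fixes t :: real
  assumes "0 \<le> t" "t \<le> 1" "t \<noteq> 0 \<Longrightarrow> lo \<le> a \<and> a \<le> hi" "lo \<le> b" "b \<le> hi"
  shows "lo \<le> t * a + (1 - t) * b" "t * a + (1 - t) * b \<le> hi"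
proof -
  have "t * lo \<le> t * a \<and> t * a \<le> t * hi"
    using assms by (cases "t = 0") (auto intro: mult_left_mono)
  moreover have "(1 - t) * lo \<le> (1 - t) * b" "(1 - t) * b \<le> (1 - t) * hi"
    using assms by (auto intro: mult_left_mono)
  ultimately show "lo \<le> t * a + (1 - t) * b" "t * a + (1 - t) * b \<le> hi"
    by (auto simp: algebra_simps)
qed

text \<open>
  The fibres are those of \<open>J\<close> in \<open>K\<close>; the walk takes place in \<open>Y\<close>, where distances are measured by
  a pseudometric \<open>d\<close> that sees countably many further coordinates. A point \<open>y \<in> Y\<close> is compared
  with the image under \<open>e\<close> of the fibre through \<open>x \<in> K\<close>. The bound 2 on \<open>d\<close> is the value of the
  geometric series with ratio one half and the initial scale of the walk.
\<close>

locale fibrewise_walk =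
  fixes K :: "'k topology" and Y :: "'y topology" and J :: "('k \<Rightarrow> real) set"
    and e :: "'k \<Rightarrow> 'y" and d :: "'y \<Rightarrow> 'y \<Rightarrow> real"
  assumes K: "compact_space K" and Y: "compact_space Y"
    and J: "J \<subseteq> real_maps K" and op: "openly_fibred K J"
    and e: "continuous_map K Y e"
    and d_cont: "jointly_continuous Y Y d"
    and d_self [simp]: "\<And>y. d y y = 0"
    and d_sym: "\<And>y y'. d y y' = d y' y"
    and d_triangle: "\<And>y y' y''. y \<in> topspace Y \<Longrightarrow> y' \<in> topspace Y \<Longrightarrow> y'' \<in> topspace Y \<Longrightarrow>
      d y y'' \<le> d y y' + d y' y''"
    and d_bounds: "\<And>y y'. y \<in> topspace Y \<Longrightarrow> y' \<in> topspace Y \<Longrightarrow> 0 \<le> d y y' \<and> d y y' \<le> 2"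
begin

definition dist_fibre :: "'k \<Rightarrow> 'y \<Rightarrow> real"
  where "dist_fibre x y = fibre_inf K J (\<lambda>q. d (e q) y) x"

text \<open>
  The continuous functions on \<open>K \<times> Y\<close> that factor through the quotient of \<open>K\<close> by the fibres.
\<close>

definition admissible :: "('k \<Rightarrow> 'y \<Rightarrow> real) \<Rightarrow> bool"
  where "admissible \<Phi> \<longleftrightarrow> jointly_continuous K Y \<Phi> \<and>
    (\<forall>y\<in>topspace Y. \<forall>x\<in>topspace K. \<forall>x'\<in>topspace K. agree J x x' \<longrightarrow> \<Phi> x y = \<Phi> x' y)"

lemma e_in: "x \<in> topspace K \<Longrightarrow> e x \<in> topspace Y"
  using e by (auto simp: continuous_map_def)

lemma d_e_cont: "jointly_continuous K Y (\<lambda>q y. d (e q) y)"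
  using e by (intro jointly_continuous_compose [OF d_cont])
    (auto intro: continuous_map_compose [OF continuous_map_fst, unfolded o_def] continuous_map_snd)

lemma dist_fibre_admissible: "admissible dist_fibre"
  unfolding admissible_def dist_fibre_def [abs_def]
  using jointly_continuous_fibre_inf [OF K J op d_e_cont] by (auto intro: fibre_inf_eq)

lemma dist_fibre_le:
  assumes "x \<in> topspace K" "y \<in> topspace Y" "q \<in> fibre K J x"
  shows "dist_fibre x y \<le> d (e q) y"
  unfolding dist_fibre_def
  using fibre_inf_le [OF K J assms(1) jointly_continuous_left [OF d_e_cont assms(2)] assms(3)] .

definition nearest :: "'k \<Rightarrow> 'y \<Rightarrow> 'k"
  where "nearest x y = (SOME q. q \<in> fibre K J x \<and> d (e q) y = dist_fibre x y)"

lemma nearest: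
  assumes "x \<in> topspace K" "y \<in> topspace Y"
  shows "nearest x y \<in> fibre K J x" "d (e (nearest x y)) y = dist_fibre x y"
proof -
  obtain q where "q \<in> fibre K J x \<and> d (e q) y = dist_fibre x y"
    unfolding dist_fibre_def
    using fibre_inf_attained [OF K J assms(1) jointly_continuous_left [OF d_e_cont assms(2)]] by metis
  then have "nearest x y \<in> fibre K J x \<and> d (e (nearest x y)) y = dist_fibre x y"
    unfolding nearest_def by (rule someI)
  then show "nearest x y \<in> fibre K J x" "d (e (nearest x y)) y = dist_fibre x y"
    by auto
qed

lemma nearest_in:
  assumes "x \<in> topspace K" "y \<in> topspace Y"
  shows "nearest x y \<in> topspace K" "agree J x (nearest x y)" "e (nearest x y) \<in> topspace Y"
  using nearest [OF assms] e_in by (auto simp: fibre_def)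

lemma dist_fibre_bounds:
  assumes "x \<in> topspace K" "y \<in> topspace Y"
  shows "0 \<le> dist_fibre x y" "dist_fibre x y \<le> 2"
  using nearest(2) [OF assms] nearest_in(3) [OF assms] d_bounds [of "e (nearest x y)" y] assms(2)
  by auto

lemma dist_fibre_self: "x \<in> topspace K \<Longrightarrow> dist_fibre x (e x) = 0"
  using dist_fibre_le [of x "e x" x] dist_fibre_bounds(1) [of x "e x"] e_in fibre_self by fastforce

definition net :: "real \<Rightarrow> 'y set"
  where "net r = (SOME N. finite N \<and> N \<subseteq> topspace Y \<and> (\<forall>y\<in>topspace Y. \<exists>v\<in>N. d v y < r))"

lemma net:
  assumes "r > 0"
  shows "finite (net r)" "net r \<subseteq> topspace Y" "\<And>y. y \<in> topspace Y \<Longrightarrow> \<exists>v\<in>net r. d v y < r"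
proof -
  let ?B = "\<lambda>v. {y \<in> topspace Y. d v y < r}"
  have "openin Y (?B v)" if "v \<in> topspace Y" for v
    using jointly_continuous_right [OF d_cont that] by (intro openin_less) auto
  moreover have "topspace Y \<subseteq> \<Union>(?B ` topspace Y)"
    using assms by auto
  ultimately obtain \<F> where \<F>: "finite \<F>" "\<F> \<subseteq> ?B ` topspace Y" "topspace Y \<subseteq> \<Union>\<F>"
    using compactinD [of Y "topspace Y" "?B ` topspace Y"] Y by (auto simp: compact_space_def)
  then obtain N where "finite N" "N \<subseteq> topspace Y" "\<F> = ?B ` N"
    using finite_subset_image [OF \<F>(1,2)] by blast
  then have "finite N \<and> N \<subseteq> topspace Y \<and> (\<forall>y\<in>topspace Y. \<exists>v\<in>N. d v y < r)"
    using \<F>(3) by blast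
  then have "finite (net r) \<and> net r \<subseteq> topspace Y \<and> (\<forall>y\<in>topspace Y. \<exists>v\<in>net r. d v y < r)"
    unfolding net_def by (rule someI)
  then show "finite (net r)" "net r \<subseteq> topspace Y" "\<And>y. y \<in> topspace Y \<Longrightarrow> \<exists>v\<in>net r. d v y < r"
    by auto
qed

text \<open>
  The probability of not moving. It is 1 on the fibre, which makes the final operator extend
  functions, and it vanishes unless \<open>y\<close> is closer than \<open>r\<close> to the fibre, so that after a step of
  scale \<open>r\<close> the walk is always within \<open>r\<close> of it.
\<close>

definition stay :: "real \<Rightarrow> 'k \<Rightarrow> 'y \<Rightarrow> real"
  where "stay r x y = max 0 (min 1 (2 - 2 * dist_fibre x y / r))"

text \<open>
  The first factor selects net points close to the fibre and the second one those close to \<open>y\<close>. A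
  net point near the fibre point nearest to \<open>y\<close> lies at distance less than \<open>dist_fibre x y + r\<close>
  from \<open>y\<close>, so the allowance \<open>2 * r\<close> keeps the total weight positive.
\<close>

definition weight :: "real \<Rightarrow> 'y \<Rightarrow> 'k \<Rightarrow> 'y \<Rightarrow> real"
  where "weight r v x y = max 0 (r - dist_fibre x v) * max 0 (dist_fibre x y + 2 * r - d y v)"

definition total_weight :: "real \<Rightarrow> 'k \<Rightarrow> 'y \<Rightarrow> real"
  where "total_weight r x y = (\<Sum>v\<in>net r. weight r v x y)"

text \<open>
  The transition operator of one step: the expected value of \<open>\<Phi> x\<close> after a step from \<open>y\<close>.
\<close>

definition step :: "real \<Rightarrow> ('k \<Rightarrow> 'y \<Rightarrow> real) \<Rightarrow> 'k \<Rightarrow> 'y \<Rightarrow> real"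
  where "step r \<Phi> x y = stay r x y * \<Phi> x y +
    (1 - stay r x y) * ((\<Sum>v\<in>net r. weight r v x y * \<Phi> x v) / total_weight r x y)"

lemma weight_nonneg: "0 \<le> weight r v x y"
  by (simp add: weight_def)

lemma total_weight_pos:
  assumes r: "r > 0" and x: "x \<in> topspace K" and y: "y \<in> topspace Y"
  shows "0 < total_weight r x y"
proof -
  let ?q = "e (nearest x y)"
  have q: "?q \<in> topspace Y" "nearest x y \<in> fibre K J x" "d ?q y = dist_fibre x y"
    using nearest nearest_in x y by auto
  obtain v where v: "v \<in> net r" "d v ?q < r"
    using net(3) [OF r q(1)] by blast
  have vY: "v \<in> topspace Y"
    using v net(2) [OF r] by blast
  have "dist_fibre x v < r"
    using dist_fibre_le [OF x vY q(2)] v d_sym [of v ?q] by simp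
  moreover have "d y v < dist_fibre x y + 2 * r"
    using d_triangle [OF y q(1) vY] q(3) v d_sym r by (smt (verit))
  ultimately have "0 < weight r v x y"
    by (simp add: weight_def)
  then show ?thesis
    unfolding total_weight_def using net(1) [OF r] v(1) weight_nonneg by (intro sum_pos2) auto
qed

lemma step_admissible:
  assumes r: "r > 0" and \<Phi>: "admissible \<Phi>"
  shows "admissible (step r \<Phi>)"
proof -
  have \<rho>: "jointly_continuous K Y dist_fibre"
    using dist_fibre_admissible by (simp add: admissible_def)
  have \<rho>v: "continuous_map (prod_topology K Y) euclideanreal (\<lambda>p. dist_fibre (fst p) v)"
    if "v \<in> topspace Y" for v
    using that by (intro jointly_continuous_compose [OF \<rho>]) (auto intro: continuous_map_fst)
  have dv: "continuous_map (prod_topology K Y) euclideanreal (\<lambda>p. d (snd p) v)"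
    if "v \<in> topspace Y" for v
    using that by (intro jointly_continuous_compose [OF d_cont]) (auto intro: continuous_map_snd)
  have \<Phi>c: "jointly_continuous K Y \<Phi>"
    using \<Phi> by (simp add: admissible_def)
  have \<Phi>v: "continuous_map (prod_topology K Y) euclideanreal (\<lambda>p. \<Phi> (fst p) v)"
    if "v \<in> topspace Y" for v
    using that by (intro jointly_continuous_compose [OF \<Phi>c]) (auto intro: continuous_map_fst)
  have w: "jointly_continuous K Y (weight r v)" if "v \<in> net r" for v
    unfolding weight_def using net(2) [OF r] that
    by (intro continuous_intros \<rho> \<rho>v dv) auto
  have s: "jointly_continuous K Y (stay r)"
    unfolding stay_def using r by (intro continuous_intros \<rho>) auto
  have "jointly_continuous K Y (step r \<Phi>)"
    unfolding step_def total_weight_def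
  proof (intro continuous_intros s w \<Phi>v net(1) [OF r])
    show "jointly_continuous K Y \<Phi>"
      by (rule \<Phi>c)
    show "v \<in> topspace Y" if "v \<in> net r" for v
      using that net(2) [OF r] by blast
    show "(\<Sum>v\<in>net r. weight r v (fst p) (snd p)) \<noteq> 0" if "p \<in> topspace (prod_topology K Y)" for p
      using that total_weight_pos [OF r, of "fst p" "snd p"] by (auto simp: total_weight_def)
  qed auto
  moreover have "step r \<Phi> x y = step r \<Phi> x' y"
    if "y \<in> topspace Y" "x \<in> topspace K" "x' \<in> topspace K" "agree J x x'" for x x' y
  proof -
    have eq: "dist_fibre x v = dist_fibre x' v \<and> \<Phi> x v = \<Phi> x' v" if "v \<in> topspace Y" for v
      using that \<open>x \<in> topspace K\<close> \<open>x' \<in> topspace K\<close> \<open>agree J x x'\<close> \<Phi> dist_fibre_admissible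
      unfolding admissible_def by blast
    then have "weight r v x y = weight r v x' y \<and> \<Phi> x v = \<Phi> x' v" if "v \<in> net r" for v
      using that net(2) [OF r] \<open>y \<in> topspace Y\<close> by (auto simp: weight_def)
    then show ?thesis
      using eq [OF \<open>y \<in> topspace Y\<close>] by (simp add: step_def total_weight_def stay_def cong: sum.cong)
  qed
  ultimately show ?thesis
    unfolding admissible_def by blast
qed

lemma step_add: "step r (\<lambda>x y. \<Phi> x y + \<Psi> x y) = (\<lambda>x y. step r \<Phi> x y + step r \<Psi> x y)"
  by (simp add: fun_eq_iff step_def algebra_simps sum.distrib add_divide_distrib)

lemma step_scale: "step r (\<lambda>x y. c * \<Phi> x y) = (\<lambda>x y. c * step r \<Phi> x y)"
proof -
  have "(\<Sum>v\<in>net r. weight r v x y * (c * \<Phi> x v)) = c * (\<Sum>v\<in>net r. weight r v x y * \<Phi> x v)" for x y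
    by (simp add: sum_distrib_left mult.left_commute)
  then show ?thesis
    by (simp add: fun_eq_iff step_def algebra_simps)
qed

text \<open>
  A step averages only over points that are within \<open>r\<close> of the fibre and not much farther from \<open>y\<close>
  than the fibre is.
\<close>

lemma step_bounds:
  assumes r: "r > 0" and x: "x \<in> topspace K" and y: "y \<in> topspace Y"
    and near: "\<And>y'. y' \<in> topspace Y \<Longrightarrow> d y y' \<le> dist_fibre x y + 2 * r \<Longrightarrow> dist_fibre x y' \<le> r \<Longrightarrow>
      lo \<le> \<Phi> x y' \<and> \<Phi> x y' \<le> hi"
  shows "lo \<le> step r \<Phi> x y \<and> step r \<Phi> x y \<le> hi"
proof -
  have wt: "weight r v x y * lo \<le> weight r v x y * \<Phi> x v \<and>
      weight r v x y * \<Phi> x v \<le> weight r v x y * hi" if "v \<in> net r" for v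
  proof (cases "weight r v x y = 0")
    case False
    then have "dist_fibre x v < r" "d y v < dist_fibre x y + 2 * r"
      by (auto simp: weight_def max_def split: if_splits)
    then have "lo \<le> \<Phi> x v \<and> \<Phi> x v \<le> hi"
      using near [of v] that net(2) [OF r] by auto
    then show ?thesis
      using weight_nonneg [of r v x y] by (auto intro: mult_left_mono)
  qed auto
  have W: "0 < total_weight r x y"
    by (rule total_weight_pos [OF r x y])
  have "total_weight r x y * lo \<le> (\<Sum>v\<in>net r. weight r v x y * \<Phi> x v)"
    "(\<Sum>v\<in>net r. weight r v x y * \<Phi> x v) \<le> total_weight r x y * hi"
    unfolding total_weight_def sum_distrib_right using wt by (auto intro!: sum_mono)
  then have avg: "lo \<le> (\<Sum>v\<in>net r. weight r v x y * \<Phi> x v) / total_weight r x y"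
    "(\<Sum>v\<in>net r. weight r v x y * \<Phi> x v) / total_weight r x y \<le> hi"
    using W by (auto simp: field_simps)
  have "lo \<le> \<Phi> x y \<and> \<Phi> x y \<le> hi" if "stay r x y \<noteq> 0"
  proof -
    have "2 * dist_fibre x y / r < 2"
      using that by (auto simp: stay_def max_def split: if_splits)
    then have "dist_fibre x y \<le> r"
      using r by (simp add: field_simps)
    then show ?thesis
      using near [OF y] dist_fibre_bounds(1) [OF x y] r by simp
  qed
  moreover have "0 \<le> stay r x y" "stay r x y \<le> 1"
    by (auto simp: stay_def)
  ultimately show ?thesis
    unfolding step_def
    using convex_combination_bounds [of "stay r x y" lo "\<Phi> x y" hi, OF _ _ _ avg] by simp
qed

lemma step_on_fibre: "dist_fibre x y = 0 \<Longrightarrow> step r \<Phi> x y = \<Phi> x y"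
  by (simp add: step_def stay_def)

text \<open>
  The expected value after \<open>m\<close> steps of scales \<open>2\<^sup>-\<^sup>k\<close>, \<open>2\<^sup>-\<^sup>k\<^sup>-\<^sup>1\<close>, \<open>\<dots>\<close>; the first step is the outermost
  operator.
\<close>

primrec walk :: "nat \<Rightarrow> nat \<Rightarrow> ('k \<Rightarrow> 'y \<Rightarrow> real) \<Rightarrow> 'k \<Rightarrow> 'y \<Rightarrow> real"
  where
    "walk 0 k \<Phi> = \<Phi>"
  | "walk (Suc m) k \<Phi> = step ((1/2) ^ k) (walk m (Suc k) \<Phi>)"

lemma walk_split: "walk (n + m) k \<Phi> = walk n k (walk m (k + n) \<Phi>)"
  by (induction n arbitrary: k) auto

lemma walk_add: "walk m k (\<lambda>x y. \<Phi> x y + \<Psi> x y) = (\<lambda>x y. walk m k \<Phi> x y + walk m k \<Psi> x y)"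
  by (induction m arbitrary: k) (auto simp: step_add)

lemma walk_scale: "walk m k (\<lambda>x y. c * \<Phi> x y) = (\<lambda>x y. c * walk m k \<Phi> x y)"
  by (induction m arbitrary: k) (auto simp: step_scale)

lemma walk_diff: "walk m k (\<lambda>x y. \<Phi> x y - \<Psi> x y) = (\<lambda>x y. walk m k \<Phi> x y - walk m k \<Psi> x y)"
  using walk_add [of m k \<Phi> "\<lambda>x y. (-1) * \<Psi> x y"] walk_scale [of m k "-1" \<Psi>] by simp

lemma walk_admissible: "admissible \<Phi> \<Longrightarrow> admissible (walk m k \<Phi>)"
  by (induction m arbitrary: k) (auto intro: step_admissible)

lemma walk_on_fibre: "dist_fibre x y = 0 \<Longrightarrow> walk m k \<Phi> x y = \<Phi> x y"
  by (induction m arbitrary: k) (auto simp: step_on_fibre)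

text \<open>
  From a point within \<open>2 * 2\<^sup>-\<^sup>k\<close> of the fibre the first step moves by at most \<open>4 * 2\<^sup>-\<^sup>k\<close> and ends
  within \<open>2 * 2\<^sup>-\<^sup>k\<^sup>-\<^sup>1\<close> of the fibre; the lengths of all steps add up to at most \<open>8 * 2\<^sup>-\<^sup>k\<close>.
\<close>

lemma walk_bounds:
  assumes x: "x \<in> topspace K" and "y \<in> topspace Y" "dist_fibre x y \<le> 2 * (1/2) ^ k"
    and "\<And>y'. y' \<in> topspace Y \<Longrightarrow> d y y' \<le> 8 * (1/2) ^ k \<Longrightarrow> dist_fibre x y' \<le> 2 * (1/2) ^ (k + m) \<Longrightarrow>
      lo \<le> \<Phi> x y' \<and> \<Phi> x y' \<le> hi"
  shows "lo \<le> walk m k \<Phi> x y \<and> walk m k \<Phi> x y \<le> hi"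
  using assms(2-)
proof (induction m arbitrary: k y)
  case 0
  then show ?case by auto
next
  case (Suc m)
  show ?case
    unfolding walk.simps
  proof (rule step_bounds [OF _ x Suc.prems(1)])
    fix y'
    assume y': "y' \<in> topspace Y" and dy': "d y y' \<le> dist_fibre x y + 2 * (1/2) ^ k"
      and \<rho>: "dist_fibre x y' \<le> (1/2) ^ k"
    show "lo \<le> walk m (Suc k) \<Phi> x y' \<and> walk m (Suc k) \<Phi> x y' \<le> hi"
    proof (rule Suc.IH [OF y'])
      show "dist_fibre x y' \<le> 2 * (1/2) ^ Suc k"
        using \<rho> by simp
      fix y''
      assume y'': "y'' \<in> topspace Y" and "d y' y'' \<le> 8 * (1/2) ^ Suc k"
        and \<rho>'': "dist_fibre x y'' \<le> 2 * (1/2) ^ (Suc k + m)"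
      then have "d y y'' \<le> 8 * (1/2) ^ k"
        using d_triangle [OF Suc.prems(1) y' y''] dy' Suc.prems(2) by simp
      then show "lo \<le> \<Phi> x y'' \<and> \<Phi> x y'' \<le> hi"
        using Suc.prems(3) [OF y''] \<rho>'' by simp
    qed
  qed simp
qed

lemma walk_0_bounds:
  assumes "x \<in> topspace K" "y \<in> topspace Y"
    and "\<And>y'. y' \<in> topspace Y \<Longrightarrow> dist_fibre x y' \<le> 2 * (1/2) ^ m \<Longrightarrow> lo \<le> \<Phi> x y' \<and> \<Phi> x y' \<le> hi"
  shows "lo \<le> walk m 0 \<Phi> x y \<and> walk m 0 \<Phi> x y \<le> hi"
  using assms dist_fibre_bounds by (intro walk_bounds) auto

text \<open>
  The functions that factor through the coordinates in \<open>J\<close> together with those seen by \<open>d\<close>.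
\<close>

definition measured :: "('k \<Rightarrow> real) set"
  where "measured = {f \<in> real_maps K. \<forall>q\<in>topspace K. \<forall>q'\<in>topspace K.
    agree J q q' \<longrightarrow> d (e q) (e q') = 0 \<longrightarrow> f q = f q'}"

lemma measuredD:
  assumes "f \<in> measured" "q \<in> topspace K" "q' \<in> topspace K" "agree J q q'" "d (e q) (e q') = 0"
  shows "f q = f q'"
proof -
  have "agree J q q' \<longrightarrow> d (e q) (e q') = 0 \<longrightarrow> f q = f q'"
    using assms(1-3) unfolding measured_def by blast
  then show ?thesis
    using assms(4,5) by blast
qed

lemma measuredI:
  assumes "continuous_map K euclideanreal f"
    and "\<And>q q'. q \<in> topspace K \<Longrightarrow> q' \<in> topspace K \<Longrightarrow> agree J q q' \<Longrightarrow> d (e q) (e q') = 0 \<Longrightarrow>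
      f q = f q'"
  shows "f \<in> measured"
  using assms unfolding measured_def by blast

lemma measured_cont: "f \<in> measured \<Longrightarrow> continuous_map K euclideanreal f"
  by (simp add: measured_def)

text \<open>
  Among the pairs in a common fibre at which \<open>f\<close> differs by at least \<open>\<epsilon>\<close>, a compact set, the
  distance \<open>d\<close> attains its minimum, and this is positive.
\<close>

lemma measured_modulus:
  assumes f: "f \<in> measured" and \<epsilon>: "\<epsilon> > 0"
  obtains \<delta> where "\<delta> > 0"
    "\<And>q q'. q \<in> topspace K \<Longrightarrow> q' \<in> topspace K \<Longrightarrow> agree J q q' \<Longrightarrow> d (e q) (e q') < \<delta> \<Longrightarrow>
      \<bar>f q - f q'\<bar> < \<epsilon>"
proof -
  let ?KK = "prod_topology K K"
  let ?A = "{p \<in> topspace ?KK. agree J (fst p) (snd p)} \<inter>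
    {p \<in> topspace ?KK. \<epsilon> \<le> \<bar>f (fst p) - f (snd p)\<bar>}"
  have fc: "continuous_map K euclideanreal f"
    using f by (simp add: measured_def)
  have "continuous_map ?KK euclideanreal (\<lambda>p. f (fst p))" "continuous_map ?KK euclideanreal (\<lambda>p. f (snd p))"
    using continuous_map_compose [OF continuous_map_fst fc] continuous_map_compose [OF continuous_map_snd fc]
    by (auto simp: o_def)
  then have A: "closedin ?KK ?A"
    by (intro closedin_Int closedin_agree J closedin_le continuous_intros)
  have "continuous_map ?KK Y (\<lambda>p. e (fst p))" "continuous_map ?KK Y (\<lambda>p. e (snd p))"
    using continuous_map_compose [OF continuous_map_fst e] continuous_map_compose [OF continuous_map_snd e]
    by (auto simp: o_def)
  then have dc: "continuous_map ?KK euclideanreal (\<lambda>p. d (e (fst p)) (e (snd p)))"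
    by (rule jointly_continuous_compose [OF d_cont])
  show thesis
  proof (cases "?A = {}")
    case True
    have "\<bar>f q - f q'\<bar> < \<epsilon>" if "q \<in> topspace K" "q' \<in> topspace K" "agree J q q'" for q q'
    proof (rule ccontr)
      assume "\<not> ?thesis"
      then have "(q, q') \<in> ?A" using that by auto
      then show False using True by blast
    qed
    then show thesis
      using that [of 1] by simp
  next
    case False
    have KK: "compact_space ?KK"
      using K by (simp add: compact_space_prod_topology)
    obtain p where p: "p \<in> ?A"
      and min: "\<And>p'. p' \<in> ?A \<Longrightarrow> d (e (fst p)) (e (snd p)) \<le> d (e (fst p')) (e (snd p'))"
      using compact_attains_min [OF KK A False dc] by blast
    have pK: "fst p \<in> topspace K" "snd p \<in> topspace K"
      using p by auto
    have "f (fst p) \<noteq> f (snd p)" "agree J (fst p) (snd p)"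
      using p \<epsilon> by auto
    then have "d (e (fst p)) (e (snd p)) \<noteq> 0"
      using measuredD [OF f pK] by blast
    then have pos: "0 < d (e (fst p)) (e (snd p))"
      using d_bounds [OF e_in [OF pK(1)] e_in [OF pK(2)]] by simp
    have "\<bar>f q - f q'\<bar> < \<epsilon>"
      if "q \<in> topspace K" "q' \<in> topspace K" "agree J q q'" "d (e q) (e q') < d (e (fst p)) (e (snd p))"
      for q q'
    proof (rule ccontr)
      assume "\<not> ?thesis"
      then have "(q, q') \<in> ?A" using that by auto
      then show False using min [of "(q, q')"] that(4) by simp
    qed
    then show thesis
      using that pos by blast
  qed
qed

text \<open>
  The function \<open>f\<close> has no canonical extension from the fibre to \<open>Y\<close>. Its value at a nearest fibre
  point is linear and monotone in \<open>f\<close>, though discontinuous; close to the fibre the choice of that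
  point matters little, and the limit of the walk becomes continuous.
\<close>

definition nearest_value :: "('k \<Rightarrow> real) \<Rightarrow> 'k \<Rightarrow> 'y \<Rightarrow> real"
  where "nearest_value f x y = f (nearest x y)"

lemma nearest_dist:
  assumes x: "x \<in> topspace K" and y: "y \<in> topspace Y" and y': "y' \<in> topspace Y"
  shows "d (e (nearest x y)) (e (nearest x y')) \<le> dist_fibre x y + d y y' + dist_fibre x y'"
proof -
  have "d (e (nearest x y)) (e (nearest x y')) \<le> d (e (nearest x y)) y + d y (e (nearest x y'))"
    using d_triangle nearest_in(3) x y y' by blast
  moreover have "d y (e (nearest x y')) \<le> d y y' + d y' (e (nearest x y'))"
    using d_triangle nearest_in(3) x y y' by blast
  ultimately show ?thesis
    using nearest(2) [OF x y] nearest(2) [OF x y'] d_sym by (smt (verit))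
qed

text \<open>
  After \<open>n\<close> steps the walk is within \<open>2 * 2\<^sup>-\<^sup>n\<close> of the fibre and will travel at most \<open>8 * 2\<^sup>-\<^sup>n\<close>
  more. The nearest fibre points therefore move by at most \<open>12 * 2\<^sup>-\<^sup>n\<close>.
\<close>

lemma walk_nearest_value_Cauchy:
  assumes f: "f \<in> measured" and \<epsilon>: "\<epsilon> > 0"
  obtains n where "\<And>n' m x y. n \<le> n' \<Longrightarrow> x \<in> topspace K \<Longrightarrow> y \<in> topspace Y \<Longrightarrow>
    \<bar>walk (n' + m) 0 (nearest_value f) x y - walk n' 0 (nearest_value f) x y\<bar> \<le> \<epsilon>"
proof -
  obtain \<delta> where \<delta>: "\<delta> > 0" and mod: "\<And>q q'. q \<in> topspace K \<Longrightarrow> q' \<in> topspace K \<Longrightarrow>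
      agree J q q' \<Longrightarrow> d (e q) (e q') < \<delta> \<Longrightarrow> \<bar>f q - f q'\<bar> < \<epsilon>"
    using measured_modulus [OF f \<epsilon>] by blast
  obtain n where n: "(1/2) ^ n < \<delta> / 12"
    using real_arch_pow_inv [of "\<delta> / 12" "1/2"] \<delta> by auto
  have "\<bar>walk (n' + m) 0 (nearest_value f) x y - walk n' 0 (nearest_value f) x y\<bar> \<le> \<epsilon>"
    if "n \<le> n'" and x: "x \<in> topspace K" and y: "y \<in> topspace Y" for n' m x y
  proof -
    have "(1/2::real) ^ n' \<le> (1/2) ^ n"
      using that by (intro power_decreasing) auto
    with n have n': "(1/2::real) ^ n' < \<delta> / 12"
      by linarith
    have "- \<epsilon> \<le> walk m n' (nearest_value f) x y' - nearest_value f x y' \<and> walk m n' (nearest_value f) x y' - nearest_value f x y' \<le> \<epsilon>"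
      if y': "y' \<in> topspace Y" and \<rho>: "dist_fibre x y' \<le> 2 * (1/2) ^ n'" for y'
    proof -
      have "nearest_value f x y' - \<epsilon> \<le> nearest_value f x y'' \<and> nearest_value f x y'' \<le> nearest_value f x y' + \<epsilon>"
        if y'': "y'' \<in> topspace Y" and "d y' y'' \<le> 8 * (1/2) ^ n'"
          and \<rho>'': "dist_fibre x y'' \<le> 2 * (1/2) ^ (n' + m)" for y''
      proof -
        have "(1/2::real) ^ (n' + m) \<le> (1/2) ^ n'"
          by (intro power_decreasing) auto
        then have "d (e (nearest x y')) (e (nearest x y'')) < \<delta>"
          using nearest_dist [OF x y' y''] \<rho> that(2) \<rho>'' n' by linarith
        moreover have "agree J (nearest x y') (nearest x y'')"
          using nearest_in(2) x y' y'' agree_trans agree_sym by metis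
        ultimately have "\<bar>f (nearest x y') - f (nearest x y'')\<bar> < \<epsilon>"
          using mod nearest_in(1) x y' y'' by blast
        then show ?thesis
          by (simp add: nearest_value_def) linarith
      qed
      then have "nearest_value f x y' - \<epsilon> \<le> walk m n' (nearest_value f) x y' \<and> walk m n' (nearest_value f) x y' \<le> nearest_value f x y' + \<epsilon>"
        by (intro walk_bounds [OF x y' \<rho>]) auto
      then show ?thesis by linarith
    qed
    then have "- \<epsilon> \<le> walk n' 0 (\<lambda>x y. walk m n' (nearest_value f) x y - nearest_value f x y) x y \<and>
      walk n' 0 (\<lambda>x y. walk m n' (nearest_value f) x y - nearest_value f x y) x y \<le> \<epsilon>"
      by (intro walk_0_bounds [OF x y]) auto
    then show ?thesis
      by (simp add: walk_diff walk_split abs_le_iff)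
  qed
  then show thesis
    using that by blast
qed

definition walk_limit :: "('k \<Rightarrow> real) \<Rightarrow> 'k \<Rightarrow> 'y \<Rightarrow> real"
  where "walk_limit f x y = lim (\<lambda>n. walk n 0 (nearest_value f) x y)"

lemma walk_nearest_value_tendsto:
  assumes f: "f \<in> measured" and x: "x \<in> topspace K" and y: "y \<in> topspace Y"
  shows "(\<lambda>n. walk n 0 (nearest_value f) x y) \<longlonglongrightarrow> walk_limit f x y"
proof -
  have "Cauchy (\<lambda>n. walk n 0 (nearest_value f) x y)"
  proof (rule metric_CauchyI)
    fix \<epsilon> :: real
    assume "\<epsilon> > 0"
    then obtain n where n: "\<And>n' m. n \<le> n' \<Longrightarrow>
        \<bar>walk (n' + m) 0 (nearest_value f) x y - walk n' 0 (nearest_value f) x y\<bar> \<le> \<epsilon> / 3"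
      using walk_nearest_value_Cauchy [OF f, of "\<epsilon> / 3"] x y by (metis zero_less_divide_iff zero_less_numeral)
    have "dist (walk i 0 (nearest_value f) x y) (walk j 0 (nearest_value f) x y) < \<epsilon>" if "i \<ge> n" "j \<ge> n" for i j
    proof -
      have "\<bar>walk i 0 (nearest_value f) x y - walk n 0 (nearest_value f) x y\<bar> \<le> \<epsilon> / 3"
        "\<bar>walk j 0 (nearest_value f) x y - walk n 0 (nearest_value f) x y\<bar> \<le> \<epsilon> / 3"
        using n [of n "i - n"] n [of n "j - n"] that by simp_all
      then show ?thesis
        using \<open>\<epsilon> > 0\<close> unfolding dist_real_def by linarith
    qed
    then show "\<exists>M. \<forall>m\<ge>M. \<forall>n\<ge>M. dist (walk m 0 (nearest_value f) x y) (walk n 0 (nearest_value f) x y) < \<epsilon>"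
      by blast
  qed
  then show ?thesis
    unfolding walk_limit_def by (simp add: Cauchy_convergent_iff convergent_LIMSEQ_iff)
qed

lemma walk_limit_uniform:
  assumes f: "f \<in> measured" and \<epsilon>: "\<epsilon> > 0"
  obtains n where "\<And>n' x y. n \<le> n' \<Longrightarrow> x \<in> topspace K \<Longrightarrow> y \<in> topspace Y \<Longrightarrow>
    \<bar>walk_limit f x y - walk n' 0 (nearest_value f) x y\<bar> \<le> \<epsilon>"
proof -
  obtain n where n: "\<And>n' m x y. n \<le> n' \<Longrightarrow> x \<in> topspace K \<Longrightarrow> y \<in> topspace Y \<Longrightarrow>
    \<bar>walk (n' + m) 0 (nearest_value f) x y - walk n' 0 (nearest_value f) x y\<bar> \<le> \<epsilon>"
    using walk_nearest_value_Cauchy [OF f \<epsilon>] by blast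
  have "\<bar>walk_limit f x y - walk n' 0 (nearest_value f) x y\<bar> \<le> \<epsilon>"
    if "n \<le> n'" and x: "x \<in> topspace K" and y: "y \<in> topspace Y" for n' x y
  proof (rule LIMSEQ_le_const2)
    show "(\<lambda>m. \<bar>walk m 0 (nearest_value f) x y - walk n' 0 (nearest_value f) x y\<bar>)
        \<longlonglongrightarrow> \<bar>walk_limit f x y - walk n' 0 (nearest_value f) x y\<bar>"
      by (intro tendsto_intros walk_nearest_value_tendsto f x y)
    show "\<exists>N. \<forall>m\<ge>N. \<bar>walk m 0 (nearest_value f) x y - walk n' 0 (nearest_value f) x y\<bar> \<le> \<epsilon>"
      using n [OF that, of "_ - n'"] by (metis le_add_diff_inverse)
  qed
  then show thesis
    using that by blast
qed

text \<open>
  The inf-convolution of \<open>f\<close> with a large multiple of \<open>d\<close> is continuous because the fibration is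
  open, and near the fibre it is close to the value of \<open>f\<close> at the nearest fibre point.
\<close>

lemma nearest_value_approx:
  assumes f: "f \<in> measured" and \<epsilon>: "\<epsilon> > 0"
  obtains \<Psi> \<delta> where "admissible \<Psi>" "\<delta> > 0"
    "\<And>x y. x \<in> topspace K \<Longrightarrow> y \<in> topspace Y \<Longrightarrow> dist_fibre x y \<le> \<delta> \<Longrightarrow> \<bar>nearest_value f x y - \<Psi> x y\<bar> \<le> \<epsilon>"
proof -
  have fc: "continuous_map K euclideanreal f"
    using f by (simp add: measured_def)
  obtain B where B: "B > 0" "\<And>x. x \<in> topspace K \<Longrightarrow> \<bar>f x\<bar> \<le> B"
    using continuous_bounded [OF K fc] by blast
  obtain \<delta> where \<delta>: "\<delta> > 0" and mod: "\<And>q q'. q \<in> topspace K \<Longrightarrow> q' \<in> topspace K \<Longrightarrow>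
      agree J q q' \<Longrightarrow> d (e q) (e q') < \<delta> \<Longrightarrow> \<bar>f q - f q'\<bar> < \<epsilon> / 2"
    using measured_modulus [OF f, of "\<epsilon> / 2"] \<epsilon> by auto
  \<comment> \<open>As \<open>f\<close> varies by at most \<open>2 * B\<close>, the minimizer of \<open>f + L * d\<close> on a fibre is at most \<open>\<delta> / 2\<close> farther
    from \<open>y\<close> than the nearest point of the fibre.\<close>
  define L where "L = 4 * B / \<delta>"
  have L: "L > 0"
    using B \<delta> by (simp add: L_def)
  define \<Psi> where "\<Psi> x y = fibre_inf K J (\<lambda>q. f q + L * d (e q) y) x" for x y
  have G: "jointly_continuous K Y (\<lambda>q y. f q + L * d (e q) y)"
    using continuous_map_compose [OF continuous_map_fst fc]
    by (intro continuous_intros d_e_cont) (auto simp: o_def)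
  have adm: "admissible \<Psi>"
    unfolding admissible_def \<Psi>_def
    using jointly_continuous_fibre_inf [OF K J op G] by (auto intro: fibre_inf_eq)
  define \<eta> where "\<eta> = min (\<delta> / 8) (\<epsilon> / (2 * L))"
  have "\<bar>nearest_value f x y - \<Psi> x y\<bar> \<le> \<epsilon>"
    if x: "x \<in> topspace K" and y: "y \<in> topspace Y" and \<rho>: "dist_fibre x y \<le> \<eta>" for x y
  proof -
    let ?q = "nearest x y"
    obtain q where q: "q \<in> fibre K J x" "f q + L * d (e q) y = \<Psi> x y"
      and qmin: "\<And>q'. q' \<in> fibre K J x \<Longrightarrow> \<Psi> x y \<le> f q' + L * d (e q') y"
      using fibre_inf_attained [OF K J x jointly_continuous_left [OF G y], folded \<Psi>_def] by blast
    have qK: "q \<in> topspace K" "agree J x q"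
      using q by (auto simp: fibre_def)
    have up: "\<Psi> x y \<le> f ?q + L * dist_fibre x y"
      using qmin [OF nearest(1) [OF x y]] nearest(2) [OF x y] by simp
    have L\<rho>: "L * dist_fibre x y \<le> \<epsilon> / 2"
      using \<rho> L by (simp add: \<eta>_def field_simps)
    have "L * d (e q) y \<le> L * dist_fibre x y + 2 * B"
      using up q(2) B(2) [OF qK(1)] B(2) [OF nearest_in(1) [OF x y]] by linarith
    also have "2 * B = L * (\<delta> / 2)"
      using \<delta> by (simp add: L_def)
    finally have "L * d (e q) y \<le> L * (dist_fibre x y + \<delta> / 2)"
      by (simp add: algebra_simps)
    then have "d (e q) y \<le> dist_fibre x y + \<delta> / 2"
      using L by simp
    moreover have "dist_fibre x y \<le> \<delta> / 8"
      using \<rho> by (simp add: \<eta>_def)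
    moreover have "d (e q) (e ?q) \<le> d (e q) y + dist_fibre x y"
      using d_triangle [OF e_in [OF qK(1)] y nearest_in(3) [OF x y]] nearest(2) [OF x y] d_sym
      by metis
    ultimately have "d (e q) (e ?q) < \<delta>"
      using \<delta> by linarith
    moreover have "agree J q ?q"
      using qK(2) nearest_in(2) [OF x y] agree_trans agree_sym by metis
    ultimately have "\<bar>f q - f ?q\<bar> < \<epsilon> / 2"
      using mod qK(1) nearest_in(1) [OF x y] by blast
    moreover have "0 \<le> L * d (e q) y"
      using L d_bounds [OF e_in [OF qK(1)] y] by simp
    ultimately show ?thesis
      using up L\<rho> q(2) \<epsilon> unfolding nearest_value_def by linarith
  qed
  moreover have "\<eta> > 0"
    using \<delta> \<epsilon> L by (simp add: \<eta>_def)
  ultimately show thesis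
    using that adm by blast
qed

lemma walk_limit_approx:
  assumes f: "f \<in> measured" and \<epsilon>: "\<epsilon> > 0"
  obtains \<Psi> where "admissible \<Psi>"
    "\<And>x y. x \<in> topspace K \<Longrightarrow> y \<in> topspace Y \<Longrightarrow> \<bar>walk_limit f x y - \<Psi> x y\<bar> \<le> \<epsilon>"
proof -
  obtain \<Psi> \<delta> where \<Psi>: "admissible \<Psi>" and \<delta>: "\<delta> > 0" and near:
    "\<And>x y. x \<in> topspace K \<Longrightarrow> y \<in> topspace Y \<Longrightarrow> dist_fibre x y \<le> \<delta> \<Longrightarrow> \<bar>nearest_value f x y - \<Psi> x y\<bar> \<le> \<epsilon> / 2"
    using nearest_value_approx [OF f, of "\<epsilon> / 2"] \<epsilon> by (metis half_gt_zero)
  obtain n1 where n1: "\<And>n' x y. n1 \<le> n' \<Longrightarrow> x \<in> topspace K \<Longrightarrow> y \<in> topspace Y \<Longrightarrow>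
    \<bar>walk_limit f x y - walk n' 0 (nearest_value f) x y\<bar> \<le> \<epsilon> / 2"
    using walk_limit_uniform [OF f, of "\<epsilon> / 2"] \<epsilon> by (metis half_gt_zero)
  obtain n2 where n2: "(1/2) ^ n2 < \<delta> / 2"
    using real_arch_pow_inv [of "\<delta> / 2" "1/2"] \<delta> by auto
  let ?n = "max n1 n2"
  have "(1/2::real) ^ ?n \<le> (1/2) ^ n2"
    by (intro power_decreasing) auto
  then have n: "2 * (1/2) ^ ?n \<le> \<delta>"
    using n2 by linarith
  have "\<bar>walk_limit f x y - walk ?n 0 \<Psi> x y\<bar> \<le> \<epsilon>" if x: "x \<in> topspace K" and y: "y \<in> topspace Y" for x y
  proof -
    have "- (\<epsilon> / 2) \<le> nearest_value f x y' - \<Psi> x y' \<and> nearest_value f x y' - \<Psi> x y' \<le> \<epsilon> / 2"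
      if "y' \<in> topspace Y" "dist_fibre x y' \<le> 2 * (1/2) ^ ?n" for y'
      using near [OF x that(1)] that(2) n by linarith
    then have "- (\<epsilon> / 2) \<le> walk ?n 0 (\<lambda>x y. nearest_value f x y - \<Psi> x y) x y \<and>
        walk ?n 0 (\<lambda>x y. nearest_value f x y - \<Psi> x y) x y \<le> \<epsilon> / 2"
      by (intro walk_0_bounds [OF x y]) auto
    then have "\<bar>walk ?n 0 (nearest_value f) x y - walk ?n 0 \<Psi> x y\<bar> \<le> \<epsilon> / 2"
      unfolding walk_diff abs_le_iff by linarith
    then show ?thesis
      using n1 [of ?n, OF _ x y] by linarith
  qed
  then show thesis
    using that walk_admissible [OF \<Psi>] by blast
qed

lemma walk_limit_admissible:
  assumes f: "f \<in> measured"
  shows "admissible (walk_limit f)"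
  unfolding admissible_def
proof (intro conjI ballI impI)
  show "jointly_continuous K Y (walk_limit f)"
  proof (rule continuous_map_uniform_approx)
    fix \<epsilon> :: real
    assume "\<epsilon> > 0"
    from walk_limit_approx [OF f this] obtain \<Psi> where \<Psi>: "admissible \<Psi>"
      and ap: "\<And>x y. x \<in> topspace K \<Longrightarrow> y \<in> topspace Y \<Longrightarrow> \<bar>walk_limit f x y - \<Psi> x y\<bar> \<le> \<epsilon>" by blast
    have "jointly_continuous K Y \<Psi>"
      using \<Psi> by (simp add: admissible_def)
    moreover have "\<bar>walk_limit f (fst p) (snd p) - \<Psi> (fst p) (snd p)\<bar> \<le> \<epsilon>"
      if "p \<in> topspace (prod_topology K Y)" for p
      using that ap [of "fst p" "snd p"] by auto
    ultimately show "\<exists>g. continuous_map (prod_topology K Y) euclideanreal g \<and>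
        (\<forall>p\<in>topspace (prod_topology K Y). \<bar>walk_limit f (fst p) (snd p) - g p\<bar> \<le> \<epsilon>)"
      by (intro exI [of _ "\<lambda>p. \<Psi> (fst p) (snd p)"]) blast
  qed
  fix y x x'
  assume y: "y \<in> topspace Y" and x: "x \<in> topspace K" and x': "x' \<in> topspace K"
    and "agree J x x'"
  show "walk_limit f x y = walk_limit f x' y"
  proof (rule ccontr)
    assume neq: "walk_limit f x y \<noteq> walk_limit f x' y"
    define \<epsilon> where "\<epsilon> = \<bar>walk_limit f x y - walk_limit f x' y\<bar> / 3"
    have \<epsilon>: "\<bar>walk_limit f x y - walk_limit f x' y\<bar> = 3 * \<epsilon>" and "\<epsilon> > 0"
      using neq by (auto simp: \<epsilon>_def)
    from walk_limit_approx [OF f this(2)] obtain \<Psi> where \<Psi>: "admissible \<Psi>"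
      and ap: "\<And>x y. x \<in> topspace K \<Longrightarrow> y \<in> topspace Y \<Longrightarrow> \<bar>walk_limit f x y - \<Psi> x y\<bar> \<le> \<epsilon>" by blast
    have "\<Psi> x y = \<Psi> x' y"
      using \<Psi> x x' y \<open>agree J x x'\<close> unfolding admissible_def by blast
    then show False
      using ap [OF x y] ap [OF x' y] \<epsilon> \<open>\<epsilon> > 0\<close> by linarith
  qed
qed

lemma measured_add:
  assumes "f \<in> measured" "g \<in> measured"
  shows "(\<lambda>x. f x + g x) \<in> measured"
proof (rule measuredI)
  show "continuous_map K euclideanreal (\<lambda>x. f x + g x)"
    using assms by (intro continuous_map_add measured_cont)
  fix q q'
  assume "q \<in> topspace K" "q' \<in> topspace K" "agree J q q'" "d (e q) (e q') = 0"
  then show "f q + g q = f q' + g q'"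
    using measuredD [OF assms(1)] measuredD [OF assms(2)] by metis
qed

lemma measured_scale:
  assumes "f \<in> measured"
  shows "(\<lambda>x. c * f x) \<in> measured"
proof (rule measuredI)
  show "continuous_map K euclideanreal (\<lambda>x. c * f x)"
    using assms by (intro continuous_map_real_mult_left measured_cont)
  fix q q'
  assume "q \<in> topspace K" "q' \<in> topspace K" "agree J q q'" "d (e q) (e q') = 0"
  then show "c * f q = c * f q'"
    using measuredD [OF assms] by metis
qed

lemma walk_limit_add:
  assumes f: "f \<in> measured" and g: "g \<in> measured" and x: "x \<in> topspace K" and y: "y \<in> topspace Y"
  shows "walk_limit (\<lambda>x. f x + g x) x y = walk_limit f x y + walk_limit g x y"
proof (rule LIMSEQ_unique)
  have "nearest_value (\<lambda>x. f x + g x) = (\<lambda>x y. nearest_value f x y + nearest_value g x y)"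
    by (simp add: nearest_value_def fun_eq_iff)
  then show "(\<lambda>n. walk n 0 (nearest_value f) x y + walk n 0 (nearest_value g) x y) \<longlonglongrightarrow> walk_limit (\<lambda>x. f x + g x) x y"
    using walk_nearest_value_tendsto [OF measured_add [OF f g] x y] by (simp add: walk_add)
  show "(\<lambda>n. walk n 0 (nearest_value f) x y + walk n 0 (nearest_value g) x y) \<longlonglongrightarrow> walk_limit f x y + walk_limit g x y"
    by (intro tendsto_intros walk_nearest_value_tendsto f g x y)
qed

lemma walk_limit_scale:
  assumes f: "f \<in> measured" and x: "x \<in> topspace K" and y: "y \<in> topspace Y"
  shows "walk_limit (\<lambda>x. c * f x) x y = c * walk_limit f x y"
proof (rule LIMSEQ_unique)
  have "nearest_value (\<lambda>x. c * f x) = (\<lambda>x y. c * nearest_value f x y)"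
    by (simp add: nearest_value_def fun_eq_iff)
  then show "(\<lambda>n. c * walk n 0 (nearest_value f) x y) \<longlonglongrightarrow> walk_limit (\<lambda>x. c * f x) x y"
    using walk_nearest_value_tendsto [OF measured_scale [OF f, of c] x y] by (simp add: walk_scale)
  show "(\<lambda>n. c * walk n 0 (nearest_value f) x y) \<longlonglongrightarrow> c * walk_limit f x y"
    by (intro tendsto_intros walk_nearest_value_tendsto f x y)
qed

text \<open>
  The limit distribution lives on the fibre through \<open>x\<close>. This gives positivity, and it also shows
  that functions that are constant on the fibres are reproduced.
\<close>

lemma walk_limit_bounds:
  assumes f: "f \<in> measured" and x: "x \<in> topspace K" and y: "y \<in> topspace Y"
    and b: "\<And>q. q \<in> fibre K J x \<Longrightarrow> lo \<le> f q \<and> f q \<le> hi"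
  shows "lo \<le> walk_limit f x y \<and> walk_limit f x y \<le> hi"
proof -
  have "lo \<le> walk n 0 (nearest_value f) x y \<and> walk n 0 (nearest_value f) x y \<le> hi" for n
    using b nearest(1) [OF x] by (intro walk_0_bounds [OF x y]) (auto simp: nearest_value_def)
  then show ?thesis
    using walk_nearest_value_tendsto [OF f x y] by (meson LIMSEQ_le_const LIMSEQ_le_const2)
qed

lemma walk_limit_extends:
  assumes f: "f \<in> measured" and x: "x \<in> topspace K"
  shows "walk_limit f x (e x) = f x"
proof -
  have ex: "e x \<in> topspace Y"
    by (rule e_in [OF x])
  have "d (e (nearest x (e x))) (e x) = 0"
    using nearest(2) [OF x ex] dist_fibre_self [OF x] by simp
  then have "f (nearest x (e x)) = f x"
    using measuredD [OF f nearest_in(1) [OF x ex] x] agree_sym [OF nearest_in(2) [OF x ex]] by blast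
  then have "walk n 0 (nearest_value f) x (e x) = f x" for n
    by (simp add: walk_on_fibre dist_fibre_self [OF x] nearest_value_def)
  then show ?thesis
    using walk_nearest_value_tendsto [OF f x ex] by (simp add: LIMSEQ_const_iff)
qed

lemma walk_limit_determined:
  assumes f: "f \<in> determined K J" and x: "x \<in> topspace K" and y: "y \<in> topspace Y"
  shows "walk_limit f x y = f x"
proof -
  have "f \<in> measured"
    using determined_cont [OF f] determinedD [OF f] by (rule measuredI)
  moreover have "f q = f x" if "q \<in> fibre K J x" for q
    using that determinedD [OF f x, of q] by (simp add: fibre_def)
  ultimately show ?thesis
    using walk_limit_bounds [OF _ x y, of f "f x" "f x"] by auto
qed

end

section \<open>Regular extension operators on subspaces\<close>

text \<open>
  The functions are not required to be extensional, so an operator is only determined up to the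
  values on \<open>topspace Y\<close>.
\<close>

definition regular_on ::
    "'k topology \<Rightarrow> 'y topology \<Rightarrow> ('k \<Rightarrow> 'y) \<Rightarrow> ('k \<Rightarrow> real) set \<Rightarrow> (('k \<Rightarrow> real) \<Rightarrow> 'y \<Rightarrow> real) \<Rightarrow> bool"
  where "regular_on K Y e L u \<longleftrightarrow>
    (\<forall>f\<in>L. continuous_map Y euclideanreal (u f)) \<and>
    (\<forall>f\<in>L. \<forall>g\<in>L. \<forall>y\<in>topspace Y. u (\<lambda>x. f x + g x) y = u f y + u g y) \<and>
    (\<forall>c. \<forall>f\<in>L. \<forall>y\<in>topspace Y. u (\<lambda>x. c * f x) y = c * u f y) \<and>
    (\<forall>f\<in>L. \<forall>x\<in>topspace K. u f (e x) = f x) \<and>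
    (\<forall>y\<in>topspace Y. u (\<lambda>_. 1) y = 1) \<and>
    (\<forall>f\<in>L. (\<forall>x\<in>topspace K. 0 \<le> f x) \<longrightarrow> (\<forall>y\<in>topspace Y. 0 \<le> u f y))"

definition function_space :: "('k \<Rightarrow> real) set \<Rightarrow> bool"
  where "function_space L \<longleftrightarrow> (\<lambda>_. 1) \<in> L \<and>
    (\<forall>f\<in>L. \<forall>g\<in>L. (\<lambda>x. f x + g x) \<in> L) \<and> (\<forall>c. \<forall>f\<in>L. (\<lambda>x. c * f x) \<in> L)"

lemma function_spaceD:
  assumes "function_space L"
  shows "(\<lambda>_. 1) \<in> L" "f \<in> L \<Longrightarrow> g \<in> L \<Longrightarrow> (\<lambda>x. f x + g x) \<in> L" "f \<in> L \<Longrightarrow> (\<lambda>x. c * f x) \<in> L"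
  using assms unfolding function_space_def by blast+

lemma function_space_const:
  assumes "function_space L"
  shows "(\<lambda>_. c) \<in> L"
  using function_spaceD(3) [OF assms function_spaceD(1) [OF assms], of c] by simp

lemma function_space_determined: "function_space (determined K J)"
  unfolding function_space_def
proof (intro conjI ballI allI)
  show "(\<lambda>_. 1) \<in> determined K J"
    by (rule determinedI) auto
  fix f and g :: "'a \<Rightarrow> real" and c
  assume f: "f \<in> determined K J"
  show "(\<lambda>x. c * f x) \<in> determined K J"
    by (intro determinedI continuous_map_real_mult_left determined_cont [OF f])
      (metis determinedD [OF f])
  assume g: "g \<in> determined K J"
  show "(\<lambda>x. f x + g x) \<in> determined K J"
    by (intro determinedI continuous_map_add determined_cont [OF f] determined_cont [OF g])
      (metis determinedD [OF f] determinedD [OF g])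
qed

lemma regular_onI:
  assumes "\<And>f. f \<in> L \<Longrightarrow> continuous_map Y euclideanreal (u f)"
    and "\<And>f g y. f \<in> L \<Longrightarrow> g \<in> L \<Longrightarrow> y \<in> topspace Y \<Longrightarrow> u (\<lambda>x. f x + g x) y = u f y + u g y"
    and "\<And>c f y. f \<in> L \<Longrightarrow> y \<in> topspace Y \<Longrightarrow> u (\<lambda>x. c * f x) y = c * u f y"
    and "\<And>f x. f \<in> L \<Longrightarrow> x \<in> topspace K \<Longrightarrow> u f (e x) = f x"
    and "\<And>y. y \<in> topspace Y \<Longrightarrow> u (\<lambda>_. 1) y = 1"
    and "\<And>f y. f \<in> L \<Longrightarrow> (\<And>x. x \<in> topspace K \<Longrightarrow> 0 \<le> f x) \<Longrightarrow> y \<in> topspace Y \<Longrightarrow> 0 \<le> u f y"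
  shows "regular_on K Y e L u"
  using assms unfolding regular_on_def by blast

lemma regular_onD:
  assumes "regular_on K Y e L u"
  shows "f \<in> L \<Longrightarrow> continuous_map Y euclideanreal (u f)"
    and "f \<in> L \<Longrightarrow> g \<in> L \<Longrightarrow> y \<in> topspace Y \<Longrightarrow> u (\<lambda>x. f x + g x) y = u f y + u g y"
    and "f \<in> L \<Longrightarrow> y \<in> topspace Y \<Longrightarrow> u (\<lambda>x. c * f x) y = c * u f y"
    and "f \<in> L \<Longrightarrow> x \<in> topspace K \<Longrightarrow> u f (e x) = f x"
    and "y \<in> topspace Y \<Longrightarrow> u (\<lambda>_. 1) y = 1"
    and "f \<in> L \<Longrightarrow> (\<And>x. x \<in> topspace K \<Longrightarrow> 0 \<le> f x) \<Longrightarrow> y \<in> topspace Y \<Longrightarrow> 0 \<le> u f y"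
  using assms unfolding regular_on_def by blast+

lemma regular_on_le:
  assumes L: "function_space L" and u: "regular_on K Y e L u"
    and f: "f \<in> L" and g: "g \<in> L" and y: "y \<in> topspace Y"
    and le: "\<And>x. x \<in> topspace K \<Longrightarrow> f x \<le> g x + c"
  shows "u f y \<le> u g y + c"
proof -
  let ?c = "\<lambda>_. c * 1" and ?f = "\<lambda>x. (-1) * f x"
  have c: "?c \<in> L" and f': "?f \<in> L" and gc: "(\<lambda>x. g x + ?c x) \<in> L"
    using function_spaceD [OF L] f g by blast+
  then have all: "(\<lambda>x. (g x + ?c x) + ?f x) \<in> L"
    using function_spaceD(2) [OF L] by blast
  have "0 \<le> u (\<lambda>x. (g x + ?c x) + ?f x) y"
    using le by (intro regular_onD(6) [OF u all _ y]) fastforce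
  also have "\<dots> = u g y + u ?c y + u ?f y"
    using regular_onD(2) [OF u gc f' y] regular_onD(2) [OF u g c y] by simp
  also have "u ?c y = c"
    using regular_onD(3) [OF u function_spaceD(1) [OF L] y, of c] regular_onD(5) [OF u y] by simp
  also have "u ?f y = - u f y"
    using regular_onD(3) [OF u f y, of "-1"] by simp
  finally show ?thesis
    by simp
qed

lemma regular_on_abs_le:
  assumes "function_space L" "regular_on K Y e L u" "f \<in> L" "g \<in> L" "y \<in> topspace Y"
    and "\<And>x. x \<in> topspace K \<Longrightarrow> \<bar>f x - g x\<bar> \<le> c"
  shows "\<bar>u f y - u g y\<bar> \<le> c"
proof -
  have "u f y \<le> u g y + c" "u g y \<le> u f y + c"
    using assms(6) by (intro regular_on_le [OF assms(1,2)] assms; force simp: abs_le_iff)+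
  then show ?thesis by linarith
qed

lemma regular_on_cong:
  assumes "function_space L" "regular_on K Y e L u" "f \<in> L" "g \<in> L" "y \<in> topspace Y"
    and "\<And>x. x \<in> topspace K \<Longrightarrow> f x = g x"
  shows "u f y = u g y"
  using regular_on_abs_le [OF assms(1-5), of 0] assms(6) by simp

lemma eq_if_close:
  fixes a b :: real
  assumes "\<And>\<epsilon>. \<epsilon> > 0 \<Longrightarrow> \<bar>a - b\<bar> \<le> 4 * \<epsilon>"
  shows "a = b"
proof (rule ccontr)
  assume "a \<noteq> b"
  then have "\<bar>a - b\<bar> > 0" by simp
  then show False
    using assms [of "\<bar>a - b\<bar> / 8"] by simp
qed

text \<open>
  A regular operator is monotone and contracts the uniform norm, so it extends to uniform limits.
  The infimum over majorants defines the extension without a choice of approximating sequences.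
\<close>

lemma regular_on_dense_extension:
  assumes L: "function_space L" and u: "regular_on K Y e L u" and e: "continuous_map K Y e"
    and L': "function_space L'" and LL': "L \<subseteq> L'"
    and dense: "\<And>F \<epsilon>. F \<in> L' \<Longrightarrow> \<epsilon> > 0 \<Longrightarrow> \<exists>h\<in>L. \<forall>x\<in>topspace K. \<bar>F x - h x\<bar> \<le> \<epsilon>"
  obtains u' where "regular_on K Y e L' u'" "\<And>f y. f \<in> L \<Longrightarrow> y \<in> topspace Y \<Longrightarrow> u' f y = u f y"
proof -
  define M where "M F = {h \<in> L. \<forall>x\<in>topspace K. F x \<le> h x}" for F
  define u' where "u' F y = Inf ((\<lambda>h. u h y) ` M F)" for F y
  have key: "\<bar>u' F y - u h y\<bar> \<le> \<epsilon>"
    if h: "h \<in> L" and y: "y \<in> topspace Y" and close: "\<And>x. x \<in> topspace K \<Longrightarrow> \<bar>F x - h x\<bar> \<le> \<epsilon>"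
    for F h y \<epsilon>
  proof -
    let ?h = "\<lambda>x. h x + \<epsilon>"
    have hL: "?h \<in> L"
      using function_spaceD(2) [OF L h function_space_const [OF L]] .
    have lower: "u h y - \<epsilon> \<le> u h' y" if "h' \<in> M F" for h'
    proof -
      have "u h y \<le> u h' y + \<epsilon>"
      proof (rule regular_on_le [OF L u h _ y])
        show "h x \<le> h' x + \<epsilon>" if "x \<in> topspace K" for x
          using close [OF that] \<open>h' \<in> M F\<close> that unfolding M_def by fastforce
      qed (use that M_def in blast)
      then show ?thesis by simp
    qed
    have "?h \<in> M F"
      using hL close unfolding M_def by (fastforce simp: abs_le_iff)
    then have "u' F y \<le> u ?h y" "u h y - \<epsilon> \<le> u' F y"
      unfolding u'_def using lower by (auto intro!: cInf_lower cInf_greatest bdd_belowI2)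
    moreover have "u ?h y \<le> u h y + \<epsilon>"
      by (rule regular_on_le [OF L u hL h y]) simp
    ultimately show ?thesis by linarith
  qed
  have ext: "u' f y = u f y" if "f \<in> L" "y \<in> topspace Y" for f y
    using key [OF that, of f 0] by simp
  have "regular_on K Y e L' u'"
  proof (rule regular_onI)
    fix F
    assume F: "F \<in> L'"
    show "continuous_map Y euclideanreal (u' F)"
    proof (rule continuous_map_uniform_approx)
      fix \<epsilon> :: real
      assume "\<epsilon> > 0"
      then obtain h where h: "h \<in> L" "\<And>x. x \<in> topspace K \<Longrightarrow> \<bar>F x - h x\<bar> \<le> \<epsilon>"
        using dense [OF F] by blast
      show "\<exists>g. continuous_map Y euclideanreal g \<and> (\<forall>y\<in>topspace Y. \<bar>u' F y - g y\<bar> \<le> \<epsilon>)"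
        using key [OF h(1) _ h(2)] regular_onD(1) [OF u h(1)] by blast
    qed
  next
    fix F G y
    assume F: "F \<in> L'" and G: "G \<in> L'" and y: "y \<in> topspace Y"
    show "u' (\<lambda>x. F x + G x) y = u' F y + u' G y"
    proof (rule eq_if_close)
      fix \<epsilon> :: real
      assume "\<epsilon> > 0"
      then obtain h k where h: "h \<in> L" "\<And>x. x \<in> topspace K \<Longrightarrow> \<bar>F x - h x\<bar> \<le> \<epsilon>"
        and k: "k \<in> L" "\<And>x. x \<in> topspace K \<Longrightarrow> \<bar>G x - k x\<bar> \<le> \<epsilon>"
        using dense [OF F] dense [OF G] by metis
      have "\<bar>F x + G x - (h x + k x)\<bar> \<le> 2 * \<epsilon>" if "x \<in> topspace K" for x
        using h(2) [OF that] k(2) [OF that] by linarith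
      then have "\<bar>u' (\<lambda>x. F x + G x) y - u (\<lambda>x. h x + k x) y\<bar> \<le> 2 * \<epsilon>"
        by (rule key [OF function_spaceD(2) [OF L h(1) k(1)] y])
      then show "\<bar>u' (\<lambda>x. F x + G x) y - (u' F y + u' G y)\<bar> \<le> 4 * \<epsilon>"
        using key [OF h(1) y h(2)] key [OF k(1) y k(2)] regular_onD(2) [OF u h(1) k(1) y]
        by linarith
    qed
  next
    fix c F y
    assume F: "F \<in> L'" and y: "y \<in> topspace Y"
    show "u' (\<lambda>x. c * F x) y = c * u' F y"
    proof (rule eq_if_close)
      fix \<epsilon> :: real
      assume \<epsilon>: "\<epsilon> > 0"
      \<comment> \<open>The summand 1 covers the case \<open>c = 0\<close>.\<close>
      define \<delta> where "\<delta> = \<epsilon> / (\<bar>c\<bar> + 1)"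
      have "\<delta> > 0" and c\<delta>: "\<bar>c\<bar> * \<delta> \<le> \<epsilon>"
        using \<epsilon> by (auto simp: \<delta>_def field_simps)
      then obtain h where h: "h \<in> L" "\<And>x. x \<in> topspace K \<Longrightarrow> \<bar>F x - h x\<bar> \<le> \<delta>"
        using dense [OF F] by metis
      have scale: "\<bar>c * a - c * b\<bar> \<le> \<epsilon>" if "\<bar>a - b\<bar> \<le> \<delta>" for a b
      proof -
        have "\<bar>c * a - c * b\<bar> = \<bar>c\<bar> * \<bar>a - b\<bar>"
          by (simp add: abs_mult flip: right_diff_distrib)
        also have "\<dots> \<le> \<bar>c\<bar> * \<delta>"
          using that by (intro mult_left_mono) auto
        finally show ?thesis
          using c\<delta> by linarith
      qed
      have "\<bar>u' (\<lambda>x. c * F x) y - u (\<lambda>x. c * h x) y\<bar> \<le> \<epsilon>"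
        using scale h(2) by (intro key [OF function_spaceD(3) [OF L h(1)] y]) blast
      moreover have "\<bar>c * u' F y - c * u h y\<bar> \<le> \<epsilon>"
        by (rule scale [OF key [OF h(1) y h(2)]])
      ultimately show "\<bar>u' (\<lambda>x. c * F x) y - c * u' F y\<bar> \<le> 4 * \<epsilon>"
        using regular_onD(3) [OF u h(1) y, of c] \<epsilon> by linarith
    qed
  next
    fix F x
    assume F: "F \<in> L'" and x: "x \<in> topspace K"
    then have ex: "e x \<in> topspace Y"
      using e by (auto simp: continuous_map_def)
    show "u' F (e x) = F x"
    proof (rule eq_if_close)
      fix \<epsilon> :: real
      assume "\<epsilon> > 0"
      then obtain h where h: "h \<in> L" "\<And>x. x \<in> topspace K \<Longrightarrow> \<bar>F x - h x\<bar> \<le> \<epsilon>"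
        using dense [OF F] by blast
      show "\<bar>u' F (e x) - F x\<bar> \<le> 4 * \<epsilon>"
        using key [OF h(1) ex h(2)] h(2) [OF x] regular_onD(4) [OF u h(1) x] \<open>\<epsilon> > 0\<close> by linarith
    qed
  next
    fix y
    assume "y \<in> topspace Y"
    then show "u' (\<lambda>_. 1) y = 1"
      using ext [OF function_spaceD(1) [OF L]] regular_onD(5) [OF u] by simp
  next
    fix F y
    assume F: "F \<in> L'" and pos: "\<And>x. x \<in> topspace K \<Longrightarrow> 0 \<le> F x" and y: "y \<in> topspace Y"
    show "0 \<le> u' F y"
    proof (rule ccontr)
      assume neg: "\<not> 0 \<le> u' F y"
      define \<epsilon> where "\<epsilon> = - u' F y / 3"
      have "\<epsilon> > 0" and \<epsilon>: "u' F y = - (3 * \<epsilon>)"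
        using neg by (auto simp: \<epsilon>_def)
      then obtain h where h: "h \<in> L" "\<And>x. x \<in> topspace K \<Longrightarrow> \<bar>F x - h x\<bar> \<le> \<epsilon>"
        using dense [OF F] by blast
      have "u (\<lambda>_. 0 * 1) y \<le> u h y + \<epsilon>"
      proof (rule regular_on_le [OF L u function_spaceD(3) [OF L function_spaceD(1) [OF L]] h(1) y])
        show "0 * 1 \<le> h x + \<epsilon>" if "x \<in> topspace K" for x
          using h(2) [OF that] pos [OF that] by linarith
      qed
      moreover have "u (\<lambda>_. 0 * 1) y = 0"
        using regular_onD(3) [OF u function_spaceD(1) [OF L] y, of 0] by simp
      ultimately show False
        using key [OF h(1) y h(2)] \<epsilon> \<open>\<epsilon> > 0\<close> by linarith
    qed
  qed
  with ext show thesis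
    using that by blast
qed

section \<open>Adding countably many coordinates\<close>

lemma embedding_map_continuous:
  assumes "embedding_map K Y e"
  shows "continuous_map K Y e"
proof -
  have "continuous_map K (subtopology Y (e ` topspace K)) e"
    using assms unfolding embedding_map_def by (rule homeomorphic_imp_continuous_map)
  then show ?thesis
    by (simp add: continuous_map_in_subtopology)
qed

lemma embedding_Tietze:
  assumes K: "compact_space K" and Y: "compact_space Y" "Hausdorff_space Y"
    and e: "embedding_map K Y e" and f: "continuous_map K euclideanreal f"
  obtains g where "continuous_map Y euclideanreal g" "\<And>x. x \<in> topspace K \<Longrightarrow> g (e x) = f x"
proof -
  let ?E = "e ` topspace K"
  obtain i where i: "homeomorphic_maps K (subtopology Y ?E) e i"
    using e unfolding embedding_map_def homeomorphic_map_maps by blast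
  have "compactin Y ?E"
    using K embedding_map_continuous [OF e] image_compactin by (metis compact_space_def)
  then have "closedin Y ?E"
    using Y compactin_imp_closedin by blast
  moreover have "continuous_map (subtopology Y ?E) euclideanreal (f \<circ> i)"
    using i f by (meson continuous_map_compose homeomorphic_maps_def)
  moreover have "normal_space Y"
    using Y by (simp add: compact_Hausdorff_or_regular_imp_normal_space)
  ultimately obtain g where g: "continuous_map Y euclideanreal g" "\<And>y. y \<in> ?E \<Longrightarrow> g y = (f \<circ> i) y"
    using Tietze_extension_realinterval [of Y ?E UNIV "f \<circ> i"] by auto
  show thesis
  proof
    show "g (e x) = f x" if "x \<in> topspace K" for x
      using g(2) i that by (simp add: homeomorphic_maps_def)
  qed (rule g)
qed

text \<open>
  The functions in \<open>D\<close> are extended from \<open>K\<close> to \<open>Y\<close> by Tietze's theorem, and the truncated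
  differences of the extensions are summed.
\<close>

lemma countable_pseudometric:
  assumes K: "compact_space K" and Y: "compact_space Y" "Hausdorff_space Y"
    and e: "embedding_map K Y e" and D: "countable D" "D \<noteq> {}" "D \<subseteq> real_maps K"
  obtains d where "jointly_continuous Y Y d" "\<And>y. d y y = 0" "\<And>y y'. d y y' = d y' y"
    "\<And>y y' y''. d y y'' \<le> d y y' + d y' y''" "\<And>y y'. 0 \<le> d y y' \<and> d y y' \<le> (2::real)"
    "\<And>q q'. q \<in> topspace K \<Longrightarrow> q' \<in> topspace K \<Longrightarrow> d (e q) (e q') = 0 \<Longrightarrow> agree D q q'"
proof -
  have "\<forall>i. \<exists>g. continuous_map Y euclideanreal g \<and>
      (\<forall>x\<in>topspace K. g (e x) = from_nat_into D i x)"
  proof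
    fix i
    have "continuous_map K euclideanreal (from_nat_into D i)"
      using from_nat_into [OF D(2)] D(3) by blast
    then show "\<exists>g. continuous_map Y euclideanreal g \<and> (\<forall>x\<in>topspace K. g (e x) = from_nat_into D i x)"
      using embedding_Tietze [OF K Y e] by metis
  qed
  then obtain g where g: "\<And>i. continuous_map Y euclideanreal (g i)"
    "\<And>i x. x \<in> topspace K \<Longrightarrow> g i (e x) = from_nat_into D i x"
    by metis
  define \<phi> where "\<phi> i p = min 1 \<bar>g i (fst p) - g i (snd p)\<bar>" for i p
  define d where "d y y' = half_series \<phi> (y, y')" for y y'
  have \<phi>: "0 \<le> \<phi> i p \<and> \<phi> i p \<le> 1" for i p
    by (simp add: \<phi>_def)
  have sm: "summable (\<lambda>i. (1/2) ^ i * \<phi> i p)" for p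
    using half_series_summable [of UNIV \<phi>] \<phi> by blast
  show thesis
  proof
    have "continuous_map (prod_topology Y Y) euclideanreal (\<phi> i)" for i
      unfolding \<phi>_def
      using continuous_map_compose [OF continuous_map_fst g(1)] continuous_map_compose [OF continuous_map_snd g(1)]
      by (intro continuous_intros) (auto simp: o_def)
    from continuous_map_half_series [OF this] \<phi>
    show "jointly_continuous Y Y d"
      by (simp add: d_def)
    show "d y y = 0" for y
      by (simp add: d_def half_series_def \<phi>_def)
    show "d y y' = d y' y" for y y'
      by (simp add: d_def half_series_def \<phi>_def abs_minus_commute)
    show "0 \<le> d y y' \<and> d y y' \<le> 2" for y y'
      unfolding d_def using half_series_nonneg [of UNIV \<phi>] half_series_le_2 [of UNIV \<phi>] \<phi> by blast
    show "d y y'' \<le> d y y' + d y' y''" for y y' y''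
    proof -
      have "\<phi> i (y, y'') \<le> \<phi> i (y, y') + \<phi> i (y', y'')" for i
        unfolding \<phi>_def fst_conv snd_conv by linarith
      then have "(1/2) ^ i * \<phi> i (y, y'') \<le> (1/2) ^ i * \<phi> i (y, y') + (1/2) ^ i * \<phi> i (y', y'')" for i
        by (simp flip: distrib_left)
      then have "(\<Sum>i. (1/2) ^ i * \<phi> i (y, y''))
          \<le> (\<Sum>i. (1/2) ^ i * \<phi> i (y, y') + (1/2) ^ i * \<phi> i (y', y''))"
        by (intro suminf_le sm summable_add)
      also have "\<dots> = (\<Sum>i. (1/2) ^ i * \<phi> i (y, y')) + (\<Sum>i. (1/2) ^ i * \<phi> i (y', y''))"
        by (rule suminf_add [OF sm sm, symmetric])
      finally show ?thesis
        by (simp add: d_def half_series_def)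
    qed
    show "agree D q q'" if q: "q \<in> topspace K" "q' \<in> topspace K" and 0: "d (e q) (e q') = 0" for q q'
    proof -
      have "\<phi> i (e q, e q') = 0" for i
        using half_series_eq_0 [of UNIV \<phi> "(e q, e q')"] \<phi> 0 by (simp add: d_def)
      then have "min 1 \<bar>from_nat_into D i q - from_nat_into D i q'\<bar> = 0" for i
        using g(2) q by (simp add: \<phi>_def)
      then have "from_nat_into D i q = from_nat_into D i q'" for i
        by (smt (verit))
      then show ?thesis
        unfolding agree_def using from_nat_into_surj [OF D(1)] by metis
    qed
  qed
qed

text \<open>
  For fixed \<open>y\<close> the walk turns a function of the coordinates \<open>J \<union> D\<close> into one of the coordinates
  \<open>J\<close>, to which \<open>u\<close> applies; the result is then evaluated at the same \<open>y\<close>. At \<open>y = e x\<close> the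
  function obtained from the walk has the value \<open>f x\<close> at \<open>x\<close>, which is the extension property.
\<close>

lemma regular_on_countable_extension:
  assumes K: "compact_space K" and Y: "compact_space Y" "Hausdorff_space Y"
    and e: "embedding_map K Y e" and J: "J \<subseteq> real_maps K" and op: "openly_fibred K J"
    and D: "countable D" "D \<subseteq> real_maps K"
    and u: "regular_on K Y e (determined K J) u"
  obtains u' where "regular_on K Y e (determined K (J \<union> D)) u'"
    "\<And>f y. f \<in> determined K J \<Longrightarrow> y \<in> topspace Y \<Longrightarrow> u' f y = u f y"
proof (cases "D = {}")
  case True
  then show thesis using that u by simp
next
  case False
  obtain d where d: "jointly_continuous Y Y d" "\<And>y. d y y = 0" "\<And>y y'. d y y' = d y' y"
    "\<And>y y' y''. d y y'' \<le> d y y' + d y' y''" "\<And>y y'. 0 \<le> d y y' \<and> d y y' \<le> (2::real)"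
    and dD: "\<And>q q'. q \<in> topspace K \<Longrightarrow> q' \<in> topspace K \<Longrightarrow> d (e q) (e q') = 0 \<Longrightarrow> agree D q q'"
    using countable_pseudometric [OF K Y e D(1) False D(2)] by blast
  interpret fibrewise_walk K Y J e d
    by (unfold_locales; rule K Y J op embedding_map_continuous [OF e] d)
  have L: "function_space (determined K J)"
    by (rule function_space_determined)
  have L': "function_space (determined K (J \<union> D))"
    by (rule function_space_determined)
  have meas: "f \<in> measured" if f: "f \<in> determined K (J \<union> D)" for f
  proof (rule measuredI [OF determined_cont [OF f]])
    fix q q'
    assume q: "q \<in> topspace K" "q' \<in> topspace K" and "agree J q q'" "d (e q) (e q') = 0"
    then have "agree (J \<union> D) q q'"
      using dD agree_Un by metis
    then show "f q = f q'"
      by (rule determinedD [OF f q])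
  qed
  have slice: "(\<lambda>x. walk_limit f x y) \<in> determined K J"
    if f: "f \<in> determined K (J \<union> D)" and y: "y \<in> topspace Y" for f y
  proof (rule determinedI)
    have adm: "admissible (walk_limit f)"
      by (rule walk_limit_admissible [OF meas [OF f]])
    show "continuous_map K euclideanreal (\<lambda>x. walk_limit f x y)"
      using adm jointly_continuous_left [OF _ y] unfolding admissible_def by blast
    show "walk_limit f x y = walk_limit f x' y" if "x \<in> topspace K" "x' \<in> topspace K" "agree J x x'" for x x'
      using adm that y unfolding admissible_def by blast
  qed
  define u' where "u' f y = u (\<lambda>x. walk_limit f x y) y" for f y
  have cont: "continuous_map Y euclideanreal (u' f)" if f: "f \<in> determined K (J \<union> D)" for f
    unfolding continuous_map_real_iff
  proof (intro ballI allI impI)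
    fix y and \<epsilon> :: real
    assume y: "y \<in> topspace Y" and \<epsilon>: "\<epsilon> > 0"
    have "jointly_continuous K Y (walk_limit f)"
      using walk_limit_admissible [OF meas [OF f]] by (simp add: admissible_def)
    then obtain N where N: "openin Y N" "y \<in> N"
      and NE: "\<And>y' x. y' \<in> N \<Longrightarrow> x \<in> topspace K \<Longrightarrow> \<bar>walk_limit f x y' - walk_limit f x y\<bar> < \<epsilon> / 2"
      using jointly_continuous_uniform [OF K _ y, of "walk_limit f" "\<epsilon> / 2"] \<epsilon> by auto
    obtain N' where N': "openin Y N'" "y \<in> N'"
      and NU: "\<And>y'. y' \<in> N' \<Longrightarrow> \<bar>u (\<lambda>x. walk_limit f x y) y' - u (\<lambda>x. walk_limit f x y) y\<bar> < \<epsilon> / 2"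
      using continuous_map_realD [OF regular_onD(1) [OF u slice [OF f y]] y, of "\<epsilon> / 2"] \<epsilon> by auto
    have "\<bar>u' f y' - u' f y\<bar> < \<epsilon>" if y': "y' \<in> N \<inter> N'" for y'
    proof -
      have Y': "y' \<in> topspace Y"
        using y' N(1) openin_subset by blast
      have "\<bar>u (\<lambda>x. walk_limit f x y') y' - u (\<lambda>x. walk_limit f x y) y'\<bar> \<le> \<epsilon> / 2"
        using NE y' by (intro regular_on_abs_le [OF L u slice [OF f Y'] slice [OF f y] Y']) (simp add: less_imp_le)
      moreover have "\<bar>u (\<lambda>x. walk_limit f x y) y' - u (\<lambda>x. walk_limit f x y) y\<bar> < \<epsilon> / 2"
        using NU y' by blast
      ultimately show ?thesis
        unfolding u'_def by linarith
    qed
    then show "\<exists>U. openin Y U \<and> y \<in> U \<and> (\<forall>y'\<in>U. \<bar>u' f y' - u' f y\<bar> < \<epsilon>)"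
      using N N' by (intro exI [of _ "N \<inter> N'"]) auto
  qed
  have ext: "u' f y = u f y" if f: "f \<in> determined K J" and y: "y \<in> topspace Y" for f y
    unfolding u'_def
  proof (rule regular_on_cong [OF L u _ f y])
    show "(\<lambda>x. walk_limit f x y) \<in> determined K J"
      using slice [OF _ y] f determined_mono [of J "J \<union> D" K] by blast
  qed (rule walk_limit_determined [OF f _ y])
  have "regular_on K Y e (determined K (J \<union> D)) u'"
  proof (rule regular_onI)
    fix f g y
    assume f: "f \<in> determined K (J \<union> D)" and g: "g \<in> determined K (J \<union> D)" and y: "y \<in> topspace Y"
    have "u' (\<lambda>x. f x + g x) y = u (\<lambda>x. walk_limit f x y + walk_limit g x y) y"
      unfolding u'_def
      by (rule regular_on_cong [OF L u slice [OF function_spaceD(2) [OF L' f g] y]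
            function_spaceD(2) [OF L slice [OF f y] slice [OF g y]] y])
        (rule walk_limit_add [OF meas [OF f] meas [OF g] _ y])
    also have "\<dots> = u' f y + u' g y"
      unfolding u'_def by (rule regular_onD(2) [OF u slice [OF f y] slice [OF g y] y])
    finally show "u' (\<lambda>x. f x + g x) y = u' f y + u' g y" .
  next
    fix c f y
    assume f: "f \<in> determined K (J \<union> D)" and y: "y \<in> topspace Y"
    have "u' (\<lambda>x. c * f x) y = u (\<lambda>x. c * walk_limit f x y) y"
      unfolding u'_def
      by (rule regular_on_cong [OF L u slice [OF function_spaceD(3) [OF L' f] y]
            function_spaceD(3) [OF L slice [OF f y]] y])
        (rule walk_limit_scale [OF meas [OF f] _ y])
    also have "\<dots> = c * u' f y"
      unfolding u'_def by (rule regular_onD(3) [OF u slice [OF f y] y])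
    finally show "u' (\<lambda>x. c * f x) y = c * u' f y" .
  next
    fix f x
    assume f: "f \<in> determined K (J \<union> D)" and x: "x \<in> topspace K"
    show "u' f (e x) = f x"
      unfolding u'_def
      using regular_onD(4) [OF u slice [OF f e_in [OF x]] x] walk_limit_extends [OF meas [OF f] x] by simp
  next
    fix y
    assume y: "y \<in> topspace Y"
    then show "u' (\<lambda>_. 1) y = 1"
      using ext [OF function_spaceD(1) [OF L] y] regular_onD(5) [OF u y] by simp
  next
    fix f y
    assume f: "f \<in> determined K (J \<union> D)" and pos: "\<And>x. x \<in> topspace K \<Longrightarrow> 0 \<le> f x"
      and y: "y \<in> topspace Y"
    obtain B where B: "\<And>x. x \<in> topspace K \<Longrightarrow> \<bar>f x\<bar> \<le> B"
      using continuous_bounded [OF K determined_cont [OF f]] by blast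
    have "0 \<le> walk_limit f x y" if x: "x \<in> topspace K" for x
    proof -
      have "0 \<le> f q \<and> f q \<le> B" if "q \<in> fibre K J x" for q
        using that pos [of q] B [of q] by (auto simp: fibre_def)
      then show ?thesis
        using walk_limit_bounds [OF meas [OF f] x y] by blast
    qed
    then show "0 \<le> u' f y"
      unfolding u'_def by (rule regular_onD(6) [OF u slice [OF f y] _ y])
  qed (rule cont)
  with ext show thesis
    using that by blast
qed

section \<open>Extension operators by transfinite exhaustion\<close>

text \<open>
  By Dini's argument: the pairs \<open>(x, q)\<close> in a common fibre of \<open>J\<close> with \<open>F x - F q \<ge> \<epsilon>\<close> form closed
  sets that decrease as \<open>J\<close> grows, and they have no common point when \<open>F\<close> is determined by the union.
\<close>

lemma fibre_inf_uniform_on_chain: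
  assumes K: "compact_space K" and ne: "\<J> \<noteq> {}"
    and chain: "\<And>J J'. J \<in> \<J> \<Longrightarrow> J' \<in> \<J> \<Longrightarrow> J \<subseteq> J' \<or> J' \<subseteq> J"
    and sub: "\<And>J. J \<in> \<J> \<Longrightarrow> J \<subseteq> real_maps K"
    and F: "F \<in> determined K (\<Union>\<J>)" and \<epsilon>: "\<epsilon> > 0"
  obtains J where "J \<in> \<J>" "\<And>x. x \<in> topspace K \<Longrightarrow> \<bar>F x - fibre_inf K J F x\<bar> \<le> \<epsilon>"
proof -
  let ?KK = "prod_topology K K"
  have Fc: "continuous_map K euclideanreal F"
    by (rule determined_cont [OF F])
  define B where "B J = {p \<in> topspace ?KK. agree J (fst p) (snd p)} \<inter>
    {p \<in> topspace ?KK. \<epsilon> \<le> F (fst p) - F (snd p)}" for J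
  have clo: "closedin ?KK (B J)" if "J \<in> \<J>" for J
  proof -
    have "continuous_map ?KK euclideanreal (\<lambda>p. F (fst p))" "continuous_map ?KK euclideanreal (\<lambda>p. F (snd p))"
      using continuous_map_compose [OF continuous_map_fst Fc] continuous_map_compose [OF continuous_map_snd Fc]
      by (auto simp: o_def)
    then show ?thesis
      unfolding B_def
      by (intro closedin_Int closedin_agree sub that closedin_le continuous_intros)
  qed
  have "\<exists>J\<in>\<J>. B J = {}"
  proof (rule ccontr)
    assume nonempty: "\<not> ?thesis"
    have fip: "\<Inter>\<F> \<noteq> {}" if fin: "finite \<F>" "\<F> \<subseteq> B ` \<J>" for \<F>
    proof -
      obtain \<J>' where J': "finite \<J>'" "\<J>' \<subseteq> \<J>" "\<F> = B ` \<J>'"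
        using finite_subset_image [OF fin] by blast
      show ?thesis
      proof (cases "\<J>' = {}")
        case False
        have "subset.chain \<J> \<J>'"
          using chain J'(2) by (auto simp: subset_chain_def)
        then have top: "\<Union>\<J>' \<in> \<J>'"
          by (rule Union_in_chain [OF J'(1) False])
        have "B (\<Union>\<J>') \<subseteq> B J" if "J \<in> \<J>'" for J
          unfolding B_def using agree_mono [of "\<Union>\<J>'" _ _ J] that by blast
        moreover have "B (\<Union>\<J>') \<noteq> {}"
          using top J'(2) nonempty by blast
        ultimately show ?thesis
          using J'(3) by blast
      qed (use J' in auto)
    qed
    have "compact_space ?KK"
      using K by (simp add: compact_space_prod_topology)
    then have "\<Inter>(B ` \<J>) \<noteq> {}"
      using fip clo unfolding compact_space_fip by blast
    then obtain p where p: "\<And>J. J \<in> \<J> \<Longrightarrow> p \<in> B J"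
      by blast
    obtain J0 where "J0 \<in> \<J>"
      using ne by blast
    from p [OF this] have "fst p \<in> topspace K" "snd p \<in> topspace K" "\<epsilon> \<le> F (fst p) - F (snd p)"
      by (auto simp: B_def)
    moreover have "agree (\<Union>\<J>) (fst p) (snd p)"
      using p by (auto simp: B_def agree_def)
    ultimately show False
      using determinedD [OF F, of "fst p" "snd p"] \<epsilon> by simp
  qed
  then obtain J where J: "J \<in> \<J>" "B J = {}"
    by blast
  have "\<bar>F x - fibre_inf K J F x\<bar> \<le> \<epsilon>" if x: "x \<in> topspace K" for x
  proof -
    obtain q where q: "q \<in> fibre K J x" "F q = fibre_inf K J F x"
      using fibre_inf_attained [OF K sub [OF J(1)] x Fc] by metis
    have "(x, q) \<notin> B J"
      using J(2) by blast
    then have "F x - F q < \<epsilon>"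
      using q(1) x by (auto simp: B_def fibre_def)
    moreover have "fibre_inf K J F x \<le> F x"
      by (rule fibre_inf_le [OF K sub [OF J(1)] x Fc fibre_self [OF x]])
    ultimately show ?thesis
      using q(2) by linarith
  qed
  with J(1) show thesis
    using that by blast
qed

text \<open>
  Compatible operators along a chain have a common extension. Fibrewise infima of a function of all
  the coordinates approximate it uniformly, and openness of the fibrations makes them members of the
  spaces in the chain; so the union of these spaces is dense.
\<close>

lemma regular_on_chain_union:
  assumes K: "compact_space K" and e: "continuous_map K Y e" and ne: "I \<noteq> {}"
    and chain: "\<And>i j. i \<in> I \<Longrightarrow> j \<in> I \<Longrightarrow> J i \<subseteq> J j \<or> J j \<subseteq> J i"
    and compat: "\<And>i j f y. i \<in> I \<Longrightarrow> j \<in> I \<Longrightarrow> f \<in> J i \<Longrightarrow> f \<in> J j \<Longrightarrow> y \<in> topspace Y \<Longrightarrow> u i f y = u j f y"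
    and sub: "\<And>i. i \<in> I \<Longrightarrow> J i \<subseteq> real_maps K"
    and closed: "\<And>i. i \<in> I \<Longrightarrow> determined K (J i) = J i"
    and op: "\<And>i. i \<in> I \<Longrightarrow> openly_fibred K (J i)"
    and u: "\<And>i. i \<in> I \<Longrightarrow> regular_on K Y e (J i) (u i)"
  obtains u' where "regular_on K Y e (determined K (\<Union>(J ` I))) u'"
    "\<And>i f y. i \<in> I \<Longrightarrow> f \<in> J i \<Longrightarrow> y \<in> topspace Y \<Longrightarrow> u' f y = u i f y"
proof -
  let ?L = "\<Union>(J ` I)"
  define u0 where "u0 f = u (SOME i. i \<in> I \<and> f \<in> J i) f" for f
  have u0: "u0 f y = u i f y" if "i \<in> I" "f \<in> J i" "y \<in> topspace Y" for f i y
  proof -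
    have "(SOME i. i \<in> I \<and> f \<in> J i) \<in> I \<and> f \<in> J (SOME i. i \<in> I \<and> f \<in> J i)"
      by (rule someI [of _ i]) (use that in blast)
    then show ?thesis
      unfolding u0_def using that compat by blast
  qed
  have fsJ: "function_space (J i)" if "i \<in> I" for i
    using function_space_determined [of K "J i"] closed [OF that] by simp
  have two: "\<exists>i\<in>I. f \<in> J i \<and> g \<in> J i" if "f \<in> ?L" "g \<in> ?L" for f g
    using that chain by blast
  have fs: "function_space ?L"
    unfolding function_space_def
  proof (intro conjI ballI allI)
    show "(\<lambda>_. 1) \<in> ?L"
      using ne function_spaceD(1) [OF fsJ] by blast
    fix f g and c :: real
    assume f: "f \<in> ?L"
    then show "(\<lambda>x. c * f x) \<in> ?L"
      using function_spaceD(3) [OF fsJ] by blast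
    assume "g \<in> ?L"
    then show "(\<lambda>x. f x + g x) \<in> ?L"
      using two [OF f] function_spaceD(2) [OF fsJ] by blast
  qed
  have reg: "regular_on K Y e ?L u0"
  proof (rule regular_onI)
    fix f
    assume "f \<in> ?L"
    then obtain i where i: "i \<in> I" "f \<in> J i" by blast
    show "continuous_map Y euclideanreal (u0 f)"
      by (rule continuous_map_eq [OF regular_onD(1) [OF u [OF i(1)] i(2)]])
        (simp add: u0 [OF i])
  next
    fix f g y
    assume "f \<in> ?L" "g \<in> ?L" and y: "y \<in> topspace Y"
    then obtain i where i: "i \<in> I" "f \<in> J i" "g \<in> J i" using two by blast
    then show "u0 (\<lambda>x. f x + g x) y = u0 f y + u0 g y"
      using regular_onD(2) [OF u [OF i(1)] i(2,3) y] function_spaceD(2) [OF fsJ [OF i(1)] i(2,3)]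
      by (simp add: u0 [OF i(1) _ y])
  next
    fix c f y
    assume "f \<in> ?L" and y: "y \<in> topspace Y"
    then obtain i where i: "i \<in> I" "f \<in> J i" by blast
    then show "u0 (\<lambda>x. c * f x) y = c * u0 f y"
      using regular_onD(3) [OF u [OF i(1)] i(2) y] function_spaceD(3) [OF fsJ [OF i(1)] i(2)]
      by (simp add: u0 [OF i(1) _ y])
  next
    fix f x
    assume "f \<in> ?L" and x: "x \<in> topspace K"
    then obtain i where i: "i \<in> I" "f \<in> J i" by blast
    have "e x \<in> topspace Y"
      using e x by (auto simp: continuous_map_def)
    then show "u0 f (e x) = f x"
      using regular_onD(4) [OF u [OF i(1)] i(2) x] by (simp add: u0 [OF i])
  next
    fix y
    assume y: "y \<in> topspace Y"
    obtain i where i: "i \<in> I" using ne by blast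
    show "u0 (\<lambda>_. 1) y = 1"
      using regular_onD(5) [OF u [OF i] y] function_spaceD(1) [OF fsJ [OF i]] by (simp add: u0 [OF i _ y])
  next
    fix f y
    assume "f \<in> ?L" and pos: "\<And>x. x \<in> topspace K \<Longrightarrow> 0 \<le> f x" and y: "y \<in> topspace Y"
    then obtain i where i: "i \<in> I" "f \<in> J i" by blast
    then show "0 \<le> u0 f y"
      using regular_onD(6) [OF u [OF i(1)] i(2) pos y] by (simp add: u0 [OF i y])
  qed
  have "?L \<subseteq> real_maps K"
    using sub by blast
  then have LL: "?L \<subseteq> determined K ?L"
    by (rule subset_determined)
  have dense: "\<exists>h\<in>?L. \<forall>x\<in>topspace K. \<bar>F x - h x\<bar> \<le> \<epsilon>"
    if F: "F \<in> determined K ?L" and "\<epsilon> > 0" for F \<epsilon>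
  proof -
    have ch: "A \<subseteq> B \<or> B \<subseteq> A" if "A \<in> J ` I" "B \<in> J ` I" for A B
      using that chain by blast
    have sb: "A \<subseteq> real_maps K" if "A \<in> J ` I" for A
      using that sub by blast
    have "J ` I \<noteq> {}"
      using ne by blast
    then obtain i where i: "i \<in> I" and
      ap: "\<And>x. x \<in> topspace K \<Longrightarrow> \<bar>F x - fibre_inf K (J i) F x\<bar> \<le> \<epsilon>"
      using fibre_inf_uniform_on_chain [OF K _ ch sb F \<open>\<epsilon> > 0\<close>] by blast
    have "F \<in> real_maps K"
      using determined_cont [OF F] by simp
    then have "fibre_inf K (J i) F \<in> J i"
      using fibre_inf_determined [OF op [OF i]] closed [OF i] by blast
    then show ?thesis
      using ap i by blast
  qed
  obtain u' where u': "regular_on K Y e (determined K ?L) u'"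
    "\<And>f y. f \<in> ?L \<Longrightarrow> y \<in> topspace Y \<Longrightarrow> u' f y = u0 f y"
    using regular_on_dense_extension [OF fs reg e function_space_determined LL dense] by blast
  have "u' f y = u i f y" if "i \<in> I" "f \<in> J i" "y \<in> topspace Y" for i f y
    using u'(2) [of f y] u0 [OF that] that by auto
  with u'(1) show thesis
    using that by blast
qed

text \<open>
  Haydon's argument. The maximal operator is found among the pairs of a set \<open>J = determined K J\<close>
  and a regular operator on \<open>J\<close>, encoded as graphs so that the order is inclusion. If a function
  were missing from \<open>J\<close>, a countable good set containing it would give a proper enlargement.
\<close>

theorem regular_on_exists:
  assumes K: "compact_space K" and x0: "x0 \<in> topspace K"
    and Y: "compact_space Y" "Hausdorff_space Y" and e: "embedding_map K Y e"
    and good_Union: "\<And>\<J>. (\<And>J. J \<in> \<J> \<Longrightarrow> J \<subseteq> real_maps K \<and> good J) \<Longrightarrow> good (\<Union>\<J>)"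
    and good_determined: "\<And>J. J \<subseteq> real_maps K \<Longrightarrow> good J \<Longrightarrow> good (determined K J)"
    and good_countable: "\<And>f. f \<in> real_maps K \<Longrightarrow>
      \<exists>D. countable D \<and> f \<in> D \<and> D \<subseteq> real_maps K \<and> good D"
    and good_open: "\<And>J. J \<subseteq> real_maps K \<Longrightarrow> good J \<Longrightarrow> openly_fibred K J"
  shows "\<exists>u. regular_on K Y e (real_maps K) u"
proof -
  have ec: "continuous_map K Y e"
    by (rule embedding_map_continuous [OF e])
  define graph where "graph J u = (\<lambda>f. (f, restrict (u f) (topspace Y))) ` J"
    for J and u :: "('a \<Rightarrow> real) \<Rightarrow> 'b \<Rightarrow> real"
  define valid where "valid J u \<longleftrightarrow> J \<subseteq> real_maps K \<and> determined K J = J \<and> good J \<and> regular_on K Y e J u"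
    for J u
  have graph_fst: "fst ` graph J u = J" for J u
    by (force simp: graph_def)
  have graph_le: "J \<subseteq> J' \<and> (\<forall>f\<in>J. \<forall>y\<in>topspace Y. u f y = u' f y)" if "graph J u \<subseteq> graph J' u'" for J u J' u'
  proof -
    have "J \<subseteq> J'"
      using that graph_fst by (metis image_mono)
    moreover have "restrict (u f) (topspace Y) = restrict (u' f) (topspace Y)" if "f \<in> J" for f
      using that \<open>graph J u \<subseteq> graph J' u'\<close> by (auto simp: graph_def)
    ultimately show ?thesis
      by (metis restrict_apply')
  qed
  have graph_mono: "graph J u \<subseteq> graph J' u'"
    if "J \<subseteq> J'" "\<And>f y. f \<in> J \<Longrightarrow> y \<in> topspace Y \<Longrightarrow> u' f y = u f y" for J u J' u'
  proof -
    have "restrict (u f) (topspace Y) = restrict (u' f) (topspace Y)" if "f \<in> J" for f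
      using that \<open>\<And>f y. f \<in> J \<Longrightarrow> y \<in> topspace Y \<Longrightarrow> u' f y = u f y\<close> by (intro restrict_ext) simp
    then show ?thesis
      using \<open>J \<subseteq> J'\<close> by (auto simp: graph_def)
  qed
  have valid_determined: "valid (determined K J) u"
    if "J \<subseteq> real_maps K" "good J" "regular_on K Y e (determined K J) u" for J u
    unfolding valid_def
  proof (intro conjI)
    show "determined K J \<subseteq> real_maps K"
      by (auto simp: determined_cont)
  qed (rule determined_idem good_determined that)+
  define \<A> where "\<A> = {M. \<exists>J u. M = graph J u \<and> valid J u}"
  have "\<exists>M\<in>\<A>. \<forall>X\<in>\<A>. M \<subseteq> X \<longrightarrow> X = M"
  proof (rule subset_Zorn)
    fix \<C>
    assume \<C>: "subset.chain \<A> \<C>"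
    show "\<exists>U\<in>\<A>. \<forall>M\<in>\<C>. M \<subseteq> U"
    proof (cases "\<C> = {}")
      case True
      have const: "f x0 = f x" if "f \<in> determined K {}" "x \<in> topspace K" for f x
        by (rule determinedD [OF that(1) x0 that(2)]) (simp add: agree_def)
      have "regular_on K Y e (determined K {}) (\<lambda>f y. f x0)"
        by (rule regular_onI) (use x0 in \<open>auto intro: const\<close>)
      moreover have "good {}"
        using good_Union [of "{}"] by simp
      ultimately have "valid (determined K {}) (\<lambda>f y. f x0)"
        by (intro valid_determined) auto
      then show ?thesis
        using True by (auto simp: \<A>_def)
    next
      case False
      have "\<exists>J u. M = graph J u \<and> valid J u" if "M \<in> \<C>" for M
        using that \<C> by (auto simp: subset_chain_def \<A>_def)
      then obtain J u where Ju: "\<And>M. M \<in> \<C> \<Longrightarrow> M = graph (J M) (u M)"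
        and v: "\<And>M. M \<in> \<C> \<Longrightarrow> valid (J M) (u M)"
        by metis
      have sub: "J M \<subseteq> real_maps K" and closed: "determined K (J M) = J M"
        and gd: "good (J M)" and reg: "regular_on K Y e (J M) (u M)" if "M \<in> \<C>" for M
        using v [OF that] by (auto simp: valid_def)
      have le: "J M \<subseteq> J M' \<and> (\<forall>f\<in>J M. \<forall>y\<in>topspace Y. u M f y = u M' f y)"
        if "M \<in> \<C>" "M' \<in> \<C>" "M \<subseteq> M'" for M M'
        using graph_le [of "J M" "u M" "J M'" "u M'"] Ju that by metis
      have tot: "M \<subseteq> M' \<or> M' \<subseteq> M" if "M \<in> \<C>" "M' \<in> \<C>" for M M'
        using \<C> that by (auto simp: subset_chain_def)
      have chain: "J M \<subseteq> J M' \<or> J M' \<subseteq> J M" if "M \<in> \<C>" "M' \<in> \<C>" for M M'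
        using tot [OF that] le that by blast
      have compat: "u M f y = u M' f y"
        if "M \<in> \<C>" "M' \<in> \<C>" "f \<in> J M" "f \<in> J M'" "y \<in> topspace Y" for M M' f y
        using tot [OF that(1,2)] le that by metis
      obtain u' where u': "regular_on K Y e (determined K (\<Union>(J ` \<C>))) u'"
        and u'M: "\<And>M f y. M \<in> \<C> \<Longrightarrow> f \<in> J M \<Longrightarrow> y \<in> topspace Y \<Longrightarrow> u' f y = u M f y"
        using regular_on_chain_union [where I = \<C> and J = J and u = u, OF K ec False chain compat sub closed good_open [OF sub gd] reg]
        by blast
      have sub': "\<Union>(J ` \<C>) \<subseteq> real_maps K"
        using sub by blast
      moreover have "good (\<Union>(J ` \<C>))"
        using sub gd by (intro good_Union) blast
      ultimately have "valid (determined K (\<Union>(J ` \<C>))) u'"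
        using u' by (intro valid_determined)
      moreover have "M \<subseteq> graph (determined K (\<Union>(J ` \<C>))) u'" if "M \<in> \<C>" for M
      proof -
        have "J M \<subseteq> determined K (\<Union>(J ` \<C>))"
          using subset_determined [OF sub'] that by blast
        then have "graph (J M) (u M) \<subseteq> graph (determined K (\<Union>(J ` \<C>))) u'"
          using u'M [OF that] by (intro graph_mono)
        then show ?thesis
          using Ju [OF that] by simp
      qed
      ultimately show ?thesis
        by (auto simp: \<A>_def)
    qed
  qed
  then obtain J u where v: "valid J u" and max: "\<And>X. X \<in> \<A> \<Longrightarrow> graph J u \<subseteq> X \<Longrightarrow> X = graph J u"
    by (auto simp: \<A>_def)
  have J: "J \<subseteq> real_maps K" "determined K J = J" "good J" "regular_on K Y e J u"
    using v by (auto simp: valid_def)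
  have "f \<in> J" if f: "f \<in> real_maps K" for f
  proof -
    obtain D where D: "countable D" "f \<in> D" "D \<subseteq> real_maps K" "good D"
      using good_countable [OF f] by blast
    have "regular_on K Y e (determined K J) u"
      using J by simp
    then obtain u' where u': "regular_on K Y e (determined K (J \<union> D)) u'"
      "\<And>f y. f \<in> determined K J \<Longrightarrow> y \<in> topspace Y \<Longrightarrow> u' f y = u f y"
      using regular_on_countable_extension [OF K Y e J(1) good_open [OF J(1,3)] D(1,3)] by blast
    have "good (\<Union>{J, D})"
      using J D by (intro good_Union) blast
    then have "valid (determined K (J \<union> D)) u'"
      using J D u' by (intro valid_determined) auto
    moreover have "J \<union> D \<subseteq> determined K (J \<union> D)"
      using J D by (intro subset_determined) blast
    then have "graph J u \<subseteq> graph (determined K (J \<union> D)) u'"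
      using u'(2) J(2) by (intro graph_mono) auto
    ultimately have "graph (determined K (J \<union> D)) u' = graph J u"
      using max by (auto simp: \<A>_def)
    then have "determined K (J \<union> D) = J"
      using graph_fst by metis
    then show "f \<in> J"
      using \<open>J \<union> D \<subseteq> determined K (J \<union> D)\<close> D(2) by blast
  qed
  then have "J = real_maps K"
    using J(1) by blast
  then show ?thesis
    using J(4) by blast
qed

lemma dugundji_spaceI:
  assumes K: "compact_space K" "Hausdorff_space K"
    and ex: "\<And>(Y :: 'y topology) e. compact_space Y \<Longrightarrow> Hausdorff_space Y \<Longrightarrow> embedding_map K Y e \<Longrightarrow>
      \<exists>u. regular_on K Y e (real_maps K) u"
  shows "dugundji_space TYPE('y) K"
  unfolding dugundji_space_def
proof (intro conjI K allI impI, elim conjE)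
  fix Y :: "'y topology" and e
  assume Y: "compact_space Y" "Hausdorff_space Y" and e: "embedding_map K Y e"
  then obtain u where u: "regular_on K Y e (real_maps K) u"
    using ex by blast
  have fs: "function_space (real_maps K)"
    by (auto simp: function_space_def intro: continuous_map_add continuous_map_real_mult_left)
  have eY: "e x \<in> topspace Y" if "x \<in> topspace K" for x
    using embedding_map_continuous [OF e] that by (auto simp: continuous_map_def)
  have CK: "f \<in> real_maps K" if "f \<in> cont_functions K" for f
    using that by (simp add: cont_functions_def)
  have restr: "u (restrict f (topspace K)) y = u f y" if "f \<in> real_maps K" "y \<in> topspace Y" for f y
  proof (rule regular_on_cong [OF fs u _ that])
    have "continuous_map K euclideanreal (restrict f (topspace K))"
      using that(1) by (auto intro: continuous_map_eq)
    then show "restrict f (topspace K) \<in> real_maps K" by simp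
  qed simp
  have "regular_extension_operator K Y e (\<lambda>f. restrict (u f) (topspace Y))"
    unfolding regular_extension_operator_def
  proof (intro conjI ballI allI impI)
    show "(\<lambda>f. restrict (u f) (topspace Y)) \<in> cont_functions K \<rightarrow> cont_functions Y"
    proof
      fix f
      assume "f \<in> cont_functions K"
      then have "continuous_map Y euclideanreal (u f)"
        by (intro regular_onD(1) [OF u] CK)
      then have "continuous_map Y euclideanreal (restrict (u f) (topspace Y))"
        by (auto intro: continuous_map_eq)
      then show "restrict (u f) (topspace Y) \<in> cont_functions Y"
        by (simp add: cont_functions_def)
    qed
  next
    fix f g
    assume fg: "f \<in> cont_functions K" "g \<in> cont_functions K"
    show "restrict (u (\<lambda>x\<in>topspace K. f x + g x)) (topspace Y) =
      (\<lambda>y\<in>topspace Y. restrict (u f) (topspace Y) y + restrict (u g) (topspace Y) y)"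
      using restr [OF function_spaceD(2) [OF fs CK CK]] regular_onD(2) [OF u CK CK] fg
      by (auto simp: restrict_def fun_eq_iff)
  next
    fix c f
    assume f: "f \<in> cont_functions K"
    show "restrict (u (\<lambda>x\<in>topspace K. c * f x)) (topspace Y) =
      (\<lambda>y\<in>topspace Y. c * restrict (u f) (topspace Y) y)"
      using restr [OF function_spaceD(3) [OF fs CK]] regular_onD(3) [OF u CK] f
      by (auto simp: restrict_def fun_eq_iff)
  next
    fix f x
    assume "f \<in> cont_functions K" and x: "x \<in> topspace K"
    then show "restrict (u f) (topspace Y) (e x) = f x"
      using regular_onD(4) [OF u CK x] eY [OF x] by simp
  next
    show "restrict (u (\<lambda>x\<in>topspace K. 1)) (topspace Y) = (\<lambda>y\<in>topspace Y. 1)"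
      using restr [OF function_spaceD(1) [OF fs]] regular_onD(5) [OF u]
      by (auto simp: restrict_def fun_eq_iff)
  next
    fix f y
    assume "f \<in> cont_functions K" "\<forall>x\<in>topspace K. 0 \<le> f x" and y: "y \<in> topspace Y"
    then show "0 \<le> restrict (u f) (topspace Y) y"
      using regular_onD(6) [OF u CK _ y] by simp
  qed
  then show "\<exists>u. regular_extension_operator K Y e u"
    by blast
qed

section \<open>Openness of invariant quotients of homogeneous compacta\<close>

definition near_identity ::
    "('g, 'm) monoid_scheme \<Rightarrow> 'k topology \<Rightarrow> ('g \<Rightarrow> 'k \<Rightarrow> 'k) \<Rightarrow> ('k \<Rightarrow> real) \<Rightarrow> real \<Rightarrow> 'g set"
  where "near_identity G K act F \<epsilon> =
    {g \<in> carrier G. \<forall>x\<in>topspace K. \<bar>F (act g x) - F x\<bar> \<le> \<epsilon>}"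

text \<open>
  The quotient of \<open>K\<close> by the fibres of \<open>J\<close> is represented by the image of \<open>K\<close> in the product
  \<open>\<real>\<^sup>J\<close>, a compact Hausdorff space.
\<close>

definition evaluation :: "('a \<Rightarrow> real) set \<Rightarrow> 'a \<Rightarrow> ('a \<Rightarrow> real) \<Rightarrow> real"
  where "evaluation J x = (\<lambda>j\<in>J. j x)"

definition evaluation_image :: "'a topology \<Rightarrow> ('a \<Rightarrow> real) set \<Rightarrow> (('a \<Rightarrow> real) \<Rightarrow> real) topology"
  where "evaluation_image K J =
    subtopology (product_topology (\<lambda>_. euclideanreal) J) (evaluation J ` topspace K)"

lemma evaluation_eq_iff: "evaluation J x = evaluation J y \<longleftrightarrow> agree J x y"
  by (auto simp: evaluation_def agree_def fun_eq_iff restrict_def)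

lemma evaluation_image_props:
  assumes K: "compact_space K" and J: "J \<subseteq> real_maps K"
  shows continuous_map_evaluation: "continuous_map K (evaluation_image K J) (evaluation J)"
    and topspace_evaluation_image: "topspace (evaluation_image K J) = evaluation J ` topspace K"
    and compact_space_evaluation_image: "compact_space (evaluation_image K J)"
    and Hausdorff_space_evaluation_image: "Hausdorff_space (evaluation_image K J)"
    and closed_map_evaluation: "closed_map K (evaluation_image K J) (evaluation J)"
    and completely_regular_evaluation_image: "completely_regular_space (evaluation_image K J)"
proof -
  let ?P = "product_topology (\<lambda>_. euclideanreal) J" and ?Z = "evaluation_image K J"
  have "continuous_map K ?P (evaluation J)"
    unfolding continuous_map_componentwise evaluation_def using J by auto
  then show cont: "continuous_map K ?Z (evaluation J)"
    by (simp add: evaluation_image_def continuous_map_in_subtopology)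
  show top: "topspace ?Z = evaluation J ` topspace K"
    by (auto simp: evaluation_image_def evaluation_def)
  have "compactin ?Z (evaluation J ` topspace K)"
    using K cont image_compactin by (metis compact_space_def)
  then show comp: "compact_space ?Z"
    using top by (simp add: compact_space_def)
  show Haus: "Hausdorff_space ?Z"
    by (simp add: evaluation_image_def Hausdorff_space_subtopology Hausdorff_space_product_topology)
  show "closed_map K ?Z (evaluation J)"
    using K Haus cont continuous_imp_closed_map by blast
  show "completely_regular_space ?Z"
    using comp Haus by (simp add: compact_Hausdorff_or_regular_imp_normal_space normal_imp_completely_regular_space)
qed

lemma set_multE:
  assumes "H <#>\<^bsub>G\<^esub> L = carrier G" "g \<in> carrier G"
  obtains h l where "h \<in> H" "l \<in> L" "g = h \<otimes>\<^bsub>G\<^esub> l"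
proof -
  have "g \<in> H <#>\<^bsub>G\<^esub> L"
    using assms by simp
  then show thesis
    using that by (auto simp: set_mult_def)
qed

text \<open>
  The group carries no topology here. Its narrowness is expressed through the sets of elements that
  move a given function by at most \<open>\<epsilon>\<close>. In the assumption on zero sets, \<open>{x. \<forall>\<phi>\<in>\<Phi>. \<phi> x \<le> 0}\<close> is
  the general form of a zero set for countable \<open>\<Phi>\<close>.
\<close>

locale homogeneous_compactum =
  fixes G :: "('g, 'm) monoid_scheme" (structure) and K :: "'k topology" and S :: "'k set"
    and act :: "'g \<Rightarrow> 'k \<Rightarrow> 'k"
  assumes group: "group G" and K: "compact_space K"
    and S: "S \<subseteq> topspace K"
    and meets_zero_sets: "\<And>\<Phi> z. countable \<Phi> \<Longrightarrow> \<Phi> \<subseteq> real_maps K \<Longrightarrow> z \<in> topspace K \<Longrightarrow>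
      (\<And>\<phi>. \<phi> \<in> \<Phi> \<Longrightarrow> \<phi> z \<le> 0) \<Longrightarrow> \<exists>x\<in>S. \<forall>\<phi>\<in>\<Phi>. \<phi> x \<le> 0"
    and act_continuous: "\<And>g. g \<in> carrier G \<Longrightarrow> continuous_map K K (act g)"
    and act_mult: "\<And>g h x. g \<in> carrier G \<Longrightarrow> h \<in> carrier G \<Longrightarrow> x \<in> topspace K \<Longrightarrow>
      act (g \<otimes> h) x = act g (act h x)"
    and act_one: "\<And>x. x \<in> topspace K \<Longrightarrow> act \<one> x = x"
    and transitive: "\<And>x y. x \<in> S \<Longrightarrow> y \<in> S \<Longrightarrow> \<exists>g\<in>carrier G. act g x = y"
    and narrow: "\<And>F \<epsilon>. F \<in> real_maps K \<Longrightarrow> \<epsilon> > 0 \<Longrightarrow> \<exists>A\<subseteq>carrier G. countable A \<and>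
      near_identity G K act F \<epsilon> <#> A = carrier G \<and> A <#> near_identity G K act F \<epsilon> = carrier G"
begin

interpretation group G by (rule group)

definition invariant :: "('k \<Rightarrow> real) set \<Rightarrow> bool"
  where "invariant J \<longleftrightarrow> (\<forall>g\<in>carrier G. \<forall>x\<in>topspace K. \<forall>y\<in>topspace K.
    agree J x y \<longrightarrow> agree J (act g x) (act g y))"

lemma invariantD:
  assumes "invariant J" "g \<in> carrier G" "x \<in> topspace K" "y \<in> topspace K" "agree J x y"
  shows "agree J (act g x) (act g y)"
  using assms unfolding invariant_def by blast

lemma act_in: "g \<in> carrier G \<Longrightarrow> x \<in> topspace K \<Longrightarrow> act g x \<in> topspace K"
  using act_continuous by (auto simp: continuous_map_def)

lemma act_inv:
  assumes "g \<in> carrier G" "x \<in> topspace K"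
  shows "act (inv g) (act g x) = x" "act g (act (inv g) x) = x"
  using assms act_mult [of "inv g" g x] act_mult [of g "inv g" x] act_one by auto

lemma compose_act_continuous:
  assumes "continuous_map K euclideanreal F" "g \<in> carrier G"
  shows "continuous_map K euclideanreal (\<lambda>x. F (act g x))"
  using continuous_map_compose [OF act_continuous [OF assms(2)] assms(1)] by (simp add: o_def)

lemma compose_act_determined:
  assumes "invariant J" "\<eta> \<in> determined K J" "g \<in> carrier G"
  shows "(\<lambda>x. \<eta> (act g x)) \<in> determined K J"
proof (rule determinedI)
  show "continuous_map K euclideanreal (\<lambda>x. \<eta> (act g x))"
    by (rule compose_act_continuous [OF determined_cont [OF assms(2)] assms(3)])
  show "\<eta> (act g x) = \<eta> (act g y)" if "x \<in> topspace K" "y \<in> topspace K" "agree J x y" for x y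
    using that assms by (intro determinedD [OF assms(2)] act_in invariantD)
qed

lemma near_identityD:
  assumes "g \<in> near_identity G K act F \<epsilon>"
  shows "g \<in> carrier G" "x \<in> topspace K \<Longrightarrow> \<bar>F (act g x) - F x\<bar> \<le> \<epsilon>"
  using assms by (auto simp: near_identity_def)

text \<open>
  The elements that move \<open>F\<close> little are closed under inverses, because \<open>K\<close> is mapped onto itself and
  the bound is uniform. This is where inverses are under control although inversion in a
  semitopological group can be discontinuous.
\<close>

lemma near_identity_two:
  assumes "v \<in> near_identity G K act F \<epsilon>" "v' \<in> near_identity G K act F \<epsilon>" "x \<in> topspace K"
  shows "\<bar>F (act (inv v) (act v' x)) - F x\<bar> \<le> 2 * \<epsilon>"
proof -
  have v: "v \<in> carrier G" "v' \<in> carrier G"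
    using assms near_identityD(1) by blast+
  have "act (inv v) (act v' x) \<in> topspace K"
    using v assms(3) act_in by simp
  from near_identityD(2) [OF assms(1) this]
  have "\<bar>F (act v' x) - F (act (inv v) (act v' x))\<bar> \<le> \<epsilon>"
    using act_inv(2) [OF v(1) act_in [OF v(2) assms(3)]] by simp
  then show ?thesis
    using near_identityD(2) [OF assms(2,3)] by linarith
qed

lemma separable_orbit:
  assumes "F \<in> real_maps K" "\<epsilon> > 0"
  obtains A where "countable A" "A \<subseteq> carrier G"
    "\<And>g. g \<in> carrier G \<Longrightarrow> \<exists>a\<in>A. \<forall>x\<in>topspace K. \<bar>F (act g x) - F (act a x)\<bar> \<le> \<epsilon>"
proof -
  obtain A where A: "A \<subseteq> carrier G" "countable A" "near_identity G K act F \<epsilon> <#> A = carrier G"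
    using narrow [OF assms] by blast
  have "\<exists>a\<in>A. \<forall>x\<in>topspace K. \<bar>F (act g x) - F (act a x)\<bar> \<le> \<epsilon>" if g: "g \<in> carrier G" for g
  proof -
    obtain v a where va: "v \<in> near_identity G K act F \<epsilon>" "a \<in> A" "g = v \<otimes> a"
      using set_multE [OF A(3) g] by blast
    have "\<bar>F (act g x) - F (act a x)\<bar> \<le> \<epsilon>" if "x \<in> topspace K" for x
      using near_identityD [OF va(1)] act_mult [of v a x] act_in [of a x] that va A(1) by auto
    then show ?thesis
      using va(2) by blast
  qed
  with A show thesis
    using that by blast
qed

text \<open>
  A countable dense subset of the orbit of \<open>F\<close> determines the values of every \<open>F \<circ> g\<close>.
\<close>

lemma invariant_countable:
  assumes F: "F \<in> real_maps K"
  shows "\<exists>D. countable D \<and> F \<in> D \<and> D \<subseteq> real_maps K \<and> invariant D"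
proof -
  have "\<exists>A. countable A \<and> A \<subseteq> carrier G \<and>
    (\<forall>g\<in>carrier G. \<exists>a\<in>A. \<forall>x\<in>topspace K. \<bar>F (act g x) - F (act a x)\<bar> \<le> 1 / Suc n)" for n
    using separable_orbit [OF F, of "1 / Suc n"] by (metis divide_pos_pos of_nat_0_less_iff zero_less_Suc zero_less_one)
  then obtain A where A: "\<And>n. countable (A n)" "\<And>n. A n \<subseteq> carrier G"
    "\<And>n g. g \<in> carrier G \<Longrightarrow> \<exists>a\<in>A n. \<forall>x\<in>topspace K. \<bar>F (act g x) - F (act a x)\<bar> \<le> 1 / Suc n"
    by metis
  define D where "D = insert F ((\<lambda>a x. F (act a x)) ` (\<Union>n. A n))"
  have orbit: "F (act g x) = F (act g y)"
    if g: "g \<in> carrier G" and xy: "x \<in> topspace K" "y \<in> topspace K" "agree D x y" for g x y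
  proof (rule ccontr)
    assume "F (act g x) \<noteq> F (act g y)"
    then have "0 < \<bar>F (act g x) - F (act g y)\<bar> / 2"
      by simp
    then obtain n c where c: "c = 1 / real (Suc n)" "c < \<bar>F (act g x) - F (act g y)\<bar> / 2"
      using nat_approx_posE by metis
    obtain a where a: "a \<in> A n" "\<And>x. x \<in> topspace K \<Longrightarrow> \<bar>F (act g x) - F (act a x)\<bar> \<le> c"
      using A(3) [OF g] unfolding c(1) by blast
    have "F (act a x) = F (act a y)"
      using xy(3) a(1) by (auto simp: agree_def D_def)
    then have "\<bar>F (act g x) - F (act g y)\<bar> \<le> 2 * c"
      using a(2) [OF xy(1)] a(2) [OF xy(2)] by linarith
    then show False
      using c(2) by simp
  qed
  have "invariant D"
    unfolding invariant_def
  proof (intro ballI impI)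
    fix g x y
    assume g: "g \<in> carrier G" and xy: "x \<in> topspace K" "y \<in> topspace K" "agree D x y"
    have "F (act a (act g x)) = F (act a (act g y))" if "a \<in> carrier G" for a
      using orbit [OF _ xy, of "a \<otimes> g"] that g xy act_mult by simp
    then show "agree D (act g x) (act g y)"
      using orbit [OF g xy] A(2) unfolding agree_def D_def by blast
  qed
  moreover have "D \<subseteq> real_maps K"
    using F A(2) compose_act_continuous by (auto simp: D_def)
  moreover have "countable D"
    using A(1) by (simp add: D_def)
  moreover have "F \<in> D"
    by (simp add: D_def)
  ultimately show ?thesis
    by blast
qed

lemma invariant_Union: "(\<And>J. J \<in> \<J> \<Longrightarrow> invariant J) \<Longrightarrow> invariant (\<Union>\<J>)"
  unfolding invariant_def agree_def by blast

lemma invariant_determined: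
  assumes "J \<subseteq> real_maps K" "invariant J"
  shows "invariant (determined K J)"
  unfolding invariant_def
proof (intro ballI impI)
  fix g x y
  assume g: "g \<in> carrier G" and xy: "x \<in> topspace K" "y \<in> topspace K" and "agree (determined K J) x y"
  then have "agree J x y"
    using agree_determined [OF assms(1) xy] by simp
  then show "agree (determined K J) (act g x) (act g y)"
    using agree_determined [OF assms(1) act_in [OF g xy(1)] act_in [OF g xy(2)]] invariantD [OF assms(2) g xy] by simp
qed

text \<open>
  Countably many translates of the orbit piece \<open>V x0\<close> cover \<open>S\<close>. If their closures in the image of
  \<open>K\<close> had empty interior, the Baire category theorem would give a point outside all of them, hence a
  nonempty zero set of \<open>K\<close> disjoint from \<open>S\<close>.
\<close>

lemma somewhere_dense_translate:
  assumes J: "J \<subseteq> real_maps K" and F: "F \<in> real_maps K" and x0: "x0 \<in> S" and \<epsilon>: "\<epsilon> > 0"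
  obtains a where "a \<in> carrier G"
    "evaluation_image K J interior_of (evaluation_image K J closure_of
      (evaluation J ` (\<lambda>v. act (a \<otimes> v) x0) ` near_identity G K act F \<epsilon>)) \<noteq> {}"
proof -
  let ?V = "near_identity G K act F \<epsilon>" and ?Z = "evaluation_image K J"
  define C where "C a = ?Z closure_of (evaluation J ` (\<lambda>v. act (a \<otimes> v) x0) ` ?V)" for a
  have x0K: "x0 \<in> topspace K"
    using x0 S by blast
  obtain A where A: "A \<subseteq> carrier G" "countable A" "A <#> ?V = carrier G"
    using narrow [OF F \<epsilon>] by blast
  have "\<exists>a\<in>A. ?Z interior_of (C a) \<noteq> {}"
  proof (rule ccontr)
    assume *: "\<not> ?thesis"
    have "regular_space ?Z" "locally_compact_space ?Z"
      using compact_space_evaluation_image [OF K J] Hausdorff_space_evaluation_image [OF K J]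
      by (auto simp: compact_Hausdorff_imp_regular_space compact_imp_locally_compact_space)
    moreover have "closedin ?Z T \<and> ?Z interior_of T = {}" if "T \<in> C ` A" for T
      using that * by (auto simp: C_def)
    ultimately have "?Z interior_of \<Union>(C ` A) = {}"
      using A(2) by (intro Baire_category_alt) auto
    moreover have "evaluation J x0 \<in> topspace ?Z"
      using x0K by (simp add: topspace_evaluation_image [OF K J])
    ultimately have "\<not> topspace ?Z \<subseteq> \<Union>(C ` A)"
      by (metis empty_iff interior_of_maximal openin_topspace subsetD)
    then obtain z where z: "z \<in> topspace K" "\<And>a. a \<in> A \<Longrightarrow> evaluation J z \<notin> C a"
      by (auto simp: topspace_evaluation_image [OF K J])
    have "\<exists>h. continuous_map ?Z (top_of_set {0..1::real}) h \<and> h (evaluation J z) = 0 \<and> h ` C a \<subseteq> {1}"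
      if "a \<in> A" for a
    proof -
      have "closedin ?Z (C a)" "evaluation J z \<in> topspace ?Z - C a"
        using z that by (auto simp: C_def topspace_evaluation_image [OF K J])
      then show ?thesis
        using completely_regular_evaluation_image [OF K J] unfolding completely_regular_space_def by blast
    qed
    then obtain h where h: "\<And>a. a \<in> A \<Longrightarrow> continuous_map ?Z (top_of_set {0..1::real}) (h a)"
      "\<And>a. a \<in> A \<Longrightarrow> h a (evaluation J z) = 0" "\<And>a w. a \<in> A \<Longrightarrow> w \<in> C a \<Longrightarrow> h a w = 1"
      by (metis image_subset_iff singletonD)
    let ?\<Phi> = "(\<lambda>a x. h a (evaluation J x)) ` A"
    have "?\<Phi> \<subseteq> real_maps K"
    proof
      fix \<phi>
      assume "\<phi> \<in> ?\<Phi>"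
      then obtain a where a: "a \<in> A" "\<phi> = h a \<circ> evaluation J"
        by (auto simp: o_def)
      have "continuous_map ?Z euclideanreal (h a)"
        using h(1) [OF a(1)] by (simp add: continuous_map_in_subtopology)
      then show "\<phi> \<in> real_maps K"
        using continuous_map_compose [OF continuous_map_evaluation [OF K J]] a(2) by simp
    qed
    then have "\<exists>x\<in>S. \<forall>\<phi>\<in>?\<Phi>. \<phi> x \<le> 0"
      using A(2) z(1) h(2) by (intro meets_zero_sets) auto
    then obtain x where x: "x \<in> S" "\<And>a. a \<in> A \<Longrightarrow> h a (evaluation J x) \<le> 0"
      by auto
    obtain k where k: "k \<in> carrier G" "act k x0 = x"
      using transitive [OF x0 x(1)] by blast
    obtain a v where av: "a \<in> A" "v \<in> ?V" "k = a \<otimes> v"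
      using set_multE [OF A(3) k(1)] by blast
    have "evaluation J ` (\<lambda>v. act (a \<otimes> v) x0) ` ?V \<subseteq> topspace ?Z"
      using A(1) av(1) near_identityD(1) act_in x0K by (auto simp: topspace_evaluation_image [OF K J])
    then have "evaluation J x \<in> C a"
      unfolding C_def using av k(2) closure_of_subset by blast
    then show False
      using h(3) [OF av(1)] x(2) [OF av(1)] by force
  qed
  then show thesis
    using that A(1) unfolding C_def by blast
qed

text \<open>
  The interior point found in a translate \<open>a V x0\<close> can be taken of the form \<open>a v x0\<close>. Since \<open>J\<close> is
  invariant, moving it back by \<open>a v\<close> gives a neighbourhood of \<open>x0\<close> in the quotient, described here
  by a function \<open>\<eta>\<close>, and every fibre over it meets the closure of \<open>V\<^sup>-\<^sup>1 V x0\<close>, where \<open>F\<close> is close to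
  \<open>F x0\<close>.
\<close>

lemma locally_dense_orbit:
  assumes J: "J \<subseteq> real_maps K" "invariant J" and F: "F \<in> real_maps K" and x0: "x0 \<in> S" and \<epsilon>: "\<epsilon> > 0"
  obtains \<eta> where "\<eta> \<in> determined K J" "\<eta> x0 = 1"
    "\<And>z. z \<in> topspace K \<Longrightarrow> \<eta> z > 0 \<Longrightarrow> \<exists>q\<in>fibre K J z. \<bar>F q - F x0\<bar> \<le> 2 * \<epsilon>"
proof -
  let ?V = "near_identity G K act F \<epsilon>" and ?Z = "evaluation_image K J"
  have x0K: "x0 \<in> topspace K"
    using x0 S by blast
  obtain a where a: "a \<in> carrier G" and
    "?Z interior_of (?Z closure_of (evaluation J ` (\<lambda>v. act (a \<otimes> v) x0) ` ?V)) \<noteq> {}"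
    using somewhere_dense_translate [OF J(1) F x0 \<epsilon>] by blast
  moreover define W where "W = (\<lambda>v. act (a \<otimes> v) x0) ` ?V"
  moreover define U where "U = ?Z interior_of (?Z closure_of (evaluation J ` W))"
  ultimately have U: "openin ?Z U" "U \<noteq> {}" "U \<subseteq> ?Z closure_of (evaluation J ` W)"
    by (auto simp: interior_of_subset)
  have WK: "W \<subseteq> topspace K"
    unfolding W_def using a near_identityD(1) act_in x0K by auto
  have "U \<inter> evaluation J ` W \<noteq> {}"
    using openin_Int_closure_of_eq_empty [OF U(1)] U(2,3) by (metis inf.absorb_iff1)
  then obtain v where v: "v \<in> ?V" "evaluation J (act (a \<otimes> v) x0) \<in> U"
    unfolding W_def by blast
  define g where "g = a \<otimes> v"
  have vG: "v \<in> carrier G"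
    using v near_identityD(1) by blast
  have g: "g \<in> carrier G"
    using a vG by (simp add: g_def)
  obtain h where h: "continuous_map ?Z (top_of_set {0..1::real}) h" "h (evaluation J (act g x0)) = 0"
    "h ` (topspace ?Z - U) \<subseteq> {1}"
  proof -
    have "closedin ?Z (topspace ?Z - U)" "evaluation J (act g x0) \<in> topspace ?Z - (topspace ?Z - U)"
      using U(1) v(2) openin_subset [OF U(1)] by (auto simp: g_def)
    then show thesis
      using completely_regular_evaluation_image [OF K J(1)] that unfolding completely_regular_space_def by blast
  qed
  have hc: "continuous_map K euclideanreal (\<lambda>z. h (evaluation J z))"
  proof -
    have "continuous_map ?Z euclideanreal h"
      using h(1) by (simp add: continuous_map_in_subtopology)
    then show ?thesis
      using continuous_map_compose [OF continuous_map_evaluation [OF K J(1)]] by (simp add: o_def)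
  qed
  have "(\<lambda>z. 1 - h (evaluation J z)) \<in> determined K J"
  proof (rule determinedI)
    show "continuous_map K euclideanreal (\<lambda>z. 1 - h (evaluation J z))"
      by (intro continuous_intros hc) auto
    show "1 - h (evaluation J x) = 1 - h (evaluation J y)" if "agree J x y" for x y
      using that evaluation_eq_iff by metis
  qed
  then have dep: "(\<lambda>z. 1 - h (evaluation J (act g z))) \<in> determined K J"
    using compose_act_determined [OF J(2) _ g] by blast
  have "\<exists>q\<in>fibre K J z. \<bar>F q - F x0\<bar> \<le> 2 * \<epsilon>"
    if z: "z \<in> topspace K" and pos: "1 - h (evaluation J (act g z)) > 0" for z
  proof -
    have gz: "act g z \<in> topspace K"
      by (rule act_in [OF g z])
    have "evaluation J (act g z) \<in> topspace ?Z"
      using gz by (simp add: topspace_evaluation_image [OF K J(1)])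
    then have "evaluation J (act g z) \<in> U"
      using h(3) pos by force
    then have "evaluation J (act g z) \<in> ?Z closure_of (evaluation J ` W)"
      using U(3) by blast
    moreover have "?Z closure_of (evaluation J ` W) \<subseteq> evaluation J ` (K closure_of W)"
      using closed_map_evaluation [OF K J(1)] WK unfolding closed_map_closure_of_image by simp
    ultimately obtain q0 where q0: "q0 \<in> K closure_of W" "evaluation J (act g z) = evaluation J q0"
      by blast
    then have q0J: "agree J (act g z) q0"
      by (simp add: evaluation_eq_iff)
    have q0K: "q0 \<in> topspace K"
      using q0(1) by (meson in_closure_of)
    let ?q = "act (inv g) q0"
    have "agree J z ?q"
      using invariantD [OF J(2) inv_closed [OF g] gz q0K q0J] act_inv(1) [OF g z] by simp
    then have "?q \<in> fibre K J z"
      using act_in [OF inv_closed [OF g] q0K] by (simp add: fibre_def)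
    moreover have "\<bar>F ?q - F x0\<bar> \<le> 2 * \<epsilon>"
    proof (rule forall_in_closure_of [OF q0(1), of "\<lambda>p. \<bar>F (act (inv g) p) - F x0\<bar> \<le> 2 * \<epsilon>"])
      fix p
      assume "p \<in> W"
      then obtain v' where v': "v' \<in> ?V" "p = act (a \<otimes> v') x0"
        unfolding W_def by blast
      have v'G: "v' \<in> carrier G"
        using v' near_identityD(1) by blast
      have "inv g \<otimes> (a \<otimes> v') = inv v \<otimes> v'"
        using a vG v'G by (simp add: g_def inv_mult_group m_assoc) (metis inv_closed l_inv l_one m_assoc)
      then have "act (inv g) p = act (inv v) (act v' x0)"
        using v'(2) act_mult [of "inv g" "a \<otimes> v'" x0] act_mult [of "inv v" v' x0] g a vG v'G x0K by simp
      then show "\<bar>F (act (inv g) p) - F x0\<bar> \<le> 2 * \<epsilon>"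
        using near_identity_two [OF v(1) v'(1) x0K] by simp
    next
      have "continuous_map K euclideanreal (\<lambda>p. F (act (inv g) p))"
        using F g by (intro compose_act_continuous) auto
      then show "closedin K {p \<in> topspace K. \<bar>F (act (inv g) p) - F x0\<bar> \<le> 2 * \<epsilon>}"
        by (intro closedin_le continuous_intros) auto
    qed
    ultimately show ?thesis by blast
  qed
  with dep h(2) show thesis
    using that by force
qed

text \<open>
  Every point of \<open>S\<close> is \<open>k x0\<close> for some \<open>k\<close>, and \<open>k\<close> can be replaced by elements of a countable set
  at the cost of a small change of \<open>F \<circ> k\<close> and of \<open>\<eta> \<circ> k\<^sup>-\<^sup>1\<close>. The neighbourhoods of
  \<open>locally_dense_orbit\<close>, intersected with sets on which \<open>F\<close> is nearly constant, thus yield a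
  countable family of cozero sets covering \<open>S\<close>. It covers \<open>K\<close>, since \<open>S\<close> meets the nonempty zero
  sets.
\<close>

lemma fibres_vary_openly:
  assumes J: "J \<subseteq> real_maps K" "invariant J" and F: "F \<in> real_maps K" and y: "y \<in> topspace K" and \<epsilon>: "\<epsilon> > 0"
  obtains \<eta> where "\<eta> \<in> determined K J" "\<eta> y > 1/2"
    "\<And>z. z \<in> topspace K \<Longrightarrow> \<eta> z > 1/2 \<Longrightarrow> \<exists>q\<in>fibre K J z. \<bar>F q - F y\<bar> \<le> \<epsilon>"
proof -
  \<comment> \<open>The comparison of \<open>F q\<close> with \<open>F y\<close> at the end has three errors \<open>\<delta>\<close> and one error \<open>3 * \<delta>\<close>.\<close>
  define \<delta> where "\<delta> = \<epsilon> / 6"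
  have \<delta>: "\<delta> > 0" "6 * \<delta> = \<epsilon>"
    using \<epsilon> by (auto simp: \<delta>_def)
  obtain x0 where x0: "x0 \<in> S"
    using meets_zero_sets [of "{}" y] y by auto
  have x0K: "x0 \<in> topspace K"
    using x0 S by blast
  obtain A where A: "countable A" "A \<subseteq> carrier G"
    "\<And>g. g \<in> carrier G \<Longrightarrow> \<exists>a\<in>A. \<forall>x\<in>topspace K. \<bar>F (act g x) - F (act a x)\<bar> \<le> \<delta>"
    using separable_orbit [OF F \<delta>(1)] by blast
  have "\<exists>\<eta>. \<eta> \<in> determined K J \<and> \<eta> x0 = 1 \<and> (\<forall>z\<in>topspace K. \<eta> z > 0 \<longrightarrow>
      (\<exists>q\<in>fibre K J z. \<bar>F (act a q) - F (act a x0)\<bar> \<le> \<delta>))" if "a \<in> A" for a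
  proof -
    have "(\<lambda>x. F (act a x)) \<in> real_maps K"
      using F A(2) that compose_act_continuous by auto
    from locally_dense_orbit [OF J this x0, of "\<delta> / 2"] \<delta>(1) show ?thesis
      by (metis field_sum_of_halves half_gt_zero mult_2)
  qed
  then obtain \<eta> where \<eta>: "\<And>a. a \<in> A \<Longrightarrow> \<eta> a \<in> determined K J" "\<And>a. a \<in> A \<Longrightarrow> \<eta> a x0 = 1"
    and \<eta>q: "\<And>a z. a \<in> A \<Longrightarrow> z \<in> topspace K \<Longrightarrow> \<eta> a z > 0 \<Longrightarrow>
      \<exists>q\<in>fibre K J z. \<bar>F (act a q) - F (act a x0)\<bar> \<le> \<delta>"
    by metis
  let ?U = "\<lambda>a. near_identity G K act (\<eta> a) (1/8)"
  have "\<exists>B\<subseteq>carrier G. countable B \<and> B <#> ?U a = carrier G" if "a \<in> A" for a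
    using narrow [of "\<eta> a" "1/8"] determined_cont [OF \<eta>(1) [OF that]] by auto
  then obtain B where B: "\<And>a. a \<in> A \<Longrightarrow> countable (B a)" "\<And>a. a \<in> A \<Longrightarrow> B a \<subseteq> carrier G"
    "\<And>a. a \<in> A \<Longrightarrow> B a <#> ?U a = carrier G"
    by metis
  define near where "near a g \<longleftrightarrow> (\<forall>x\<in>topspace K. \<bar>F (act g x) - F (act a x)\<bar> \<le> \<delta>)" for a g
  \<comment> \<open>Of each translate \<open>b U\<close> that contains group elements acting on \<open>F\<close> almost like \<open>a\<close>, one such element
    is kept; any two elements of the translate differ little in their effect on \<open>\<eta> a\<close>.\<close>
  define I where "I = {(a, b). a \<in> A \<and> b \<in> B a \<and> (\<exists>u\<in>?U a. near a (b \<otimes> u))}"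
  have "\<forall>i\<in>I. \<exists>u\<in>?U (fst i). near (fst i) (snd i \<otimes> u)"
    by (auto simp: I_def)
  then obtain t where t: "\<And>i. i \<in> I \<Longrightarrow> t i \<in> ?U (fst i)" "\<And>i. i \<in> I \<Longrightarrow> near (fst i) (snd i \<otimes> t i)"
    by metis
  define g where "g i = snd i \<otimes> t i" for i
  have gG: "g i \<in> carrier G" if "i \<in> I" for i
  proof -
    have "fst i \<in> A" "snd i \<in> B (fst i)"
      using that by (auto simp: I_def)
    then have "snd i \<in> carrier G"
      using B(2) by blast
    then show ?thesis
      using near_identityD(1) [OF t(1) [OF that]] by (simp add: g_def)
  qed
  \<comment> \<open>The points where \<open>\<psi> i\<close> is positive lie over the neighbourhood of \<open>g i x0\<close> and have nearly the same
    value of \<open>F\<close> as \<open>g i x0\<close>.\<close>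
  define \<psi> where "\<psi> i z = min (\<eta> (fst i) (act (inv (g i)) z) - 1/2) (3 * \<delta> - \<bar>F z - F (act (g i) x0)\<bar>)"
    for i z
  have dep: "(\<lambda>z. \<eta> (fst i) (act (inv (g i)) z)) \<in> determined K J" if "i \<in> I" for i
    using that \<eta>(1) gG by (intro compose_act_determined J) (auto simp: I_def)
  have "\<exists>i\<in>I. \<psi> i y > 0"
  proof (rule ccontr)
    assume "\<not> ?thesis"
    moreover have "countable I"
      using A(1) B(1) by (intro countable_subset [of I "SIGMA a:A. B a"]) (auto simp: I_def)
    moreover have "\<psi> i \<in> real_maps K" if "i \<in> I" for i
      unfolding \<psi>_def mem_Collect_eq using determined_cont [OF dep [OF that]] F
      by (intro continuous_intros) auto
    ultimately have "\<exists>x\<in>S. \<forall>\<phi>\<in>\<psi> ` I. \<phi> x \<le> 0"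
      using y by (intro meets_zero_sets) (auto simp: not_less)
    then obtain x where x: "x \<in> S" "\<And>i. i \<in> I \<Longrightarrow> \<psi> i x \<le> 0"
      by auto
    obtain k where k: "k \<in> carrier G" "act k x0 = x"
      using transitive [OF x0 x(1)] by blast
    obtain a where a: "a \<in> A" "near a k"
      using A(3) [OF k(1)] unfolding near_def by blast
    obtain b u where bu: "b \<in> B a" "u \<in> ?U a" "k = b \<otimes> u"
      using set_multE [OF B(3) [OF a(1)] k(1)] by blast
    have i: "(a, b) \<in> I"
      using a bu by (auto simp: I_def)
    let ?t = "t (a, b)" and ?g = "g (a, b)"
    have tU: "?t \<in> ?U a" and tn: "near a ?g"
      using t [OF i] by (auto simp: g_def)
    have G: "b \<in> carrier G" "u \<in> carrier G" "?t \<in> carrier G"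
      using B(2) [OF a(1)] bu near_identityD(1) tU by blast+
    have "inv ?g \<otimes> k = inv ?t \<otimes> u"
      using G bu(3) by (simp add: g_def inv_mult_group m_assoc) (metis inv_closed l_inv l_one m_assoc)
    then have eq: "act (inv ?g) x = act (inv ?t) (act u x0)"
      using k act_mult [of "inv ?g" k x0] act_mult [of "inv ?t" u x0] gG [OF i] G x0K by simp
    have "\<bar>\<eta> a (act (inv ?g) x) - 1\<bar> \<le> 2 * (1/8)"
      using near_identity_two [OF tU bu(2) x0K] unfolding \<eta>(2) [OF a(1)] eq .
    then have "\<eta> a (act (inv ?g) x) > 1/2"
      by linarith
    moreover have "\<bar>F x - F (act ?g x0)\<bar> < 3 * \<delta>"
    proof -
      have "\<bar>F (act k x0) - F (act a x0)\<bar> \<le> \<delta>" "\<bar>F (act ?g x0) - F (act a x0)\<bar> \<le> \<delta>"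
        using a(2) tn x0K by (auto simp: near_def)
      then show ?thesis
        using \<delta>(1) unfolding k(2) by linarith
    qed
    ultimately show False
      using x(2) [OF i] by (simp add: \<psi>_def)
  qed
  then obtain i where i: "i \<in> I" "\<psi> i y > 0"
    by blast
  let ?a = "fst i" and ?g = "g i"
  have a: "?a \<in> A" and g: "?g \<in> carrier G" and gn: "near ?a ?g"
    using i(1) gG t(2) [OF i(1)] by (auto simp: I_def g_def)
  have yg: "\<eta> ?a (act (inv ?g) y) > 1/2" "\<bar>F y - F (act ?g x0)\<bar> < 3 * \<delta>"
    using i(2) by (auto simp: \<psi>_def)
  have "\<exists>q\<in>fibre K J z. \<bar>F q - F y\<bar> \<le> \<epsilon>"
    if z: "z \<in> topspace K" and pos: "\<eta> ?a (act (inv ?g) z) > 1/2" for z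
  proof -
    have gz: "act (inv ?g) z \<in> topspace K"
      using g z act_in by simp
    obtain q where q: "q \<in> fibre K J (act (inv ?g) z)" "\<bar>F (act ?a q) - F (act ?a x0)\<bar> \<le> \<delta>"
      using \<eta>q [OF a gz] pos by force
    have qK: "q \<in> topspace K" "agree J (act (inv ?g) z) q"
      using q(1) by (auto simp: fibre_def)
    have "agree J z (act ?g q)"
      using invariantD [OF J(2) g gz qK] act_inv(2) [OF g z] by simp
    then have "act ?g q \<in> fibre K J z"
      using act_in [OF g qK(1)] by (simp add: fibre_def)
    moreover have "\<bar>F (act ?g q) - F (act ?a q)\<bar> \<le> \<delta>" "\<bar>F (act ?g x0) - F (act ?a x0)\<bar> \<le> \<delta>"
      using gn qK(1) x0K by (auto simp: near_def)
    then have "\<bar>F (act ?g q) - F y\<bar> \<le> \<epsilon>"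
      using q(2) yg(2) \<delta>(2) by linarith
    ultimately show ?thesis by blast
  qed
  with dep [OF i(1)] yg(1) show thesis
    using that by blast
qed

text \<open>
  Upper semicontinuity of fibrewise infima is \<open>fibres_vary_openly\<close> at a minimizer; lower
  semicontinuity holds because the quotient map is closed.
\<close>

lemma invariant_openly_fibred:
  assumes J: "J \<subseteq> real_maps K" "invariant J"
  shows "openly_fibred K J"
  unfolding openly_fibred_def
proof
  fix F
  assume F: "F \<in> real_maps K"
  then have Fc: "continuous_map K euclideanreal F" by simp
  show "continuous_map K euclideanreal (fibre_inf K J F)"
    unfolding continuous_map_real_iff
  proof (intro ballI allI impI)
    fix y and \<epsilon> :: real
    assume y: "y \<in> topspace K" and \<epsilon>: "\<epsilon> > 0"
    let ?Z = "evaluation_image K J" and ?I = "fibre_inf K J F"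
    obtain p where p: "p \<in> fibre K J y" "F p = ?I y"
      using fibre_inf_attained [OF K J(1) y Fc] by metis
    have pK: "p \<in> topspace K" "agree J y p"
      using p(1) by (auto simp: fibre_def)
    obtain \<eta> where \<eta>: "\<eta> \<in> determined K J" "\<eta> p > 1/2"
      and near: "\<And>z. z \<in> topspace K \<Longrightarrow> \<eta> z > 1/2 \<Longrightarrow> \<exists>q\<in>fibre K J z. \<bar>F q - F p\<bar> \<le> \<epsilon> / 2"
      using fibres_vary_openly [OF J F pK(1), of "\<epsilon> / 2"] \<epsilon> by auto
    let ?U = "{z \<in> topspace K. 1/2 < \<eta> z}"
    have U: "openin K ?U"
      by (intro openin_less determined_cont [OF \<eta>(1)]) auto
    have yU: "y \<in> ?U"
      using y \<eta>(2) determinedD [OF \<eta>(1) y pK] by simp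
    have up: "?I z < ?I y + \<epsilon>" if zU: "z \<in> ?U" for z
    proof -
      have z: "z \<in> topspace K" "1/2 < \<eta> z"
        using zU by auto
      obtain q where q: "q \<in> fibre K J z" "\<bar>F q - F p\<bar> \<le> \<epsilon> / 2"
        using near [OF z] by blast
      then show ?thesis
        using fibre_inf_le [OF K J(1) z(1) Fc q(1)] p(2) \<epsilon> by linarith
    qed
    let ?B = "{q \<in> topspace K. F q \<le> ?I y - \<epsilon>}"
    have "closedin K ?B"
      by (intro closedin_le Fc) auto
    then have B: "closedin ?Z (evaluation J ` ?B)"
      using closed_map_evaluation [OF K J(1)] by (simp add: closed_map_def)
    let ?V = "{z \<in> topspace K. evaluation J z \<in> topspace ?Z - evaluation J ` ?B}"
    have V: "openin K ?V"
      using B by (intro openin_continuous_map_preimage [OF continuous_map_evaluation [OF K J(1)]]) auto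
    have "evaluation J y \<noteq> evaluation J q" if "q \<in> ?B" for q
      using that fibre_inf_le [OF K J(1) y Fc, of q] \<epsilon> by (auto simp: evaluation_eq_iff fibre_def)
    then have yV: "y \<in> ?V"
      using y by (auto simp: topspace_evaluation_image [OF K J(1)])
    have low: "?I y - \<epsilon> < ?I z" if zV: "z \<in> ?V" for z
    proof -
      have z: "z \<in> topspace K"
        using zV by blast
      obtain q where q: "q \<in> fibre K J z" "F q = ?I z"
        using fibre_inf_attained [OF K J(1) z Fc] by metis
      then have "evaluation J z = evaluation J q" "q \<in> topspace K"
        by (auto simp: evaluation_eq_iff fibre_def)
      then have "q \<notin> ?B"
        using zV by auto
      then show ?thesis
        using q(2) \<open>q \<in> topspace K\<close> by simp
    qed
    have "\<bar>?I z - ?I y\<bar> < \<epsilon>" if "z \<in> ?U \<inter> ?V" for z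
      using up [of z] low [of z] that by auto
    then show "\<exists>U. openin K U \<and> y \<in> U \<and> (\<forall>z\<in>U. \<bar>?I z - ?I y\<bar> < \<epsilon>)"
      using U V yU yV by (intro exI [of _ "?U \<inter> ?V"]) blast
  qed
qed

end

theorem (in homogeneous_compactum) dugundji:
  assumes "Hausdorff_space K" "z \<in> topspace K"
  shows "dugundji_space TYPE('y) K"
proof (rule dugundji_spaceI [OF K assms(1)])
  fix Y :: "'y topology" and e
  assume Y: "compact_space Y" "Hausdorff_space Y" and e: "embedding_map K Y e"
  show "\<exists>u. regular_on K Y e (real_maps K) u"
  proof (rule regular_on_exists [OF K assms(2) Y e, where good = invariant])
    show "invariant (\<Union>\<J>)" if "\<And>J. J \<in> \<J> \<Longrightarrow> J \<subseteq> real_maps K \<and> invariant J" for \<J>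
      using that by (intro invariant_Union) blast
  qed (fact invariant_determined invariant_countable invariant_openly_fibred)+
qed

section \<open>Pseudocompact spaces and k-spaces\<close>

text \<open>
  An infinite \<open>\<epsilon>\<close>-separated sequence would carry disjoint bumps of unbounded height, and their sum
  is continuous because each point has a neighbourhood that meets at most one bump.
\<close>

lemma pseudocompact_totally_bounded:
  fixes d :: "'a \<Rightarrow> 'a \<Rightarrow> real"
  assumes X: "pseudocompact_space X"
    and cont: "\<And>x. x \<in> topspace X \<Longrightarrow> continuous_map X euclideanreal (d x)"
    and self: "\<And>x. d x x = 0" and sym: "\<And>x y. d x y = d y x"
    and tri: "\<And>x y z. x \<in> topspace X \<Longrightarrow> y \<in> topspace X \<Longrightarrow> z \<in> topspace X \<Longrightarrow> d x z \<le> d x y + d y z"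
    and \<epsilon>: "\<epsilon> > 0"
  obtains N where "finite N" "N \<subseteq> topspace X" "\<And>x. x \<in> topspace X \<Longrightarrow> \<exists>v\<in>N. d v x < \<epsilon>"
proof (rule ccontr)
  note net_found = that
  assume contra: "\<not> thesis"
  have no_net: "\<exists>x\<in>topspace X. \<forall>v\<in>N. \<epsilon> \<le> d v x" if "finite N" "N \<subseteq> topspace X" for N
    using net_found [OF that] contra by (meson not_le)
  define P where "P s n x \<longleftrightarrow> x \<in> topspace X \<and> (\<forall>m<n. \<epsilon> \<le> d (s m) x)" 
    for s :: "nat \<Rightarrow> 'a" and n x
  have "\<exists>s. \<forall>n. P s n (s n)"
  proof (rule dependent_wellorder_choice)
    show "P f n x = P g n x" if "\<And>m. m < n \<Longrightarrow> f m = g m" for x f g n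
      using that by (simp add: P_def)
    show "\<exists>x. P s n x" if "\<And>m. m < n \<Longrightarrow> P s m (s m)" for n s
    proof -
      have "s ` {..<n} \<subseteq> topspace X"
        using that by (auto simp: P_def)
      then show ?thesis
        using no_net [of "s ` {..<n}"] by (auto simp: P_def)
    qed
  qed
  then obtain s where s: "\<And>n. P s n (s n)"
    by blast
  have sX: "s n \<in> topspace X" for n
    using s [of n] by (simp add: P_def)
  have lt: "\<epsilon> \<le> d (s m) (s n)" if "m < n" for m n
    using s [of n] that by (simp add: P_def)
  have apart: "\<epsilon> \<le> d (s m) (s n)" if "m \<noteq> n" for m n
    using lt [of m n] lt [of n m] that sym by (metis nat_neq_iff)
  define near where "near r x = {n. d (s n) x < r}" for r x
  have fin: "finite (near (\<epsilon> / 2) x)" if x: "x \<in> topspace X" for x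
  proof -
    have "m = n" if "m \<in> near (\<epsilon> / 2) x" "n \<in> near (\<epsilon> / 2) x" for m n
    proof (rule ccontr)
      assume "m \<noteq> n"
      then show False
        using apart [of m n] tri [OF sX [of m] x sX [of n]] sym [of x "s n"] that
        unfolding near_def by auto
    qed
    then show ?thesis
      by (metis finite.simps insertI1 is_singletonI' is_singleton_def)
  qed
  \<comment> \<open>A bump of height \<open>n\<close> at \<open>s n\<close>, supported in the ball of radius \<open>\<epsilon> / 3\<close>.\<close>
  define b where "b n x = real n * max 0 (1 - 3 * d (s n) x / \<epsilon>)" for n x
  define f where "f x = (\<Sum>n\<in>near (\<epsilon> / 3) x. b n x)" for x
  have b0: "b n x = 0" if "n \<notin> near (\<epsilon> / 3) x" for n x
    using that \<epsilon> by (simp add: b_def near_def field_simps)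
  have bc: "continuous_map X euclideanreal (b n)" for n
    unfolding b_def using \<epsilon> by (intro continuous_intros cont sX) auto
  have "continuous_map X euclideanreal f"
    unfolding continuous_map_real_iff
  proof (intro ballI allI impI)
    fix x and \<delta> :: real
    assume x: "x \<in> topspace X" and \<delta>: "\<delta> > 0"
    define h where "h y = (\<Sum>n\<in>near (\<epsilon> / 2) x. b n y)" for y
    let ?U = "{y \<in> topspace X. d x y < \<epsilon> / 6}"
    have fh: "f y = h y" if y: "y \<in> ?U" for y
    proof -
      have yX: "y \<in> topspace X"
        using y by blast
      have "near (\<epsilon> / 3) y \<subseteq> near (\<epsilon> / 2) x"
      proof
        fix n
        assume "n \<in> near (\<epsilon> / 3) y"
        then show "n \<in> near (\<epsilon> / 2) x"
          using tri [OF sX [of n] yX x] y sym [of x y] by (simp add: near_def)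
      qed
      then show ?thesis
        unfolding f_def h_def using fin [OF x] b0 by (intro sum.mono_neutral_left) auto
    qed
    have "continuous_map X euclideanreal h"
      unfolding h_def using fin [OF x] bc by (intro continuous_intros) auto
    then obtain W where W: "openin X W" "x \<in> W" "\<And>y. y \<in> W \<Longrightarrow> \<bar>h y - h x\<bar> < \<delta>"
      using continuous_map_realD [OF _ x \<delta>] by metis
    have "openin X ?U"
      by (intro openin_less cont x) auto
    moreover have xU: "x \<in> ?U"
      using x self \<epsilon> by simp
    ultimately show "\<exists>U. openin X U \<and> x \<in> U \<and> (\<forall>y\<in>U. \<bar>f y - f x\<bar> < \<delta>)"
      using W fh [OF xU] fh by (intro exI [of _ "?U \<inter> W"]) auto
  qed
  then have "bounded (f ` topspace X)"
    using X by (simp add: pseudocompact_space_def)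
  then obtain B where B: "\<And>x. x \<in> topspace X \<Longrightarrow> \<bar>f x\<bar> \<le> B"
    by (auto simp: bounded_iff)
  obtain n :: nat where n: "B < n"
    using reals_Archimedean2 by blast
  have "near (\<epsilon> / 3) (s n) \<subseteq> near (\<epsilon> / 2) (s n)"
    using \<epsilon> by (auto simp: near_def)
  then have "finite (near (\<epsilon> / 3) (s n))"
    using fin [OF sX] finite_subset by blast
  moreover have "n \<in> near (\<epsilon> / 3) (s n)"
    using self \<epsilon> by (simp add: near_def)
  moreover have "0 \<le> b m (s n)" for m
    by (simp add: b_def)
  ultimately have "b n (s n) \<le> f (s n)"
    unfolding f_def by (intro member_le_sum) auto
  then show False
    using B [OF sX [of n]] n by (simp add: b_def self)
qed

text \<open>
  The supremum over \<open>C\<close> of the differences \<open>\<bar>\<Phi> g x - \<Phi> g y\<bar>\<close> is a continuous pseudometric on \<open>X\<close>, so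
  \<open>X\<close> has a finite net for it, and near \<open>g0\<close> only the finitely many net points need attention.
\<close>

lemma pseudocompact_equicontinuous:
  assumes C: "compact_space C" and X: "pseudocompact_space X"
    and \<Phi>: "jointly_continuous C X \<Phi>" and g0: "g0 \<in> topspace C" and \<epsilon>: "\<epsilon> > 0"
  obtains N where "openin C N" "g0 \<in> N"
    "\<And>g x. g \<in> N \<Longrightarrow> x \<in> topspace X \<Longrightarrow> \<bar>\<Phi> g x - \<Phi> g0 x\<bar> \<le> \<epsilon>"
proof -
  define d where "d x y = (SUP g\<in>topspace C. \<bar>\<Phi> g x - \<Phi> g y\<bar>)" for x y
  have bdd: "bdd_above ((\<lambda>g. \<bar>\<Phi> g x - \<Phi> g y\<bar>) ` topspace C)"
    if "x \<in> topspace X" "y \<in> topspace X" for x y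
  proof -
    have "continuous_map C euclideanreal (\<lambda>g. \<Phi> g x - \<Phi> g y)"
      using that by (intro continuous_intros jointly_continuous_left [OF \<Phi>])
    then obtain B where "\<And>g. g \<in> topspace C \<Longrightarrow> \<bar>\<Phi> g x - \<Phi> g y\<bar> \<le> B"
      using continuous_bounded [OF C] by blast
    then show ?thesis
      by (intro bdd_aboveI2)
  qed
  have le_d: "\<bar>\<Phi> g x - \<Phi> g y\<bar> \<le> d x y" if "g \<in> topspace C" "x \<in> topspace X" "y \<in> topspace X" for g x y
    unfolding d_def using that bdd by (intro cSUP_upper)
  have d_le: "d x y \<le> c" if "\<And>g. g \<in> topspace C \<Longrightarrow> \<bar>\<Phi> g x - \<Phi> g y\<bar> \<le> c" for x y c
    unfolding d_def using g0 that by (intro cSUP_least) auto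
  have "topspace C \<noteq> {}"
    using g0 by blast
  from cSUP_const [OF this, of "0::real"] have self: "d x x = 0" for x
    by (simp add: d_def)
  have sym: "d x y = d y x" for x y
    by (simp add: d_def abs_minus_commute)
  have tri: "d x z \<le> d x y + d y z"
    if "x \<in> topspace X" "y \<in> topspace X" "z \<in> topspace X" for x y z
  proof (rule d_le)
    fix g
    assume "g \<in> topspace C"
    then show "\<bar>\<Phi> g x - \<Phi> g z\<bar> \<le> d x y + d y z"
      using le_d [of g x y] le_d [of g y z] that by linarith
  qed
  have cont: "continuous_map X euclideanreal (d x)" if x: "x \<in> topspace X" for x
    unfolding continuous_map_real_iff
  proof (intro ballI allI impI)
    fix y and \<delta> :: real
    assume y: "y \<in> topspace X" and \<delta>: "\<delta> > 0"
    obtain U where U: "openin X U" "y \<in> U"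
      and near: "\<And>y' g. y' \<in> U \<Longrightarrow> g \<in> topspace C \<Longrightarrow> \<bar>\<Phi> g y' - \<Phi> g y\<bar> < \<delta> / 2"
      using jointly_continuous_uniform [OF C \<Phi> y, of "\<delta> / 2"] \<delta> by auto
    have "\<bar>d x y' - d x y\<bar> < \<delta>" if y': "y' \<in> U" for y'
    proof -
      have y'X: "y' \<in> topspace X"
        using U(1) y' openin_subset by blast
      have "d y' y \<le> \<delta> / 2"
        using near [OF y'] by (intro d_le) (simp add: less_imp_le)
      then show ?thesis
        using tri [OF x y'X y] tri [OF x y y'X] sym [of y y'] \<delta> by linarith
    qed
    then show "\<exists>U. openin X U \<and> y \<in> U \<and> (\<forall>y'\<in>U. \<bar>d x y' - d x y\<bar> < \<delta>)"
      using U by blast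
  qed
  obtain V where V: "finite V" "V \<subseteq> topspace X" "\<And>x. x \<in> topspace X \<Longrightarrow> \<exists>v\<in>V. d v x < \<epsilon> / 3"
    using pseudocompact_totally_bounded [where d = d and \<epsilon> = "\<epsilon> / 3", OF X cont self sym tri] \<epsilon> by auto
  have "\<exists>N. openin C N \<and> g0 \<in> N \<and> (\<forall>g\<in>N. \<bar>\<Phi> g v - \<Phi> g0 v\<bar> < \<epsilon> / 3)" if "v \<in> V" for v
  proof -
    have vX: "v \<in> topspace X" and pos: "\<epsilon> / 3 > 0"
      using that V(2) \<epsilon> by auto
    show ?thesis
      using continuous_map_realD [OF jointly_continuous_left [OF \<Phi> vX] g0 pos] by metis
  qed
  then obtain N where N: "\<And>v. v \<in> V \<Longrightarrow> openin C (N v)" "\<And>v. v \<in> V \<Longrightarrow> g0 \<in> N v"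
    "\<And>v g. v \<in> V \<Longrightarrow> g \<in> N v \<Longrightarrow> \<bar>\<Phi> g v - \<Phi> g0 v\<bar> < \<epsilon> / 3"
    by metis
  let ?N = "{g \<in> topspace C. \<forall>v\<in>V. g \<in> N v}"
  have "?N = topspace C \<inter> (\<Inter>v\<in>V. N v)"
    by auto
  moreover have "openin C (topspace C \<inter> (\<Inter>v\<in>V. N v))"
    using N(1) V(1) by (cases "V = {}") (auto intro: openin_Int openin_Inter)
  ultimately have "openin C ?N"
    by simp
  moreover have "g0 \<in> ?N"
    using g0 N(2) by blast
  moreover have "\<bar>\<Phi> g x - \<Phi> g0 x\<bar> \<le> \<epsilon>" if g: "g \<in> ?N" and x: "x \<in> topspace X" for g x
  proof -
    obtain v where v: "v \<in> V" "d v x < \<epsilon> / 3"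
      using V(3) [OF x] by blast
    have vX: "v \<in> topspace X" and gC: "g \<in> topspace C" and gN: "g \<in> N v"
      using v(1) V(2) g by auto
    show ?thesis
      using le_d [OF gC vX x] le_d [OF g0 vX x] N(3) [OF v(1) gN] v(2) by linarith
  qed
  ultimately show thesis
    using that by blast
qed

text \<open>
  The set of all \<open>g\<close> with \<open>sup \<bar>\<Phi> g x - \<Phi> g1 x\<bar> < \<epsilon>\<close> is relatively open in every compact set. The
  strict bound is phrased with some \<open>\<delta> < \<epsilon>\<close> to avoid the supremum.
\<close>

lemma k_space_uniform_neighbourhood:
  assumes T: "k_space T" and X: "pseudocompact_space X" and \<Phi>: "jointly_continuous T X \<Phi>"
    and g1: "g1 \<in> topspace T" and \<epsilon>: "\<epsilon> > 0"
  obtains U where "openin T U" "g1 \<in> U"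
    "\<And>g x. g \<in> U \<Longrightarrow> x \<in> topspace X \<Longrightarrow> \<bar>\<Phi> g x - \<Phi> g1 x\<bar> \<le> \<epsilon>"
proof -
  define U where "U = {g \<in> topspace T. \<exists>\<delta><\<epsilon>. \<forall>x\<in>topspace X. \<bar>\<Phi> g x - \<Phi> g1 x\<bar> \<le> \<delta>}"
  have "openin (subtopology T C) (C \<inter> U)" if C: "compactin T C" for C
  proof (subst openin_subopen, intro ballI)
    let ?C = "subtopology T C"
    have topC: "topspace ?C = C"
      using compactin_subset_topspace [OF C] by (simp add: Int_absorb1)
    have "continuous_map (prod_topology ?C X) T fst"
      using continuous_map_into_fulltopology [OF continuous_map_fst] .
    then have \<Phi>C: "jointly_continuous ?C X \<Phi>"
      by (intro jointly_continuous_compose [OF \<Phi>] continuous_map_snd)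
    fix g0
    assume g0: "g0 \<in> C \<inter> U"
    then obtain \<delta> where \<delta>: "\<delta> < \<epsilon>" "\<And>x. x \<in> topspace X \<Longrightarrow> \<bar>\<Phi> g0 x - \<Phi> g1 x\<bar> \<le> \<delta>"
      unfolding U_def by blast
    have "compact_space ?C" "g0 \<in> topspace ?C" "(\<epsilon> - \<delta>) / 2 > 0"
      using C g0 topC \<delta>(1) by (auto simp: compactin_subspace)
    from pseudocompact_equicontinuous [OF this(1) X \<Phi>C this(2,3)]
    obtain N where N: "openin ?C N" "g0 \<in> N"
      and near: "\<And>g x. g \<in> N \<Longrightarrow> x \<in> topspace X \<Longrightarrow> \<bar>\<Phi> g x - \<Phi> g0 x\<bar> \<le> (\<epsilon> - \<delta>) / 2"
      by blast
    have "N \<subseteq> C \<inter> U"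
    proof
      fix g
      assume g: "g \<in> N"
      have gC: "g \<in> C"
        using g openin_subset [OF N(1)] topC by blast
      have "\<bar>\<Phi> g x - \<Phi> g1 x\<bar> \<le> (\<epsilon> + \<delta>) / 2" if "x \<in> topspace X" for x
      proof -
        have "(\<epsilon> - \<delta>) / 2 + \<delta> = (\<epsilon> + \<delta>) / 2"
          by (simp add: field_simps)
        then show ?thesis
          using near [OF g that] \<delta>(2) [OF that] by linarith
      qed
      moreover have "(\<epsilon> + \<delta>) / 2 < \<epsilon>"
        using \<delta>(1) by simp
      ultimately show "g \<in> C \<inter> U"
        using gC compactin_subset_topspace [OF C] unfolding U_def by blast
    qed
    then show "\<exists>N. openin ?C N \<and> g0 \<in> N \<and> N \<subseteq> C \<inter> U"
      using N by blast
  qed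
  then have "openin T U"
    using T unfolding k_space_open by (simp add: U_def)
  moreover have "g1 \<in> U"
    using g1 \<epsilon> unfolding U_def by (auto intro!: exI [of _ 0])
  moreover have "\<bar>\<Phi> g x - \<Phi> g1 x\<bar> \<le> \<epsilon>" if "g \<in> U" "x \<in> topspace X" for g x
    using that unfolding U_def by force
  ultimately show thesis
    using that by blast
qed

section \<open>The action on the Stone-Cech compactification\<close>

lemma stone_cech_map_in: "x \<in> topspace X \<Longrightarrow> stone_cech_map X x \<in> topspace (stone_cech X)"
  using closure_of_subset [OF stone_cech_map_image [of X]] stone_cech_map_image [of X]
  by (auto simp: stone_cech_def)

lemma continuous_map_stone_cech_map: "continuous_map X (stone_cech X) (stone_cech_map X)"
  unfolding stone_cech_def continuous_map_in_subtopology
  using continuous_map_stone_cech_cube closure_of_subset [OF stone_cech_map_image [of X]] by blast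

lemma stone_cech_forall:
  assumes "closedin (stone_cech X) {z \<in> topspace (stone_cech X). P z}"
    and "\<And>x. x \<in> topspace X \<Longrightarrow> P (stone_cech_map X x)" and "z \<in> topspace (stone_cech X)"
  shows "P z"
proof (rule forall_in_closure_of [OF _ _ assms(1)])
  show "z \<in> stone_cech X closure_of (stone_cech_map X ` topspace X)"
    using assms(3) by (simp add: stone_cech_dense)
qed (use assms(2) in blast)

lemma stone_cech_eq:
  assumes Z: "Hausdorff_space Z" and f: "continuous_map (stone_cech X) Z f" and g: "continuous_map (stone_cech X) Z g"
    and eq: "\<And>x. x \<in> topspace X \<Longrightarrow> f (stone_cech_map X x) = g (stone_cech_map X x)"
    and z: "z \<in> topspace (stone_cech X)"
  shows "f z = g z"
proof (rule forall_in_closure_of_eq [OF _ Z f g])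
  show "z \<in> stone_cech X closure_of (stone_cech_map X ` topspace X)"
    using z by (simp add: stone_cech_dense)
qed (use eq in blast)

text \<open>
  Otherwise a continuous function that vanishes at \<open>z\<close> is positive on \<open>X\<close>; its reciprocal is bounded
  on \<open>X\<close> by pseudocompactness, so the function is bounded away from 0 on a dense set.
\<close>

lemma stone_cech_meets_zero_sets:
  assumes X: "pseudocompact_space X" and ne: "topspace X \<noteq> {}"
    and \<Phi>: "countable \<Phi>" "\<Phi> \<subseteq> real_maps (stone_cech X)"
    and z: "z \<in> topspace (stone_cech X)" and le: "\<And>\<phi>. \<phi> \<in> \<Phi> \<Longrightarrow> \<phi> z \<le> 0"
  shows "\<exists>x\<in>stone_cech_map X ` topspace X. \<forall>\<phi>\<in>\<Phi>. \<phi> x \<le> 0"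
proof (cases "\<Phi> = {}")
  case True
  then show ?thesis using ne by auto
next
  case False
  let ?K = "stone_cech X" and ?i = "stone_cech_map X"
  define \<psi> where "\<psi> n x = min 1 (max 0 (from_nat_into \<Phi> n x))" for n x
  have \<psi>: "0 \<le> \<psi> n x \<and> \<psi> n x \<le> 1" for n x
    by (simp add: \<psi>_def)
  have "continuous_map ?K euclideanreal (\<psi> n)" for n
  proof -
    have "continuous_map ?K euclideanreal (from_nat_into \<Phi> n)"
      using from_nat_into [OF False] \<Phi>(2) by blast
    then show ?thesis
      unfolding \<psi>_def by (intro continuous_intros) auto
  qed
  then have cont: "continuous_map ?K euclideanreal (half_series \<psi>)"
    using \<psi> by (intro continuous_map_half_series) auto
  have zero: "half_series \<psi> x = 0 \<longleftrightarrow> (\<forall>\<phi>\<in>\<Phi>. \<phi> x \<le> 0)" for x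
  proof -
    have "half_series \<psi> x = 0 \<longleftrightarrow> (\<forall>n. \<psi> n x = 0)"
      using half_series_eq_0 [of UNIV \<psi> x] \<psi> by simp
    also have "\<psi> n x = 0 \<longleftrightarrow> from_nat_into \<Phi> n x \<le> 0" for n
      unfolding \<psi>_def by linarith
    then have "(\<forall>n. \<psi> n x = 0) \<longleftrightarrow> (\<forall>n. from_nat_into \<Phi> n x \<le> 0)"
      by blast
    also have "\<dots> \<longleftrightarrow> (\<forall>\<phi>\<in>\<Phi>. \<phi> x \<le> 0)"
      using from_nat_into [OF False] from_nat_into_surj [OF \<Phi>(1)] by metis
    finally show ?thesis .
  qed
  show ?thesis
  proof (rule ccontr)
    assume neg: "\<not> ?thesis"
    have nz: "half_series \<psi> (?i x) \<noteq> 0" if "x \<in> topspace X" for x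
    proof -
      have "\<not> (\<forall>\<phi>\<in>\<Phi>. \<phi> (?i x) \<le> 0)"
        using neg that by blast
      then show ?thesis
        by (simp only: zero not_False_eq_True)
    qed
    have pos: "0 < half_series \<psi> (?i x)" if "x \<in> topspace X" for x
      using nz [OF that] half_series_nonneg [of UNIV \<psi> "?i x"] \<psi> by simp
    have "continuous_map X euclideanreal (\<lambda>x. half_series \<psi> (?i x))"
      using continuous_map_compose [OF continuous_map_stone_cech_map cont] by (simp add: o_def)
    then have "continuous_map X euclideanreal (\<lambda>x. inverse (half_series \<psi> (?i x)))"
      using nz by (intro continuous_map_real_inverse)
    then have "bounded ((\<lambda>x. inverse (half_series \<psi> (?i x))) ` topspace X)"
      using X by (simp add: pseudocompact_space_def)
    then obtain B where B: "B > 0" "\<And>x. x \<in> topspace X \<Longrightarrow> \<bar>inverse (half_series \<psi> (?i x))\<bar> \<le> B"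
      by (auto simp: bounded_pos)
    have "inverse B \<le> half_series \<psi> z"
    proof (rule stone_cech_forall [OF _ _ z])
      show "closedin ?K {z \<in> topspace ?K. inverse B \<le> half_series \<psi> z}"
        by (intro closedin_le cont) auto
      fix x
      assume x: "x \<in> topspace X"
      then have "inverse (half_series \<psi> (?i x)) \<le> B"
        using abs_le_D1 [OF B(2)] by blast
      then have "inverse B \<le> inverse (inverse (half_series \<psi> (?i x)))"
        using pos [OF x] by (intro le_imp_inverse_le) auto
      then show "inverse B \<le> half_series \<psi> (?i x)"
        by simp
    qed
    moreover have "half_series \<psi> z = 0"
      using zero le by blast
    ultimately show False
      using B(1) by simp
  qed
qed

text \<open>
  Each \<open>\<theta> g\<close> extends to the compactification. Identities and estimates for the extensions hold on
  the dense image of \<open>X\<close> and pass to the closure.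
\<close>

lemma stone_cech_homogeneous_compactum:
  fixes G :: "('g, 'm) monoid_scheme"
  assumes G: "semitopological_group G T" and narrow: "omega_narrow G T" and k: "k_space T"
    and X: "pseudocompact_space X" "topspace X \<noteq> {}"
    and tr: "transitive_action G (topspace X) \<theta>" and cont: "continuous_action T X \<theta>"
  obtains act where "homogeneous_compactum G (stone_cech X) (stone_cech_map X ` topspace X) act"
proof -
  let ?K = "stone_cech X" and ?i = "stone_cech_map X"
  have grp: "group G" and top: "topspace T = carrier G"
    using G by (auto simp: semitopological_group_def)
  interpret group G by (rule grp)
  interpret transitive_action G "topspace X" \<theta> by (rule tr)
  have \<theta>T: "continuous_map (prod_topology T X) X (\<lambda>p. \<theta> (fst p) (snd p))"
    using cont by (simp add: continuous_action_def case_prod_unfold)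
  have \<theta>: "continuous_map X X (\<theta> g)" if "g \<in> carrier G" for g
  proof -
    have "continuous_map X (prod_topology T X) (\<lambda>x. (g, x))"
      using that top by (intro continuous_map_pairedI) auto
    from continuous_map_compose [OF this \<theta>T] show ?thesis
      by (simp add: o_def)
  qed
  have \<theta>X: "\<theta> g x \<in> topspace X" if "g \<in> carrier G" "x \<in> topspace X" for g x
    using \<theta> [OF that(1)] that(2) by (auto simp: continuous_map_def)
  have "\<exists>k. continuous_map ?K ?K k \<and> (\<forall>x\<in>topspace X. k (?i x) = ?i (\<theta> g x))" if "g \<in> carrier G" for g
  proof -
    have "continuous_map X ?K (?i \<circ> \<theta> g)"
      using continuous_map_compose [OF \<theta> [OF that] continuous_map_stone_cech_map] .
    from stone_cech_extension [OF compact_space_stone_cech Hausdorff_space_stone_cech this]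
    show ?thesis by (metis comp_apply)
  qed
  then obtain act where act: "\<And>g. g \<in> carrier G \<Longrightarrow> continuous_map ?K ?K (act g)"
    and act_i: "\<And>g x. g \<in> carrier G \<Longrightarrow> x \<in> topspace X \<Longrightarrow> act g (?i x) = ?i (\<theta> g x)"
    by metis
  have near: "near_identity G ?K act F \<epsilon> \<subseteq> carrier G \<and>
      (\<exists>V. openin T V \<and> \<one>\<^bsub>G\<^esub> \<in> V \<and> V \<subseteq> near_identity G ?K act F \<epsilon>)"
    if F: "F \<in> real_maps ?K" and \<epsilon>: "\<epsilon> > 0" for F \<epsilon>
  proof -
    have Fc: "continuous_map ?K euclideanreal F"
      using F by simp
    have "jointly_continuous T X (\<lambda>g x. F (?i (\<theta> g x)))"
      using continuous_map_compose [OF \<theta>T continuous_map_compose [OF continuous_map_stone_cech_map Fc]]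
      by (simp add: o_def)
    from k_space_uniform_neighbourhood [OF k X(1) this, of "\<one>\<^bsub>G\<^esub>" \<epsilon>] \<epsilon> top
    obtain U where U: "openin T U" "\<one>\<^bsub>G\<^esub> \<in> U"
      and UF: "\<And>g x. g \<in> U \<Longrightarrow> x \<in> topspace X \<Longrightarrow> \<bar>F (?i (\<theta> g x)) - F (?i (\<theta> \<one>\<^bsub>G\<^esub> x))\<bar> \<le> \<epsilon>"
      by auto
    have "U \<subseteq> near_identity G ?K act F \<epsilon>"
    proof
      fix g
      assume gU: "g \<in> U"
      then have g: "g \<in> carrier G"
        using U(1) top openin_subset by blast
      have "\<bar>F (act g z) - F z\<bar> \<le> \<epsilon>" if "z \<in> topspace ?K" for z
      proof (rule stone_cech_forall [OF _ _ that])
        have "continuous_map ?K euclideanreal (\<lambda>z. F (act g z))"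
          using continuous_map_compose [OF act [OF g] Fc] by (simp add: o_def)
        then show "closedin ?K {z \<in> topspace ?K. \<bar>F (act g z) - F z\<bar> \<le> \<epsilon>}"
          using Fc by (intro closedin_le continuous_intros) auto
        fix x
        assume x: "x \<in> topspace X"
        have "\<theta> \<one>\<^bsub>G\<^esub> x = x"
          using id_eq_one x by (metis restrict_apply')
        then show "\<bar>F (act g (?i x)) - F (?i x)\<bar> \<le> \<epsilon>"
          using UF [OF gU x] act_i [OF g x] by simp
      qed
      then show "g \<in> near_identity G ?K act F \<epsilon>"
        using g by (simp add: near_identity_def)
    qed
    then show ?thesis
      using U by (auto simp: near_identity_def)
  qed
  have "homogeneous_compactum G ?K (?i ` topspace X) act"
  proof
    show "?i ` topspace X \<subseteq> topspace ?K"
      by (auto intro: stone_cech_map_in)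
    show "\<exists>x\<in>?i ` topspace X. \<forall>\<phi>\<in>\<Phi>. \<phi> x \<le> 0"
      if "countable \<Phi>" "\<Phi> \<subseteq> real_maps ?K" "z \<in> topspace ?K" "\<And>\<phi>. \<phi> \<in> \<Phi> \<Longrightarrow> \<phi> z \<le> 0" for \<Phi> z
      using that by (intro stone_cech_meets_zero_sets X)
    show "act (g \<otimes>\<^bsub>G\<^esub> h) z = act g (act h z)"
      if g: "g \<in> carrier G" and h: "h \<in> carrier G" and z: "z \<in> topspace ?K" for g h z
    proof (rule stone_cech_eq [OF Hausdorff_space_stone_cech _ _ _ z])
      show "continuous_map ?K ?K (act (g \<otimes>\<^bsub>G\<^esub> h))"
        using g h by (intro act) simp
      show "continuous_map ?K ?K (\<lambda>z. act g (act h z))"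
        using continuous_map_compose [OF act [OF h] act [OF g]] by (simp add: o_def)
      show "act (g \<otimes>\<^bsub>G\<^esub> h) (?i x) = act g (act h (?i x))" if "x \<in> topspace X" for x
        using composition_rule [OF that g h] g h that by (simp add: act_i \<theta>X)
    qed
    show "act \<one>\<^bsub>G\<^esub> z = z" if z: "z \<in> topspace ?K" for z
    proof (rule stone_cech_eq [OF Hausdorff_space_stone_cech _ _ _ z])
      show "continuous_map ?K ?K (act \<one>\<^bsub>G\<^esub>)"
        by (intro act) simp
      show "continuous_map ?K ?K (\<lambda>z. z)"
        by simp
      show "act \<one>\<^bsub>G\<^esub> (?i x) = ?i x" if "x \<in> topspace X" for x
        using act_i [OF one_closed that] id_eq_one that by (metis restrict_apply')
    qed
    show "\<exists>g\<in>carrier G. act g x = y" if xy: "x \<in> ?i ` topspace X" "y \<in> ?i ` topspace X" for x y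
    proof -
      obtain x' y' where x': "x' \<in> topspace X" "x = ?i x'" and y': "y' \<in> topspace X" "y = ?i y'"
        using xy by blast
      obtain g where "g \<in> carrier G" "\<theta> g x' = y'"
        using unique_orbit [OF x'(1) y'(1)] by blast
      then show ?thesis
        using act_i [of g x'] x' y' by auto
    qed
    show "\<exists>A\<subseteq>carrier G. countable A \<and> near_identity G ?K act F \<epsilon> <#>\<^bsub>G\<^esub> A = carrier G \<and>
        A <#>\<^bsub>G\<^esub> near_identity G ?K act F \<epsilon> = carrier G"
      if "F \<in> real_maps ?K" "\<epsilon> > 0" for F \<epsilon>
      using narrow near [OF that] unfolding omega_narrow_def by simp
  qed (use grp act compact_space_stone_cech in auto)
  then show thesis
    by (rule that)
qed

theorem theorem1p3:
  fixes G :: "('g, 'm) monoid_scheme"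
    and T :: "'g topology"
    and X :: "'x topology"
    and \<theta> :: "'g \<Rightarrow> 'x \<Rightarrow> 'x"
  assumes "semitopological_group G T"
    and "tychonoff_space T"
    and "omega_narrow G T"
    and "k_space T"
    and "tychonoff_space X"
    and "topspace X \<noteq> {}"
    and "pseudocompact_space X"
    and "transitive_action G (topspace X) \<theta>"
    and "continuous_action T X \<theta>"
  shows "dugundji_space TYPE('y) (stone_cech X)"
proof -
  obtain act where "homogeneous_compactum G (stone_cech X) (stone_cech_map X ` topspace X) act"
    using stone_cech_homogeneous_compactum [OF assms(1,3,4,7,6,8,9)] .
  then interpret homogeneous_compactum G "stone_cech X" "stone_cech_map X ` topspace X" act .
  obtain x where "x \<in> topspace X"
    using assms(6) by blast
  then show ?thesis
    by (intro dugundji [OF Hausdorff_space_stone_cech stone_cech_map_in])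
qed

end
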